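(* Let $\mathbf T=(T_1,\ldots,T_k)$ be an element of the regular polyball $\mathbf B_{\mathbf n}(\mathcal H)$ with trace class defect. Then the curvature $\mathrm{curv}(\mathbf T)$ exists (i.e. the limit defining it exists) and satisfies $$\mathrm{curv}(\mathbf T)=\lim_{(q_1,\ldots,q_k)\in\mathbb Z_+^k}\frac{\mathrm{trace}\left[\mathbf K_{\mathbf T}^*(P^{(1)}_{q_1}\otimes\cdots\otimes P^{(k)}_{q_k}\otimes I_{\mathcal D_{\mathbf T}})\mathbf K_{\mathbf T}\right]}{\mathrm{trace}\left[P^{(1)}_{q_1}\otimes\cdots\otimes P^{(k)}_{q_k}\right]}$$ $$=\lim_{m\to\infty}\frac{1}{\binom{m+k-1}{k-1}}\sum_{\substack{q_1\ge0,\ldots,q_k\ge0\\ q_1+\cdots+q_k=m}}\frac{\mathrm{trace}\left[\mathbf K_{\mathbf T}^*(P^{(1)}_{q_1}\otimes\cdots\otimes P^{(k)}_{q_k}\otimes I_{\mathcal D_{\mathbf T}})\mathbf K_{\mathbf T}\right]}{\mathrm{trace}\left[P^{(1)}_{q_1}\otimes\cdots\otimes P^{(k)}_{q_k}\right]}$$ $$=\lim_{q_1\to\infty}\cdots\lim_{q_k\to\infty}\frac{\mathrm{trace}\left[\mathbf K_{\mathbf T}^*(P_{\le(q_1,\ldots,q_k)}\otimes I_{\mathcal D_{\mathbf T}})\mathbf K_{\mathbf T}\right]}{\mathrm{trace}\left[P_{\le(q_1,\ldots,q_k)}\right]},$$ all these limits existing.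
   Context: All Hilbert spaces are complex; $\mathbb N=\{1,2,\ldots\}$, $\mathbb Z_+=\{0,1,\ldots\}$. Fix $k\in\mathbb N$ and $\mathbf n=(n_1,\ldots,n_k)\in\mathbb N^k$. For $X_i=(X_{i,1},\ldots,X_{i,n_i})\in B(\mathcal H)^{n_i}$ let $\Phi_{X_i}(Y)=\sum_{j=1}^{n_i}X_{i,j}YX_{i,j}^*$ for $Y\in B(\mathcal H)$. The regular polyball $\mathbf B_{\mathbf n}(\mathcal H)$ is the set of all $\mathbf X=(X_1,\ldots,X_k)$ with $X_i\in B(\mathcal H)^{n_i}$ such that every entry of $X_s$ commutes with every entry of $X_t$ whenever $s\ne t$ (entries of the same $X_s$ need not commute) and $(id-\Phi_{X_1})^{p_1}\circ\cdots\circ(id-\Phi_{X_k})^{p_k}(I)\ge0$ for all $(p_1,\ldots,p_k)\in\{0,1\}^k$. Put $\mathbf\Delta_{\mathbf X}=(id-\Phi_{X_1})\circ\cdots\circ(id-\Phi_{X_k})$. $\mathbf T\in\mathbf B_{\mathbf n}(\mathcal H)$ has trace class defect if $\mathbf\Delta_{\mathbf T}(I)$ is a trace class operator. Put $\mathcal D_{\mathbf T}=\overline{\mathbf\Delta_{\mathbf T}(I)\mathcal H}$. $F^2(H_{n_i})=\mathbb C1\oplus\bigoplus_{p\ge1}H_{n_i}^{\otimes p}$ is the full Fock space of an $n_i$-dimensional Hilbert space $H_{n_i}$ with orthonormal basis $e^i_1,\ldots,e^i_{n_i}$. $\mathbb F_{n_i}^+$ is the free unital semigroup on $n_i$ generators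 $g_1^i,\ldots,g_{n_i}^i$ with length $|\cdot|$; for $\alpha=g^i_{j_1}\cdots g^i_{j_p}$ put $e^i_\alpha=e^i_{j_1}\otimes\cdots\otimes e^i_{j_p}$ and $T_{i,\alpha}=T_{i,j_1}\cdots T_{i,j_p}$, while for the neutral element $e^i_\alpha=1$ and $T_{i,\alpha}=I$. The Berezin kernel of $\mathbf T$ is $\mathbf K_{\mathbf T}:\mathcal H\to F^2(H_{n_1})\otimes\cdots\otimes F^2(H_{n_k})\otimes\mathcal D_{\mathbf T}$, $$\mathbf K_{\mathbf T}h=\sum_{\beta_i\in\mathbb F_{n_i}^+,\,i=1,\ldots,k}e^1_{\beta_1}\otimes\cdots\otimes e^k_{\beta_k}\otimes\mathbf\Delta_{\mathbf T}(I)^{1/2}T_{1,\beta_1}^*\cdots T_{k,\beta_k}^*h.$$ $P^{(i)}_q$ is the orthogonal projection of $F^2(H_{n_i})$ onto the span of all $e^i_\alpha$ with $|\alpha|=q$. $P_{\le(q_1,\ldots,q_k)}$ is the orthogonal projection of $\bigotimes_{i=1}^kF^2(H_{n_i})$ onto the span of all $e^1_{\alpha_1}\otimes\cdots\otimes e^k_{\alpha_k}$ with $|\alpha_i|\le q_i$ for all $i$. The curvature of $\mathbf T$ is defined by $$\mathrm{curv}(\mathbf T):=\lim_{m\to\infty}\frac1{\binom{m+k}{k}}\sum_{\substack{q_1\ge0,\ldots,q_k\ge0\\ q_1+\cdots+q_k\le m}}\frac{\mathrm{trace}\left[\mathbf K_{\mathbf T}^*(P^{(1)}_{q_1}\otimes\cdots\otimes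 P^{(k)}_{q_k}\otimes I_{\mathcal D_{\mathbf T}})\mathbf K_{\mathbf T}\right]}{\mathrm{trace}\left[P^{(1)}_{q_1}\otimes\cdots\otimes P^{(k)}_{q_k}\right]}.$$ Limits over $\mathbb Z_+^k$ are limits of nets, $\mathbb Z_+^k$ being directed by the coordinatewise order. *)

theory Defs
  imports "HOL-Analysis.Analysis"
begin

section \<open>Complex Hilbert spaces\<close>

text \<open>HOL-Analysis only has real inner product spaces. A complex Hilbert space is a complete real
inner product space with a compatible complex structure; the complex inner product is linear in its
first argument, and the real one (hence the norm and the topology) is its real part.\<close>

class chilbert_space = real_inner + complete_space +
  fixes scaleC :: "complex \<Rightarrow> 'a \<Rightarrow> 'a" (infixr \<open>*\<^sub>C\<close> 75)
    and cinner :: "'a \<Rightarrow> 'a \<Rightarrow> complex"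
  assumes scaleC_add_right: "c *\<^sub>C (x + y) = c *\<^sub>C x + c *\<^sub>C y"
    and scaleC_add_left: "(c + d) *\<^sub>C x = c *\<^sub>C x + d *\<^sub>C x"
    and scaleC_scaleC: "c *\<^sub>C d *\<^sub>C x = (c * d) *\<^sub>C x"
    and scaleC_one: "1 *\<^sub>C x = x"
    and scaleR_scaleC: "scaleR r x = complex_of_real r *\<^sub>C x"
    and cinner_commute: "cinner x y = cnj (cinner y x)"
    and cinner_add_left: "cinner (x + y) z = cinner x z + cinner y z"
    and cinner_scaleC_left: "cinner (c *\<^sub>C x) y = c * cinner x y"
    and inner_cinner: "inner x y = Re (cinner x y)"

global_interpretation complex_vector:
  vector_space "scaleC :: complex \<Rightarrow> 'a \<Rightarrow> 'a::chilbert_space"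
  by unfold_locales (auto simp: scaleC_add_right scaleC_add_left scaleC_scaleC scaleC_one)

instantiation complex :: chilbert_space
begin
definition "scaleC_complex = ((*) :: complex \<Rightarrow> complex \<Rightarrow> complex)"
definition "cinner_complex = (\<lambda>x y :: complex. x * cnj y)"
instance
  by standard (auto simp: scaleC_complex_def cinner_complex_def algebra_simps
      scaleR_conv_of_real inner_complex_def)
end

lemma norm_scaleC: "norm (c *\<^sub>C x) = norm c * norm (x::'a::chilbert_space)"
proof -
  have r: "cinner y (c *\<^sub>C z) = cnj c * cinner y z" for c and y z :: 'a
    by (metis cinner_commute cinner_scaleC_left complex_cnj_mult)
  have i: "Im (cinner x x) = 0"
    using arg_cong[OF cinner_commute[of x x], of Im] by simp
  have "inner (c *\<^sub>C x) (c *\<^sub>C x) = (norm c)\<^sup>2 * inner x x"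
    unfolding cmod_power2
    by (simp add: inner_cinner r cinner_scaleC_left i power2_eq_square algebra_simps)
  then show ?thesis
    by (simp add: norm_eq_sqrt_inner real_sqrt_mult)
qed

section \<open>Operators\<close>

definition bounded_clinear :: "('a::chilbert_space \<Rightarrow> 'b::chilbert_space) \<Rightarrow> bool" where
  "bounded_clinear A \<longleftrightarrow>
     Vector_Spaces.linear scaleC scaleC A \<and> (\<exists>K. \<forall>x. norm (A x) \<le> K * norm x)"

definition cadjoint :: "('a::chilbert_space \<Rightarrow> 'b::chilbert_space) \<Rightarrow> 'b \<Rightarrow> 'a" where
  "cadjoint A = (THE B. \<forall>x y. cinner (A x) y = cinner x (B y))"

definition positive_op :: "('a::chilbert_space \<Rightarrow> 'a) \<Rightarrow> bool" where
  "positive_op A \<longleftrightarrow> bounded_clinear A \<and> (\<forall>x. cinner (A x) x \<in> \<real>\<^sub>\<ge>\<^sub>0)"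

definition sqrt_op :: "('a::chilbert_space \<Rightarrow> 'a) \<Rightarrow> 'a \<Rightarrow> 'a" where
  "sqrt_op A = (THE B. positive_op B \<and> B \<circ> B = A)"

definition abs_op :: "('a::chilbert_space \<Rightarrow> 'a) \<Rightarrow> 'a \<Rightarrow> 'a" where
  "abs_op A = sqrt_op (cadjoint A \<circ> A)"

definition is_onb :: "'a::chilbert_space set \<Rightarrow> bool" where
  "is_onb E \<longleftrightarrow> (\<forall>x\<in>E. \<forall>y\<in>E. cinner x y = (if x = y then 1 else 0)) \<and>
     closure (complex_vector.span E) = UNIV"

definition trace_class :: "('a::chilbert_space \<Rightarrow> 'a) \<Rightarrow> bool" where
  "trace_class A \<longleftrightarrow> bounded_clinear A \<and>
     (\<exists>E. is_onb E \<and> (\<lambda>e. cinner (abs_op A e) e) summable_on E)"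

text \<open>Meaningful for trace class operators, where the sum does not depend on the basis.\<close>

definition trace_op :: "('a::chilbert_space \<Rightarrow> 'a) \<Rightarrow> complex" where
  "trace_op A = (\<Sum>\<^sub>\<infinity>e\<in>(SOME E. is_onb E). cinner (A e) e)"

text \<open>Orthogonal projection onto a closed subspace.\<close>

definition proj :: "'a::chilbert_space set \<Rightarrow> 'a \<Rightarrow> 'a" where
  "proj M x = (THE y. y \<in> M \<and> (\<forall>z\<in>M. cinner (x - y) z = 0))"

section \<open>Hilbert sums and tensor products\<close>

text \<open>The type of square summable families \<open>(x\<^sub>i)\<close> of vectors. For scalar families it is
the space \<open>\<ell>\<^sup>2\<close> over the index type.\<close>

typedef (overloaded) ('i, 'h) hsum =
  "{f :: 'i \<Rightarrow> 'h::chilbert_space. (\<lambda>i. (norm (f i))\<^sup>2) summable_on UNIV}"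
  morphisms hnth Abs_hsum
  by (rule exI[of _ "\<lambda>_. 0"]) simp

setup_lifting type_definition_hsum

lemma hsum_summable: "(\<lambda>i. (norm (hnth x i))\<^sup>2) summable_on UNIV"
  using hnth[of x] by simp

lemma hsum_eqI: "(\<And>i. hnth x i = hnth y i) \<Longrightarrow> x = y"
  by (metis ext hnth_inject)

lemma square_summable_add:
  fixes f g :: "'i \<Rightarrow> 'h::real_normed_vector"
  assumes "(\<lambda>i. (norm (f i))\<^sup>2) summable_on A" "(\<lambda>i. (norm (g i))\<^sup>2) summable_on A"
  shows "(\<lambda>i. (norm (f i + g i))\<^sup>2) summable_on A"
proof (rule summable_on_comparison_test)
  show "(\<lambda>i. 2 * (norm (f i))\<^sup>2 + 2 * (norm (g i))\<^sup>2) summable_on A"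
    using assms by (intro summable_on_add summable_on_cmult_right)
  fix i
  have "(norm (f i + g i))\<^sup>2 \<le> (norm (f i) + norm (g i))\<^sup>2"
    by (intro power_mono norm_triangle_ineq norm_ge_zero)
  also have "\<dots> \<le> 2 * (norm (f i))\<^sup>2 + 2 * (norm (g i))\<^sup>2"
    using sum_squares_bound[of "norm (f i)" "norm (g i)"] by (simp add: power2_sum)
  finally show "(norm (f i + g i))\<^sup>2 \<le> 2 * (norm (f i))\<^sup>2 + 2 * (norm (g i))\<^sup>2" .
qed simp

lemma square_summable_scaleC:
  fixes f :: "'i \<Rightarrow> 'h::chilbert_space"
  assumes "(\<lambda>i. (norm (f i))\<^sup>2) summable_on A"
  shows "(\<lambda>i. (norm (c *\<^sub>C f i))\<^sup>2) summable_on A"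
  using summable_on_cmult_right[OF assms, of "(norm c)\<^sup>2"]
  by (simp add: norm_scaleC power_mult_distrib)

lemma norm_cinner_le: "norm (cinner x y) \<le> norm x * norm (y::'h::chilbert_space)"
proof (cases "cinner x y = 0")
  case False
  define c where "c = cnj (sgn (cinner x y))"
  have "norm (cinner x y) = Re (cinner (c *\<^sub>C x) y)"
  proof -
    have "cnj z * z = (complex_of_real (norm z))\<^sup>2" for z
      by (metis complex_norm_square mult.commute of_real_power)
    then have "c * cinner x y = complex_of_real (norm (cinner x y))"
      using False by (simp add: c_def sgn_eq power2_eq_square)
    then show ?thesis
      by (simp add: cinner_scaleC_left)
  qed
  also have "\<dots> \<le> norm (c *\<^sub>C x) * norm y"
    by (simp flip: inner_cinner) (rule norm_cauchy_schwarz)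
  also have "norm (c *\<^sub>C x) = norm x"
    using False by (simp add: norm_scaleC c_def norm_sgn)
  finally show ?thesis .
qed simp

lemma cinner_abs_summable:
  fixes f g :: "'i \<Rightarrow> 'h::chilbert_space"
  assumes "(\<lambda>i. (norm (f i))\<^sup>2) summable_on A" "(\<lambda>i. (norm (g i))\<^sup>2) summable_on A"
  shows "(\<lambda>i. norm (cinner (f i) (g i))) summable_on A"
proof (rule summable_on_comparison_test)
  show "(\<lambda>i. (norm (f i))\<^sup>2 + (norm (g i))\<^sup>2) summable_on A"
    using assms by (intro summable_on_add)
  fix i
  have "norm (cinner (f i) (g i)) \<le> norm (f i) * norm (g i)"
    by (rule norm_cinner_le)
  also have "\<dots> \<le> (norm (f i))\<^sup>2 + (norm (g i))\<^sup>2"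
    using sum_squares_bound[of "norm (f i)" "norm (g i)"]
      mult_nonneg_nonneg[OF norm_ge_zero norm_ge_zero, of "f i" "g i"] by linarith
  finally show "norm (cinner (f i) (g i)) \<le> (norm (f i))\<^sup>2 + (norm (g i))\<^sup>2" .
qed simp

lemma hsum_cinner_summable: "(\<lambda>i. cinner (hnth x i) (hnth y i)) summable_on UNIV"
  by (rule abs_summable_summable, rule cinner_abs_summable) (rule hsum_summable)+

instantiation hsum :: (type, chilbert_space) real_inner
begin

lift_definition zero_hsum :: "('a, 'b) hsum" is "\<lambda>_. 0"
  by simp
lift_definition plus_hsum :: "('a, 'b) hsum \<Rightarrow> ('a, 'b) hsum \<Rightarrow> ('a, 'b) hsum"
  is "\<lambda>f g i. f i + g i"
  by (rule square_summable_add)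
lift_definition uminus_hsum :: "('a, 'b) hsum \<Rightarrow> ('a, 'b) hsum" is "\<lambda>f i. - f i"
  by simp
lift_definition scaleR_hsum :: "real \<Rightarrow> ('a, 'b) hsum \<Rightarrow> ('a, 'b) hsum" is "\<lambda>r f i. scaleR r (f i)"
  unfolding scaleR_scaleC by (rule square_summable_scaleC)

definition minus_hsum :: "('a, 'b) hsum \<Rightarrow> ('a, 'b) hsum \<Rightarrow> ('a, 'b) hsum" where
  "x - y = x + - y" for x y :: "('a, 'b) hsum"
definition inner_hsum :: "('a, 'b) hsum \<Rightarrow> ('a, 'b) hsum \<Rightarrow> real" where
  "inner x y = (\<Sum>\<^sub>\<infinity>i. inner (hnth x i) (hnth y i))" for x y :: "('a, 'b) hsum"
definition norm_hsum :: "('a, 'b) hsum \<Rightarrow> real" where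
  "norm x = sqrt (inner x x)" for x :: "('a, 'b) hsum"
definition dist_hsum :: "('a, 'b) hsum \<Rightarrow> ('a, 'b) hsum \<Rightarrow> real" where
  "dist x y = norm (x - y)" for x y :: "('a, 'b) hsum"
definition sgn_hsum :: "('a, 'b) hsum \<Rightarrow> ('a, 'b) hsum" where
  "sgn x = scaleR (inverse (norm x)) x" for x :: "('a, 'b) hsum"
definition uniformity_hsum :: "(('a, 'b) hsum \<times> ('a, 'b) hsum) filter" where
  "uniformity_hsum = (INF e\<in>{0 <..}. principal {(x, y). dist x y < e})"
definition open_hsum :: "('a, 'b) hsum set \<Rightarrow> bool" where
  "open_hsum U = (\<forall>x\<in>U. eventually (\<lambda>(x', y). x' = x \<longrightarrow> y \<in> U) uniformity)"

instance
proof
  fix x y z :: "('a, 'b) hsum" and r s :: real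
  have s: "(\<lambda>i. inner (hnth u i) (hnth v i)) summable_on UNIV" for u v :: "('a, 'b) hsum"
    unfolding inner_cinner by (intro summable_on_Re hsum_cinner_summable)
  show "x + y + z = x + (y + z)" "x + y = y + x" "0 + x = x" "- x + x = 0"
    by (transfer, simp add: algebra_simps)+
  show "x - y = x + - y"
    by (rule minus_hsum_def)
  show "r *\<^sub>R (x + y) = r *\<^sub>R x + r *\<^sub>R y" "(r + s) *\<^sub>R x = r *\<^sub>R x + s *\<^sub>R x"
    "r *\<^sub>R s *\<^sub>R x = (r * s) *\<^sub>R x" "1 *\<^sub>R x = x"
    by (transfer, simp add: algebra_simps)+
  show "inner x y = inner y x"
    unfolding inner_hsum_def by (intro infsum_cong inner_commute)
  show "inner (x + y) z = inner x z + inner y z"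
    unfolding inner_hsum_def plus_hsum.rep_eq inner_add_left by (rule infsum_add[OF s s])
  show "inner (r *\<^sub>R x) y = r * inner x y"
    unfolding inner_hsum_def scaleR_hsum.rep_eq inner_scaleR_left by (rule infsum_cmult_right')
  show "0 \<le> inner x x"
    unfolding inner_hsum_def by (rule infsum_nonneg) simp
  show "inner x x = 0 \<longleftrightarrow> x = 0"
  proof
    assume "inner x x = 0"
    then have "(\<Sum>\<^sub>\<infinity>i. inner (hnth x i) (hnth x i)) \<le> 0"
      by (simp only: inner_hsum_def)
    then have "inner (hnth x i) (hnth x i) = 0" for i
      using s inner_ge_zero UNIV_I by (rule nonneg_infsum_le_0D)
    then show "x = 0"
      by (intro hsum_eqI) (simp add: zero_hsum.rep_eq)
  qed (simp add: inner_hsum_def zero_hsum.rep_eq)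
qed (rule norm_hsum_def dist_hsum_def sgn_hsum_def uniformity_hsum_def open_hsum_def)+

end

lemma hsum_norm_sq: "(norm x)\<^sup>2 = (\<Sum>\<^sub>\<infinity>i. (norm (hnth x i))\<^sup>2)"
  unfolding power2_norm_eq_inner inner_hsum_def ..

lemma hsum_partial_sum_le: "finite F \<Longrightarrow> (\<Sum>i\<in>F. (norm (hnth x i))\<^sup>2) \<le> (norm x)\<^sup>2"
  unfolding hsum_norm_sq by (rule finite_sum_le_infsum[OF hsum_summable]) simp_all

lemma hnth_diff: "hnth (x - y) i = hnth x i - hnth y i"
  unfolding minus_hsum_def plus_hsum.rep_eq uminus_hsum.rep_eq by simp

instance hsum :: (type, chilbert_space) complete_space
proof
  fix X :: "nat \<Rightarrow> ('a, 'b) hsum"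
  assume C: "Cauchy X"
  have le: "norm (hnth u i) \<le> norm u" for u :: "('a, 'b) hsum" and i
    using power2_le_imp_le[of "norm (hnth u i)" "norm u"] hsum_partial_sum_le[of "{i}" u]
    by simp
  have "dist (hnth u i) (hnth v i) \<le> dist u v" for u v :: "('a, 'b) hsum" and i
    using le[of "u - v" i] by (simp only: dist_norm hnth_diff)
  then have "Cauchy (\<lambda>m. hnth (X m) i)" for i
    using C unfolding Cauchy_def by (meson le_less_trans)
  then have "\<exists>l. (\<lambda>m. hnth (X m) i) \<longlonglongrightarrow> l" for i
    by (simp add: Cauchy_convergent_iff convergent_def)
  then obtain L where L: "\<And>i. (\<lambda>m. hnth (X m) i) \<longlonglongrightarrow> L i"
    by metis
  have bd: "\<exists>N. \<forall>m\<ge>N. \<forall>F. finite F \<longrightarrow> (\<Sum>i\<in>F. (norm (hnth (X m) i - L i))\<^sup>2) \<le> e\<^sup>2"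
    if "e > 0" for e
  proof -
    obtain N where N: "\<And>m n. m \<ge> N \<Longrightarrow> n \<ge> N \<Longrightarrow> norm (X m - X n) < e"
      using C \<open>e > 0\<close> unfolding Cauchy_def dist_norm by blast
    have "(\<Sum>i\<in>F. (norm (hnth (X m) i - L i))\<^sup>2) \<le> e\<^sup>2" if "m \<ge> N" "finite F" for m F
    proof (rule LIMSEQ_le_const2)
      show "(\<lambda>n. \<Sum>i\<in>F. (norm (hnth (X m) i - hnth (X n) i))\<^sup>2)
          \<longlonglongrightarrow> (\<Sum>i\<in>F. (norm (hnth (X m) i - L i))\<^sup>2)"
        by (intro tendsto_intros L)
      have "(\<Sum>i\<in>F. (norm (hnth (X m) i - hnth (X n) i))\<^sup>2) \<le> e\<^sup>2" if "n \<ge> N" for n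
      proof -
        have "(\<Sum>i\<in>F. (norm (hnth (X m) i - hnth (X n) i))\<^sup>2) \<le> (norm (X m - X n))\<^sup>2"
          using hsum_partial_sum_le[OF \<open>finite F\<close>, of "X m - X n"] by (simp add: hnth_diff)
        also have "\<dots> \<le> e\<^sup>2"
          using N[OF \<open>m \<ge> N\<close> that] by (intro power_mono) auto
        finally show ?thesis .
      qed
      then show "\<exists>N. \<forall>n\<ge>N. (\<Sum>i\<in>F. (norm (hnth (X m) i - hnth (X n) i))\<^sup>2) \<le> e\<^sup>2"
        by blast
    qed
    then show ?thesis by blast
  qed
  have summ: "(\<lambda>i. (norm (hnth (X m) i - L i))\<^sup>2) summable_on UNIV"
    if "\<forall>F. finite F \<longrightarrow> (\<Sum>i\<in>F. (norm (hnth (X m) i - L i))\<^sup>2) \<le> e\<^sup>2" for m e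
  proof (rule nonneg_bdd_above_summable_on)
    show "bdd_above (sum (\<lambda>i. (norm (hnth (X m) i - L i))\<^sup>2) ` {F. F \<subseteq> UNIV \<and> finite F})"
      by (rule bdd_aboveI2[where M = "e\<^sup>2"]) (use that in blast)
  qed (rule zero_le_power2)
  obtain N where "\<forall>F. finite F \<longrightarrow> (\<Sum>i\<in>F. (norm (hnth (X N) i - L i))\<^sup>2) \<le> 1\<^sup>2"
    using bd[OF zero_less_one] by blast
  then have "(\<lambda>i. (norm (hnth (X N) i + - (hnth (X N) i - L i)))\<^sup>2) summable_on UNIV"
    by (intro square_summable_add hsum_summable) (simp only: norm_minus_cancel, rule summ)
  then have Lsum: "(\<lambda>i. (norm (L i))\<^sup>2) summable_on UNIV"
    by simp
  define Y where "Y = Abs_hsum L"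
  have Y: "hnth Y = L"
    using Lsum by (simp add: Y_def Abs_hsum_inverse)
  have "X \<longlonglongrightarrow> Y"
  proof (rule metric_LIMSEQ_I)
    fix r :: real
    assume "r > 0"
    then obtain N where N: "\<And>m F. m \<ge> N \<Longrightarrow> finite F \<Longrightarrow>
        (\<Sum>i\<in>F. (norm (hnth (X m) i - L i))\<^sup>2) \<le> (r/2)\<^sup>2"
      using bd[OF half_gt_zero] by blast
    have "dist (X m) Y < r" if "m \<ge> N" for m
    proof -
      have "(norm (X m - Y))\<^sup>2 \<le> (r/2)\<^sup>2"
        unfolding hsum_norm_sq hnth_diff Y
        by (rule infsum_le_finite_sums) (use N[OF that] in \<open>blast intro: summ\<close>)+
      then have "norm (X m - Y) \<le> r/2"
        by (rule power2_le_imp_le) (use \<open>r > 0\<close> in simp)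
      then show ?thesis
        using \<open>r > 0\<close> by (simp add: dist_norm)
    qed
    then show "\<exists>N. \<forall>m\<ge>N. dist (X m) Y < r" by blast
  qed
  then show "convergent X"
    by (rule convergentI)
qed

instantiation hsum :: (type, chilbert_space) chilbert_space
begin

lift_definition scaleC_hsum :: "complex \<Rightarrow> ('a, 'b) hsum \<Rightarrow> ('a, 'b) hsum" is "\<lambda>c f i. c *\<^sub>C f i"
  by (rule square_summable_scaleC)
definition cinner_hsum :: "('a, 'b) hsum \<Rightarrow> ('a, 'b) hsum \<Rightarrow> complex" where
  "cinner x y = (\<Sum>\<^sub>\<infinity>i. cinner (hnth x i) (hnth y i))" for x y :: "('a, 'b) hsum"

instance
proof
  fix x y z :: "('a, 'b) hsum" and c d :: complex and r :: real
  show "c *\<^sub>C (x + y) = c *\<^sub>C x + c *\<^sub>C y" "(c + d) *\<^sub>C x = c *\<^sub>C x + d *\<^sub>C x"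
    "c *\<^sub>C d *\<^sub>C x = (c * d) *\<^sub>C x" "1 *\<^sub>C x = x" "r *\<^sub>R x = complex_of_real r *\<^sub>C x"
    by (transfer, simp add: scaleC_add_right scaleC_add_left scaleC_scaleC scaleC_one
        scaleR_scaleC)+
  show "cinner x y = cnj (cinner y x)"
    unfolding cinner_hsum_def infsum_cnj[symmetric] by (intro infsum_cong cinner_commute)
  show "cinner (x + y) z = cinner x z + cinner y z"
    unfolding cinner_hsum_def plus_hsum.rep_eq cinner_add_left
    by (rule infsum_add[OF hsum_cinner_summable hsum_cinner_summable])
  show "cinner (c *\<^sub>C x) y = c * cinner x y"
    unfolding cinner_hsum_def scaleC_hsum.rep_eq cinner_scaleC_left by (rule infsum_cmult_right')
  show "inner x y = Re (cinner x y)"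
    unfolding inner_hsum_def cinner_hsum_def inner_cinner
    by (rule infsum_Re[OF hsum_cinner_summable])
qed

end

text \<open>\<open>('i, 'h) hsum\<close> is the Hilbert space tensor product of \<open>('i, complex) hsum\<close> and \<open>'h\<close>.\<close>

lift_definition tensor :: "('i, complex) hsum \<Rightarrow> 'h \<Rightarrow> ('i, 'h::chilbert_space) hsum"
  is "\<lambda>u h i. u i *\<^sub>C h"
  by (simp add: norm_scaleC power_mult_distrib summable_on_cmult_left)

definition tensor_op :: "(('i, complex) hsum \<Rightarrow> ('i, complex) hsum) \<Rightarrow> ('h \<Rightarrow> 'h)
    \<Rightarrow> ('i, 'h::chilbert_space) hsum \<Rightarrow> ('i, 'h) hsum" where
  "tensor_op A B =
     (THE S. bounded_clinear S \<and> (\<forall>u h. S (tensor u h) = tensor (A u) (B h)))"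

lemma square_summable_prod:
  fixes x :: "'k::finite \<Rightarrow> 'w \<Rightarrow> complex"
  assumes "\<And>i. (\<lambda>w. (norm (x i w))\<^sup>2) summable_on UNIV"
  shows "(\<lambda>\<beta>. (norm (\<Prod>i\<in>UNIV. x i (\<beta> i)))\<^sup>2) summable_on UNIV"
proof (rule nonneg_bdd_above_summable_on)
  show "bdd_above (sum (\<lambda>\<beta>. (norm (\<Prod>i\<in>UNIV. x i (\<beta> i)))\<^sup>2) ` {F. F \<subseteq> UNIV \<and> finite F})"
  proof (rule bdd_aboveI2)
    fix F :: "('k \<Rightarrow> 'w) set"
    assume "F \<in> {F. F \<subseteq> UNIV \<and> finite F}"
    then have F: "finite F" by simp
    define G where "G i = (\<lambda>\<beta>. \<beta> i) ` F" for i
    have G: "finite (G i)" for i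
      using F by (simp add: G_def)
    have sub: "F \<subseteq> PiE UNIV G"
      by (auto simp: G_def)
    have "(\<Sum>\<beta>\<in>F. (norm (\<Prod>i\<in>UNIV. x i (\<beta> i)))\<^sup>2)
        = (\<Sum>\<beta>\<in>F. \<Prod>i\<in>UNIV. (norm (x i (\<beta> i)))\<^sup>2)"
      by (simp add: prod_norm[symmetric] prod_power_distrib)
    also have "\<dots> \<le> (\<Sum>\<beta>\<in>PiE UNIV G. \<Prod>i\<in>UNIV. (norm (x i (\<beta> i)))\<^sup>2)"
      using sub G by (intro sum_mono2 finite_PiE) (auto intro: prod_nonneg)
    also have "\<dots> = (\<Prod>i\<in>UNIV. \<Sum>w\<in>G i. (norm (x i w))\<^sup>2)"
      using G by (subst prod_sum_PiE) auto
    also have "\<dots> \<le> (\<Prod>i\<in>UNIV. \<Sum>\<^sub>\<infinity>w. (norm (x i w))\<^sup>2)"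
      using G assms by (intro prod_mono conjI finite_sum_le_infsum sum_nonneg) auto
    finally show "(\<Sum>\<beta>\<in>F. (norm (\<Prod>i\<in>UNIV. x i (\<beta> i)))\<^sup>2)
        \<le> (\<Prod>i\<in>UNIV. \<Sum>\<^sub>\<infinity>w. (norm (x i w))\<^sup>2)" .
  qed
qed simp

text \<open>\<open>('k \<Rightarrow> 'w, complex) hsum\<close> is the tensor product over \<open>i :: 'k\<close> of copies of
\<open>('w, complex) hsum\<close>.\<close>

lift_definition Tensor :: "('k::finite \<Rightarrow> ('w, complex) hsum) \<Rightarrow> ('k \<Rightarrow> 'w, complex) hsum"
  is "\<lambda>x \<beta>. \<Prod>i\<in>UNIV. x i (\<beta> i)"
  by (rule square_summable_prod) auto

definition Tensor_op :: "('k::finite \<Rightarrow> ('w, complex) hsum \<Rightarrow> ('w, complex) hsum)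
    \<Rightarrow> ('k \<Rightarrow> 'w, complex) hsum \<Rightarrow> ('k \<Rightarrow> 'w, complex) hsum" where
  "Tensor_op A = (THE S. bounded_clinear S \<and> (\<forall>x. S (Tensor x) = Tensor (\<lambda>i. A i (x i))))"

section \<open>Fock spaces\<close>

text \<open>A word in the generators \<open>g\<^sub>1, \<dots>, g\<^sub>m\<close> is a list over \<open>{1..m}\<close>, and the full Fock space
of an \<open>m\<close>-dimensional Hilbert space is the closed span in \<open>(nat list, complex) hsum\<close> of the
orthonormal vectors \<open>fock_basis w\<close> for such words \<open>w\<close>. The ambient type is larger; operators on
the Fock space are extended by zero to its orthogonal complement, which affects neither traces nor
products with operators ranging in the Fock space.\<close>

lift_definition fock_basis :: "nat list \<Rightarrow> (nat list, complex) hsum"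
  is "\<lambda>w v. if v = w then 1 else 0"
  by (rule finite_nonzero_values_imp_summable_on) simp

definition fock_proj :: "nat \<Rightarrow> nat \<Rightarrow> (nat list, complex) hsum \<Rightarrow> (nat list, complex) hsum" where
  "fock_proj m q =
     proj (complex_vector.span (fock_basis ` {w \<in> lists {1..m}. length w = q}))"

definition tensor_proj :: "('k::finite \<Rightarrow> nat) \<Rightarrow> ('k \<Rightarrow> nat)
    \<Rightarrow> ('k \<Rightarrow> nat list, complex) hsum \<Rightarrow> ('k \<Rightarrow> nat list, complex) hsum" where
  "tensor_proj n q = Tensor_op (\<lambda>i. fock_proj (n i) (q i))"

definition tensor_proj_le :: "('k::finite \<Rightarrow> nat) \<Rightarrow> ('k \<Rightarrow> nat)
    \<Rightarrow> ('k \<Rightarrow> nat list, complex) hsum \<Rightarrow> ('k \<Rightarrow> nat list, complex) hsum" where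
  "tensor_proj_le n q = proj (complex_vector.span
     ((\<lambda>\<alpha>. Tensor (\<lambda>i. fock_basis (\<alpha> i))) `
        {\<alpha>. \<forall>i. \<alpha> i \<in> lists {1..n i} \<and> length (\<alpha> i) \<le> q i}))"

section \<open>The regular polyball and the curvature\<close>

text \<open>A finite linearly ordered type \<open>'k\<close> plays the role of \<open>{1, \<dots>, k}\<close>. A tuple has entries
\<open>X i j\<close> for \<open>j \<in> {1..n i}\<close>; values at other \<open>j\<close> are irrelevant.\<close>

definition indices :: "'k::{finite,linorder} list" where
  "indices = sorted_list_of_set UNIV"

definition Phi :: "nat \<Rightarrow> (nat \<Rightarrow> 'h \<Rightarrow> 'h) \<Rightarrow> ('h::chilbert_space \<Rightarrow> 'h) \<Rightarrow> 'h \<Rightarrow> 'h" where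
  "Phi m X Y = (\<lambda>h. \<Sum>j=1..m. X j (Y (cadjoint (X j) h)))"

definition id_minus_Phi :: "nat \<Rightarrow> (nat \<Rightarrow> 'h \<Rightarrow> 'h) \<Rightarrow> ('h::chilbert_space \<Rightarrow> 'h) \<Rightarrow> 'h \<Rightarrow> 'h" where
  "id_minus_Phi m X Y = (\<lambda>h. Y h - Phi m X Y h)"

definition Delta_pow :: "('k::{finite,linorder} \<Rightarrow> nat) \<Rightarrow> ('k \<Rightarrow> nat)
    \<Rightarrow> ('k \<Rightarrow> nat \<Rightarrow> 'h \<Rightarrow> 'h) \<Rightarrow> ('h::chilbert_space \<Rightarrow> 'h) \<Rightarrow> 'h \<Rightarrow> 'h" where
  "Delta_pow n p X = foldr (\<lambda>i. (id_minus_Phi (n i) (X i)) ^^ (p i)) indices"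

definition Delta :: "('k::{finite,linorder} \<Rightarrow> nat) \<Rightarrow> ('k \<Rightarrow> nat \<Rightarrow> 'h \<Rightarrow> 'h)
    \<Rightarrow> ('h::chilbert_space \<Rightarrow> 'h) \<Rightarrow> 'h \<Rightarrow> 'h" where
  "Delta n X = foldr (\<lambda>i. id_minus_Phi (n i) (X i)) indices"

definition regular_polyball ::
    "('k::{finite,linorder} \<Rightarrow> nat) \<Rightarrow> ('k \<Rightarrow> nat \<Rightarrow> 'h::chilbert_space \<Rightarrow> 'h) set" where
  "regular_polyball n = {X.
     (\<forall>i. \<forall>j\<in>{1..n i}. bounded_clinear (X i j)) \<and>
     (\<forall>s t. s \<noteq> t \<longrightarrow>
        (\<forall>j\<in>{1..n s}. \<forall>l\<in>{1..n t}. X s j \<circ> X t l = X t l \<circ> X s j)) \<and>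
     (\<forall>p. (\<forall>i. p i \<in> {0, 1}) \<longrightarrow> positive_op (Delta_pow n p X id))}"

definition trace_class_defect ::
    "('k::{finite,linorder} \<Rightarrow> nat) \<Rightarrow> ('k \<Rightarrow> nat \<Rightarrow> 'h::chilbert_space \<Rightarrow> 'h) \<Rightarrow> bool" where
  "trace_class_defect n T \<longleftrightarrow> trace_class (Delta n T id)"

definition defect_space ::
    "('k::{finite,linorder} \<Rightarrow> nat) \<Rightarrow> ('k \<Rightarrow> nat \<Rightarrow> 'h::chilbert_space \<Rightarrow> 'h) \<Rightarrow> 'h set" where
  "defect_space n T = closure (range (Delta n T id))"

definition word_op :: "(nat \<Rightarrow> 'h \<Rightarrow> 'h) \<Rightarrow> nat list \<Rightarrow> 'h \<Rightarrow> 'h" where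
  "word_op X w = foldr X w"

text \<open>The values of the Berezin kernel lie in the subspace (tensor product of the Fock spaces and
the defect space) of \<open>('k \<Rightarrow> nat list, 'h) hsum\<close>.\<close>

definition berezin_kernel :: "('k::{finite,linorder} \<Rightarrow> nat)
    \<Rightarrow> ('k \<Rightarrow> nat \<Rightarrow> 'h \<Rightarrow> 'h) \<Rightarrow> 'h::chilbert_space \<Rightarrow> ('k \<Rightarrow> nat list, 'h) hsum" where
  "berezin_kernel n T h =
     (\<Sum>\<^sub>\<infinity>\<beta>\<in>{\<beta>. \<forall>i. \<beta> i \<in> lists {1..n i}}.
        tensor (Tensor (\<lambda>i. fock_basis (\<beta> i)))
          (sqrt_op (Delta n T id)
             (foldr (\<lambda>i. cadjoint (word_op (T i) (\<beta> i))) indices h)))"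

text \<open>The identity of the defect space, extended by zero, is the orthogonal projection onto it.\<close>

definition berezin_compression :: "('k::{finite,linorder} \<Rightarrow> nat)
    \<Rightarrow> ('k \<Rightarrow> nat \<Rightarrow> 'h \<Rightarrow> 'h)
    \<Rightarrow> (('k \<Rightarrow> nat list, complex) hsum \<Rightarrow> ('k \<Rightarrow> nat list, complex) hsum)
    \<Rightarrow> 'h::chilbert_space \<Rightarrow> 'h" where
  "berezin_compression n T P =
     cadjoint (berezin_kernel n T) \<circ> tensor_op P (proj (defect_space n T)) \<circ> berezin_kernel n T"

definition trace_ratio :: "('k::{finite,linorder} \<Rightarrow> nat)
    \<Rightarrow> ('k \<Rightarrow> nat \<Rightarrow> 'h::chilbert_space \<Rightarrow> 'h)
    \<Rightarrow> (('k \<Rightarrow> nat list, complex) hsum \<Rightarrow> ('k \<Rightarrow> nat list, complex) hsum) \<Rightarrow> complex" where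
  "trace_ratio n T P = trace_op (berezin_compression n T P) / trace_op P"

definition curv_mean :: "('k::{finite,linorder} \<Rightarrow> nat)
    \<Rightarrow> ('k \<Rightarrow> nat \<Rightarrow> 'h::chilbert_space \<Rightarrow> 'h) \<Rightarrow> nat \<Rightarrow> complex" where
  "curv_mean n T m =
     1 / of_nat ((m + CARD('k)) choose CARD('k)) *
     (\<Sum>q | (\<Sum>i\<in>UNIV. q i) \<le> m. trace_ratio n T (tensor_proj n q))"

definition curv :: "('k::{finite,linorder} \<Rightarrow> nat)
    \<Rightarrow> ('k \<Rightarrow> nat \<Rightarrow> 'h::chilbert_space \<Rightarrow> 'h) \<Rightarrow> complex" where
  "curv n T = lim (curv_mean n T)"

text \<open>\<open>has_iterated_limit [i\<^sub>1, \<dots>, i\<^sub>k] f q c\<close>: the limit of \<open>f\<close> as the \<open>i\<^sub>1\<close>-coordinate (outermost),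
\<dots>, the \<open>i\<^sub>k\<close>-coordinate (innermost) tend to infinity exists, including all inner limits, and
equals \<open>c\<close>; the other coordinates are those of \<open>q\<close> (none are left if all indices are listed).\<close>

fun has_iterated_limit ::
    "'k list \<Rightarrow> (('k \<Rightarrow> nat) \<Rightarrow> 'a::topological_space) \<Rightarrow> ('k \<Rightarrow> nat) \<Rightarrow> 'a \<Rightarrow> bool" where
  "has_iterated_limit [] f q c \<longleftrightarrow> f q = c"
| "has_iterated_limit (i # is) f q c \<longleftrightarrow>
     (\<exists>g. (\<forall>m. has_iterated_limit is f (q(i := m)) (g m)) \<and> g \<longlonglongrightarrow> c)"

end

theory Submission
  imports Defs
begin

text \<open>Write \<open>D\<close> for the defect operator and
\<open>C\<^sub>\<beta> = D\<^sup>1\<^sup>/\<^sup>2 T\<^sub>1\<^sub>,\<^sub>\<beta>\<^sub>1\<^sup>* \<cdots> T\<^sub>k\<^sub>,\<^sub>\<beta>\<^sub>k\<^sup>*\<close> for the coefficients of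
the Berezin kernel. The trace belonging to the multidegree \<open>q\<close> is the sum of the squared
Hilbert-Schmidt norms of the \<open>C\<^sub>\<beta>\<close> with \<open>|\<beta>\<^sub>i| = q\<^sub>i\<close>. Since the operators \<open>T\<^sub>i\<^sub>,\<^sub>j\<close> are
contractions and operators from different tuples commute, raising \<open>q\<^sub>i\<close> by one multiplies this
trace by at most \<open>n\<^sub>i\<close>. Hence the trace ratio is a nonnegative antitone net and converges to its
infimum. The other expressions are weighted averages of this net whose weights on every slab
\<open>{s. s\<^sub>i = t}\<close> vanish in the limit, so they have the same limit. The averages over boxes are again
antitone, so that all inner limits of the iterated limit exist.\<close>

section \<open>Averages of antitone nets\<close>

text \<open>The comparison of neighbouring degrees depends on where the new letter goes. Prepending
  \<open>j\<close> to the \<open>i\<close>-th word turns \<open>C_\<beta>\<close> into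
  \<open>C_\<beta> T_ij^*\<close>: inside its own tuple the new adjoint acts first, and it commutes
  with the adjoints of the tuples to its right. The contraction thus stands to the right of the
  coefficient, where it cannot be estimated basis vector by basis vector; invariance of the
  Hilbert-Schmidt norm under adjoints moves it to the left. The trace class hypothesis enters
  through the Hilbert-Schmidt property of \<open>D^(1/2)\<close>. Positivity of the partial defects
  serves twice: for one index it makes the operators contractions, and for the suffixes of the index
  list it drives a telescoping argument showing that the Berezin kernel is itself a contraction, so
  that its defining sum converges and its adjoint exists. Adjoints, square roots, projections and
  tensor products are defined by descriptions, and the basis in the trace is an arbitrary choice.
  Each object therefore needs existence and uniqueness before it can be computed; afterwards
  everything is read off in the coordinates of \<open>hsum\<close>.\<close>

lemma antimono_fun_steps:
  fixes r :: "('k::finite \<Rightarrow> nat) \<Rightarrow> real"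
  assumes step: "\<And>q i. r (q(i := Suc (q i))) \<le> r q" and "q \<le> q'"
  shows "r q' \<le> r q"
  using \<open>q \<le> q'\<close>
proof (induction "\<Sum>i\<in>UNIV. q' i - q i" arbitrary: q rule: less_induct)
  case less
  show ?case
  proof (cases "q = q'")
    case False
    then obtain i where i: "q i \<noteq> q' i" by (auto simp: fun_eq_iff)
    have le: "q l \<le> q' l" for l using less.prems by (simp add: le_fun_def)
    then have lt: "q i < q' i" using i by (simp add: order_le_neq_trans)
    let ?p = "q(i := Suc (q i))"
    have "(\<Sum>l\<in>UNIV. q' l - ?p l) < (\<Sum>l\<in>UNIV. q' l - q l)"
    proof (rule sum_strict_mono_ex1)
      show "\<exists>l\<in>UNIV. q' l - ?p l < q' l - q l" using lt by (intro bexI[of _ i]) auto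
    qed auto
    moreover have "?p \<le> q'" using le lt by (auto simp: le_fun_def)
    ultimately have "r q' \<le> r ?p" using less.hyps by blast
    then show ?thesis using step[of q i] by linarith
  qed simp
qed

lemma eventually_at_top_funI:
  fixes q0 :: "'k \<Rightarrow> nat"
  assumes "\<And>q. q0 \<le> q \<Longrightarrow> P q"
  shows "eventually P at_top"
  unfolding at_top_def
  by (rule eventually_INF1[of q0]) (use assms in \<open>auto simp: eventually_principal\<close>)

text \<open>Choose \<open>q0\<close> with \<open>r q0\<close> close to \<open>c\<close>. Points
  above \<open>q0\<close> are harmless by antitonicity; all others lie in the finitely many slabs
  \<open>s i = t\<close> with \<open>t < q0 i\<close>, whose total share of the weight vanishes, and
  there \<open>r - c\<close> is at most its value at the origin. The filter and the sets are kept
  general so that simplices and boxes are covered at once.\<close>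

lemma tendsto_averages:
  fixes r :: "('k::finite \<Rightarrow> nat) \<Rightarrow> real" and w :: "'x \<Rightarrow> ('k \<Rightarrow> nat) \<Rightarrow> real"
  assumes anti: "\<And>p q. p \<le> q \<Longrightarrow> r q \<le> r p" and lower: "\<And>q. c \<le> r q"
    and approx: "\<And>e. e > 0 \<Longrightarrow> \<exists>q. r q < c + e"
    and w: "\<And>x s. 0 \<le> w x s" and pos: "\<And>x. 0 < sum (w x) (S x)"
    and slab: "\<And>i t. ((\<lambda>x. (\<Sum>s\<in>{s \<in> S x. s i = t}. w x s) / sum (w x) (S x)) \<longlongrightarrow> 0) F"
  shows "((\<lambda>x. (\<Sum>s\<in>S x. w x s * r s) / sum (w x) (S x)) \<longlongrightarrow> c) F"
  unfolding tendsto_iff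
proof (intro allI impI)
  fix e :: real assume e: "e > 0"
  obtain q0 where q0: "r q0 < c + e / 2" using approx[of "e / 2"] e by auto
  \<comment> \<open>A sum over an infinite set is 0 by convention, so a positive total weight forces
    finiteness.\<close>
  have fin: "finite (S x)" for x
    using pos[of x] by (metis less_irrefl sum.infinite)
  define B where "B = r (\<lambda>_. 0) - c"
  have B: "0 \<le> B" using lower by (simp add: B_def)
  define \<sigma> where "\<sigma> x i t = (\<Sum>s\<in>{s \<in> S x. s i = t}. w x s) / sum (w x) (S x)" for x i t
  \<comment> \<open>The double sum counts the coordinates with \<open>s i < q0 i\<close>. It is at
    least 1 unless \<open>s\<close> lies above \<open>q0\<close>, and then \<open>B\<close>, the
    largest value of \<open>r - c\<close>, takes over.\<close>
  have pt: "r s - c \<le> e / 2 + B * (\<Sum>i\<in>UNIV. \<Sum>t<q0 i. of_bool (s i = t))" for s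
  proof (cases "q0 \<le> s")
    case True
    then have "r s - c \<le> e / 2" using anti[OF True] q0 by simp
    also have "\<dots> \<le> e / 2 + B * (\<Sum>i\<in>UNIV. \<Sum>t<q0 i. of_bool (s i = t))"
      using B by (simp add: sum_nonneg)
    finally show ?thesis .
  next
    case False
    then obtain i where i: "s i < q0 i" by (auto simp: le_fun_def not_le)
    have "(1::real) = (\<Sum>t\<in>{s i}. of_bool (s i = t))" by simp
    also have "\<dots> \<le> (\<Sum>t<q0 i. of_bool (s i = t))" using i by (intro sum_mono2) auto
    also have "\<dots> \<le> (\<Sum>i\<in>UNIV. \<Sum>t<q0 i. of_bool (s i = t))"
      by (rule member_le_sum[of i UNIV "\<lambda>i. \<Sum>t<q0 i. of_bool (s i = t)"]) (auto intro: sum_nonneg)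
    finally have "B * 1 \<le> B * (\<Sum>i\<in>UNIV. \<Sum>t<q0 i. of_bool (s i = t))"
      using B by (rule mult_left_mono)
    moreover have "r s - c \<le> B" using anti[of "\<lambda>_. 0" s] by (simp add: B_def le_fun_def)
    ultimately show ?thesis using e by simp
  qed
  have upper: "(\<Sum>s\<in>S x. w x s * r s) / sum (w x) (S x) - c
      \<le> e / 2 + B * (\<Sum>i\<in>UNIV. \<Sum>t<q0 i. \<sigma> x i t)" for x
  proof -
    let ?W = "sum (w x) (S x)"
    have "(\<Sum>s\<in>S x. w x s * r s) - c * ?W = (\<Sum>s\<in>S x. w x s * (r s - c))"
      by (simp add: right_diff_distrib sum_subtractf sum_distrib_left mult.commute)
    also have "\<dots> \<le> (\<Sum>s\<in>S x. w x s * (e / 2 + B * (\<Sum>i\<in>UNIV. \<Sum>t<q0 i. of_bool (s i = t))))"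
      by (intro sum_mono mult_left_mono pt w)
    also have "\<dots> = e / 2 * ?W + B * (\<Sum>s\<in>S x. \<Sum>i\<in>UNIV. \<Sum>t<q0 i. w x s * of_bool (s i = t))"
      by (simp add: distrib_left sum.distrib sum_distrib_left sum_distrib_right mult_ac)
    also have "(\<Sum>s\<in>S x. \<Sum>i\<in>UNIV. \<Sum>t<q0 i. w x s * of_bool (s i = t))
        = (\<Sum>i\<in>UNIV. \<Sum>t<q0 i. \<Sum>s\<in>S x. w x s * of_bool (s i = t))"
      by (subst sum.swap) (intro sum.cong refl sum.swap)
    also have "\<dots> = (\<Sum>i\<in>UNIV. \<Sum>t<q0 i. \<sigma> x i t * ?W)"
    proof (intro sum.cong refl)
      fix i t
      have "(\<Sum>s\<in>S x. w x s * of_bool (s i = t)) = (\<Sum>s\<in>{s \<in> S x. s i = t}. w x s)"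
        by (simp add: sum.inter_filter[OF fin] of_bool_def if_distrib cong: if_cong)
      then show "(\<Sum>s\<in>S x. w x s * of_bool (s i = t)) = \<sigma> x i t * ?W"
        using pos[of x] by (simp add: \<sigma>_def)
    qed
    also have "e / 2 * ?W + B * \<dots> = (e / 2 + B * (\<Sum>i\<in>UNIV. \<Sum>t<q0 i. \<sigma> x i t)) * ?W"
      by (simp only: distrib_right sum_distrib_right[symmetric] mult.assoc)
    finally show ?thesis using pos[of x] by (simp add: field_simps)
  qed
  have "((\<lambda>x. e / 2 + B * (\<Sum>i\<in>UNIV. \<Sum>t<q0 i. \<sigma> x i t)) \<longlongrightarrow> e / 2 + B * (\<Sum>i\<in>(UNIV::'k set). \<Sum>t<q0 i. 0)) F"
    unfolding \<sigma>_def by (intro tendsto_intros slab)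
  then have "eventually (\<lambda>x. e / 2 + B * (\<Sum>i\<in>UNIV. \<Sum>t<q0 i. \<sigma> x i t) < e) F"
    by (rule order_tendstoD) (use e in simp)
  then show "eventually (\<lambda>x. dist ((\<Sum>s\<in>S x. w x s * r s) / sum (w x) (S x)) c < e) F"
  proof (rule eventually_mono)
    fix x assume lt: "e / 2 + B * (\<Sum>i\<in>UNIV. \<Sum>t<q0 i. \<sigma> x i t) < e"
    have "(\<Sum>s\<in>S x. w x s * c) \<le> (\<Sum>s\<in>S x. w x s * r s)"
      by (intro sum_mono mult_left_mono lower w)
    then have "c \<le> (\<Sum>s\<in>S x. w x s * r s) / sum (w x) (S x)"
      using pos[of x] by (simp add: field_simps sum_distrib_left)
    then show "dist ((\<Sum>s\<in>S x. w x s * r s) / sum (w x) (S x)) c < e"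
      using upper[of x] lt by (simp add: dist_real_def)
  qed
qed

subsection \<open>Simplices\<close>

text \<open>Reduces counting functions with a given total to the stars and bars count of lists,
  \<open>card_length_sum_list\<close>.\<close>

lemma bij_betw_map_functions:
  assumes "distinct xs" "set xs = (UNIV :: 'k set)"
  shows "bij_betw (\<lambda>f :: 'k \<Rightarrow> nat. map f xs) {f. sum_list (map f xs) = m} {l. length l = length xs \<and> sum_list l = m}"
proof (rule bij_betw_imageI)
  show "inj_on (\<lambda>f :: 'k \<Rightarrow> nat. map f xs) {f. sum_list (map f xs) = m}"
    using assms by (auto intro!: inj_onI simp: fun_eq_iff)
  show "(\<lambda>f :: 'k \<Rightarrow> nat. map f xs) ` {f. sum_list (map f xs) = m} = {l. length l = length xs \<and> sum_list l = m}"
  proof (intro equalityI subsetI)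
    fix l :: "nat list" assume l: "l \<in> {l. length l = length xs \<and> sum_list l = m}"
    define f where "f = (\<lambda>x. the (map_of (zip xs l) x))"
    have "map f xs = l"
      using l assms(1) by (intro nth_equalityI) (auto simp: f_def map_of_zip_nth)
    then show "l \<in> (\<lambda>f. map f xs) ` {f. sum_list (map f xs) = m}" using l by force
  qed auto
qed

lemma obtain_enumeration:
  obtains xs :: "'k::finite list" where "distinct xs" "set xs = UNIV" "length xs = CARD('k)"
    "\<And>f :: 'k \<Rightarrow> nat. sum_list (map f xs) = (\<Sum>i\<in>UNIV. f i)"
proof -
  obtain xs :: "'k list" where xs: "set xs = UNIV" "distinct xs"
    using finite_distinct_list[of "UNIV :: 'k set"] by auto
  moreover have "sum_list (map f xs) = (\<Sum>i\<in>UNIV. f i)" for f :: "'k \<Rightarrow> nat"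
    using xs sum_list_distinct_conv_sum_set by metis
  moreover have "length xs = CARD('k)" using xs distinct_card by metis
  ultimately show thesis using that by blast
qed

lemma finite_card_simplex_boundary:
  "finite {q :: 'k::finite \<Rightarrow> nat. (\<Sum>i\<in>UNIV. q i) = m} \<and>
   card {q :: 'k::finite \<Rightarrow> nat. (\<Sum>i\<in>UNIV. q i) = m} = (m + CARD('k) - 1) choose m"
proof -
  obtain xs :: "'k list" where xs: "distinct xs" "set xs = UNIV" "length xs = CARD('k)"
    "\<And>f :: 'k \<Rightarrow> nat. sum_list (map f xs) = (\<Sum>i\<in>UNIV. f i)"
    using obtain_enumeration by blast
  note b = bij_betw_map_functions[OF xs(1,2), of m, unfolded xs(3,4)]
  have c: "card {l. length l = CARD('k) \<and> sum_list l = m} = (m + CARD('k) - 1) choose m"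
    by (rule card_length_sum_list)
  have "finite {l :: nat list. length l = CARD('k) \<and> sum_list l = m}"
    by (rule finite_subset[OF _ finite_lists_length_eq[of "{..m}" "CARD('k)"]])
      (auto dest: member_le_sum_list)
  then show ?thesis using bij_betw_finite[OF b] bij_betw_same_card[OF b] c by simp
qed

text \<open>Deleting the known coordinate \<open>i\<close> leaves a tuple with one entry less and
  total \<open>m - t\<close>. Only an inequality is claimed: for \<open>t > m\<close> the slab is
  empty, while truncated subtraction makes the right-hand side 1.\<close>

lemma card_simplex_boundary_slab_le:
  "card {q :: 'k::finite \<Rightarrow> nat. (\<Sum>l\<in>UNIV. q l) = m \<and> q i = t} \<le> (m - t + (CARD('k) - 1) - 1) choose (m - t)"
proof -
  obtain xs :: "'k list" where xs: "distinct xs" "set xs = UNIV" "length xs = CARD('k)"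
    "\<And>f :: 'k \<Rightarrow> nat. sum_list (map f xs) = (\<Sum>i\<in>UNIV. f i)"
    using obtain_enumeration by blast
  let ?ys = "remove1 i xs" and ?A = "{q :: 'k \<Rightarrow> nat. (\<Sum>l\<in>UNIV. q l) = m \<and> q i = t}"
  have ys: "set ?ys = UNIV - {i}" "length ?ys = CARD('k) - 1"
    using xs by (auto simp: length_remove1)
  have s: "sum_list (map q xs) = q i + sum_list (map q ?ys)" for q :: "'k \<Rightarrow> nat"
    using xs(2) by (simp add: sum_list_map_remove1)
  have inj: "inj_on (\<lambda>q. map q ?ys) ?A"
  proof (rule inj_onI)
    fix p q :: "'k \<Rightarrow> nat" assume "p \<in> ?A" "q \<in> ?A" "map p ?ys = map q ?ys"
    then have "p l = q l" for l using ys(1) by (cases "l = i") auto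
    then show "p = q" by (rule ext)
  qed
  have fin: "finite {l :: nat list. length l = CARD('k) - 1 \<and> sum_list l = m - t}"
    by (rule finite_subset[OF _ finite_lists_length_eq[of "{..m - t}" "CARD('k) - 1"]])
      (auto dest: member_le_sum_list)
  have "card ?A \<le> card {l :: nat list. length l = CARD('k) - 1 \<and> sum_list l = m - t}"
    by (rule card_inj_on_le[OF inj _ fin]) (use ys(2) s xs(4) in auto)
  also have "\<dots> = (m - t + (CARD('k) - 1) - 1) choose (m - t)"
    by (rule card_length_sum_list)
  finally show ?thesis .
qed

lemma card_simplex_boundary:
  "card {q :: 'k::finite \<Rightarrow> nat. (\<Sum>i\<in>UNIV. q i) = m} = (m + CARD('k) - 1) choose (CARD('k) - 1)"
proof -
  have "0 < CARD('k)" by simp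
  then obtain j where j: "CARD('k) = Suc j" by (auto simp: gr0_conv_Suc)
  show ?thesis
    using finite_card_simplex_boundary[where 'k='k, of m] binomial_symmetric[of m "m + j"] by (simp add: j)
qed

text \<open>The layers of exact total \<open>j \<le> m\<close> are disjoint, and their sizes add up
  by the hockey stick identity \<open>sum_choose_lower\<close>.\<close>

lemma card_simplex:
  "card {q :: 'k::finite \<Rightarrow> nat. (\<Sum>i\<in>UNIV. q i) \<le> m} = (m + CARD('k)) choose CARD('k)"
proof -
  let ?B = "\<lambda>j. {q :: 'k \<Rightarrow> nat. (\<Sum>i\<in>UNIV. q i) = j}"
  have eq: "{q :: 'k \<Rightarrow> nat. (\<Sum>i\<in>UNIV. q i) \<le> m} = (\<Union>j\<in>{..m}. ?B j)" by auto
  have fin: "finite (?B j)" for j using finite_card_simplex_boundary by blast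
  have k: "0 < CARD('k)" by simp
  have "card (\<Union>j\<in>{..m}. ?B j) = (\<Sum>j\<le>m. card (?B j))"
    by (rule card_UN_disjoint) (use fin in auto)
  also have "\<dots> = (\<Sum>j\<le>m. ((CARD('k) - 1) + j) choose j)"
    by (intro sum.cong refl) (use k in \<open>simp add: finite_card_simplex_boundary add.commute\<close>)
  also have "\<dots> = (m + CARD('k)) choose m"
    unfolding sum_choose_lower using k by (simp add: add.commute)
  also have "\<dots> = (m + CARD('k)) choose CARD('k)"
    using binomial_symmetric[of m "m + CARD('k)"] by simp
  finally show "card {q :: 'k \<Rightarrow> nat. (\<Sum>i\<in>UNIV. q i) \<le> m} = (m + CARD('k)) choose CARD('k)"
    unfolding eq .
qed

text \<open>A slab has one dimension less. With \<open>j + 2\<close> coordinates it has at most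
  \<open>(m + j) choose j\<close> points, and absorption compares this with
  \<open>(m + j + 1) choose (j + 1)\<close> at the cost of the factor
  \<open>(j + 1) / m\<close>.\<close>

lemma card_simplex_boundary_slab_ratio:
  assumes "t < m"
  shows "real (card {q :: 'k::finite \<Rightarrow> nat. (\<Sum>l\<in>UNIV. q l) = m \<and> q i = t})
      / real ((m + CARD('k) - 1) choose (CARD('k) - 1)) \<le> real CARD('k) / real m"
proof -
  let ?c = "card {q :: 'k \<Rightarrow> nat. (\<Sum>l\<in>UNIV. q l) = m \<and> q i = t}"
  have m: "0 < m" and k: "0 < CARD('k)" using assms by auto
  have "?c * m \<le> CARD('k) * ((m + CARD('k) - 1) choose (CARD('k) - 1))"
  proof (cases "CARD('k) - 1")
    \<comment> \<open>With a single coordinate the total \<open>m\<close> forces the value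
      \<open>m\<close>, so the slab at \<open>t < m\<close> is empty.\<close>
    case 0
    then have "?c = 0" using card_simplex_boundary_slab_le[where 'k='k, of m i t] assms
      unfolding 0 by (simp add: binomial_eq_0)
    then show ?thesis by simp
  next
    case (Suc j)
    have K: "CARD('k) = Suc (Suc j)" using Suc by linarith
    have "?c \<le> (m - t + j) choose (m - t)"
      using card_simplex_boundary_slab_le[where 'k='k, of m i t] unfolding K by simp
    also have "\<dots> = (m - t + j) choose j" using binomial_symmetric[of "m - t" "m - t + j"] by simp
    also have "\<dots> \<le> (m + j) choose j" by (rule binomial_right_mono) simp
    finally have "?c * m \<le> ((m + j) choose j) * (m + Suc j)" by (intro mult_mono) auto
    also have "\<dots> = Suc j * ((m + Suc j) choose Suc j)"
      using binomial_absorption[of j "m + Suc j"] by (simp add: mult.commute)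
    also have "\<dots> \<le> CARD('k) * ((m + Suc j) choose Suc j)"
      unfolding K by (intro mult_right_mono) auto
    finally show ?thesis unfolding K by simp
  qed
  then have "real ?c * real m \<le> real CARD('k) * real ((m + CARD('k) - 1) choose (CARD('k) - 1))"
    unfolding of_nat_mult[symmetric] of_nat_le_iff .
  moreover have "0 < (m + CARD('k) - 1) choose (CARD('k) - 1)" using m by simp
  ultimately show ?thesis using m by (simp add: divide_le_eq le_divide_eq mult.commute)
qed

text \<open>Adding the missing amount \<open>m - \<Sum> q\<close> to coordinate \<open>i\<close>
  sends the slab into the boundary simplex, injectively because the old value \<open>t\<close> of
  that coordinate is known. By absorption the boundary makes up the fraction
  \<open>k / (m + k)\<close> of the simplex, where \<open>k = CARD('k)\<close>.\<close>

lemma card_simplex_slab_ratio: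
  assumes "0 < m"
  shows "real (card {q :: 'k::finite \<Rightarrow> nat. (\<Sum>l\<in>UNIV. q l) \<le> m \<and> q i = t})
      / real ((m + CARD('k)) choose CARD('k)) \<le> real CARD('k) / real m"
proof -
  let ?A = "{q :: 'k \<Rightarrow> nat. (\<Sum>l\<in>UNIV. q l) \<le> m \<and> q i = t}"
  let ?B = "{q :: 'k \<Rightarrow> nat. (\<Sum>l\<in>UNIV. q l) = m}"
  let ?f = "\<lambda>q :: 'k \<Rightarrow> nat. q(i := q i + (m - (\<Sum>l\<in>UNIV. q l)))"
  have inj: "inj_on ?f ?A"
  proof (rule inj_onI)
    fix p q assume p: "p \<in> ?A" and q: "q \<in> ?A" and eq: "?f p = ?f q"
    have "p i = q i" using p q by simp
    moreover have "p l = q l" if "l \<noteq> i" for l using fun_cong[OF eq, of l] that by simp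
    ultimately have "p l = q l" for l by (cases "l = i") simp_all
    then show "p = q" by (rule ext)
  qed
  have im: "?f ` ?A \<subseteq> ?B"
  proof clarify
    fix q :: "'k \<Rightarrow> nat" assume le: "(\<Sum>l\<in>UNIV. q l) \<le> m"
    have "(\<Sum>l\<in>UNIV. ?f q l) = ?f q i + (\<Sum>l\<in>UNIV - {i}. ?f q l)"
      by (rule sum.remove) auto
    also have "(\<Sum>l\<in>UNIV - {i}. ?f q l) = (\<Sum>l\<in>UNIV - {i}. q l)" by (intro sum.cong) auto
    also have "?f q i + \<dots> = (\<Sum>l\<in>UNIV. q l) + (m - (\<Sum>l\<in>UNIV. q l))"
      using sum.remove[of UNIV i q] by simp
    finally show "(\<Sum>l\<in>UNIV. ?f q l) = m" using le by simp
  qed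
  have "card ?A \<le> card ?B"
    by (rule card_inj_on_le[OF inj im]) (use finite_card_simplex_boundary in blast)
  then have "card ?A * (m + CARD('k)) \<le> ((m + CARD('k) - 1) choose (CARD('k) - 1)) * (m + CARD('k))"
    unfolding card_simplex_boundary by (intro mult_right_mono) auto
  also have "\<dots> = CARD('k) * ((m + CARD('k)) choose CARD('k))"
    using binomial_absorption[of "CARD('k) - 1" "m + CARD('k)"] by (simp add: mult.commute)
  finally have "card ?A * m \<le> CARD('k) * ((m + CARD('k)) choose CARD('k))"
    by (simp add: distrib_left)
  then have "real (card ?A) * real m \<le> real CARD('k) * real ((m + CARD('k)) choose CARD('k))"
    unfolding of_nat_mult[symmetric] of_nat_le_iff .
  moreover have "0 < (m + CARD('k)) choose CARD('k)" by simp
  ultimately show ?thesis using assms by (simp add: divide_le_eq le_divide_eq mult.commute)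
qed

context
  fixes r :: "('k::finite \<Rightarrow> nat) \<Rightarrow> real" and c :: real
  assumes anti: "\<And>p q. p \<le> q \<Longrightarrow> r q \<le> r p" and lower: "\<And>q. c \<le> r q"
    and approx: "\<And>e. e > 0 \<Longrightarrow> \<exists>q. r q < c + e"
begin

lemma antitone_net_tendsto: "(r \<longlongrightarrow> c) at_top"
  unfolding tendsto_iff
proof (intro allI impI)
  fix e :: real assume "e > 0"
  then obtain q0 where q0: "r q0 < c + e" using approx by blast
  show "eventually (\<lambda>q. dist (r q) c < e) at_top"
  proof (rule eventually_at_top_funI[of q0])
    fix q assume "q0 \<le> q"
    then have "r q \<le> r q0" by (rule anti)
    then show "dist (r q) c < e" using q0 lower[of q] by (simp add: dist_real_def)
  qed
qed

lemma simplex_averages_tendsto: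
  "(\<lambda>m. (\<Sum>q | (\<Sum>i\<in>UNIV. q i) \<le> m. r q) / real ((m + CARD('k)) choose CARD('k))) \<longlonglongrightarrow> c"
proof -
  let ?S = "\<lambda>m. {q :: 'k \<Rightarrow> nat. (\<Sum>i\<in>UNIV. q i) \<le> m}"
  have W: "(\<Sum>s\<in>?S m. 1::real) = real ((m + CARD('k)) choose CARD('k))" for m
    by (simp add: card_simplex)
  have "(\<lambda>m. (\<Sum>s\<in>?S m. 1 * r s) / (\<Sum>s\<in>?S m. 1)) \<longlonglongrightarrow> c"
  proof (rule tendsto_averages[where w = "\<lambda>_ _. 1 :: real", OF anti lower approx])
    show "0 < (\<Sum>s\<in>?S m. 1::real)" for m unfolding W by simp
    show "(\<lambda>m. (\<Sum>s\<in>{s \<in> ?S m. s i = t}. 1) / (\<Sum>s\<in>?S m. 1::real)) \<longlonglongrightarrow> 0" for i t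
    proof (rule tendsto_sandwich[OF _ _ tendsto_const lim_const_over_n])
      show "\<forall>\<^sub>F m in sequentially. (\<Sum>s\<in>{s \<in> ?S m. s i = t}. 1) / (\<Sum>s\<in>?S m. 1) \<le> real CARD('k) / real m"
        using eventually_gt_at_top[of 0]
        by eventually_elim (use card_simplex_slab_ratio[where 'k='k] in \<open>simp add: card_simplex\<close>)
    qed (simp add: sum_nonneg)
  qed simp_all
  then show ?thesis unfolding W mult_1 .
qed

lemma simplex_boundary_averages_tendsto:
  "(\<lambda>m. (\<Sum>q | (\<Sum>i\<in>UNIV. q i) = m. r q) / real ((m + CARD('k) - 1) choose (CARD('k) - 1))) \<longlonglongrightarrow> c"
proof -
  let ?S = "\<lambda>m. {q :: 'k \<Rightarrow> nat. (\<Sum>i\<in>UNIV. q i) = m}"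
  have W: "(\<Sum>s\<in>?S m. 1::real) = real ((m + CARD('k) - 1) choose (CARD('k) - 1))" for m
    by (simp add: card_simplex_boundary)
  have "(\<lambda>m. (\<Sum>s\<in>?S m. 1 * r s) / (\<Sum>s\<in>?S m. 1)) \<longlonglongrightarrow> c"
  proof (rule tendsto_averages[where w = "\<lambda>_ _. 1 :: real", OF anti lower approx])
    have "CARD('k) - 1 \<le> m + CARD('k) - 1" for m by simp
    then show "0 < (\<Sum>s\<in>?S m. 1::real)" for m unfolding W by (simp only: of_nat_0_less_iff zero_less_binomial_iff)
    show "(\<lambda>m. (\<Sum>s\<in>{s \<in> ?S m. s i = t}. 1) / (\<Sum>s\<in>?S m. 1::real)) \<longlonglongrightarrow> 0" for i t
    proof (rule tendsto_sandwich[OF _ _ tendsto_const lim_const_over_n])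
      show "\<forall>\<^sub>F m in sequentially. (\<Sum>s\<in>{s \<in> ?S m. s i = t}. 1) / (\<Sum>s\<in>?S m. 1) \<le> real CARD('k) / real m"
        using eventually_gt_at_top[of t]
        by eventually_elim (use card_simplex_boundary_slab_ratio[where 'k='k] in \<open>simp add: card_simplex_boundary\<close>)
    qed (simp add: sum_nonneg)
  qed simp_all
  then show ?thesis unfolding W mult_1 .
qed

end

subsection \<open>Boxes and iterated limits\<close>

lemma PiE_UNIV_eq: "Pi\<^sub>E UNIV W = {\<beta>. \<forall>i. \<beta> i \<in> W i}"
  by (auto simp: PiE_def)

lemma finite_atMost_fun: "finite {..q :: 'k::finite \<Rightarrow> nat}"
proof -
  have "{..q} = Pi\<^sub>E UNIV (\<lambda>i. {..q i})" unfolding PiE_UNIV_eq by (auto simp: le_fun_def)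
  then show ?thesis by (simp add: finite_PiE)
qed

text \<open>Fubini for one coordinate. The points with \<open>s i = 0\<close> represent the lines in
  direction \<open>i\<close>, so that the other coordinates remain functions on the same index
  type.\<close>

lemma sum_atMost_slabs:
  fixes q :: "'k::finite \<Rightarrow> nat" and g :: "('k \<Rightarrow> nat) \<Rightarrow> real"
  shows "(\<Sum>s\<le>q. g s) = (\<Sum>u\<le>q i. \<Sum>s\<in>{s. s \<le> q \<and> s i = 0}. g (s(i := u)))"
proof -
  let ?B = "{s. s \<le> q \<and> s i = 0}" and ?f = "\<lambda>(u, s). s(i := u)"
  have im: "{..q} = ?f ` ({..q i} \<times> ?B)"
  proof (intro equalityI subsetI)
    fix s assume "s \<in> {..q}"
    then have "(s i, s(i := 0)) \<in> {..q i} \<times> ?B" by (simp add: le_fun_def)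
    moreover have "s = ?f (s i, s(i := 0))" by simp
    ultimately show "s \<in> ?f ` ({..q i} \<times> ?B)" by (rule rev_image_eqI)
  qed (auto simp: le_fun_def)
  have inj: "inj_on ?f ({..q i} \<times> ?B)"
  proof (rule inj_onI, clarify)
    fix u s v t assume s: "s i = 0" and t: "t i = 0" and eq: "s(i := u) = t(i := v)"
    have "s l = t l" for l using fun_cong[OF eq, of l] s t by (cases "l = i") simp_all
    moreover have "u = v" using fun_cong[OF eq, of i] by simp
    ultimately show "u = v \<and> s = t" by (simp add: fun_eq_iff)
  qed
  have "(\<Sum>s\<le>q. g s) = (\<Sum>(u, s)\<in>{..q i} \<times> ?B. g (s(i := u)))"
    unfolding im by (subst sum.reindex[OF inj]) (simp only: o_def case_prod_unfold)
  then show ?thesis by (simp only: sum.cartesian_product)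
qed

text \<open>This is the number of tuples of words with lengths \<open>s\<close>, that is, the trace
  of the projection of multidegree \<open>s\<close>.\<close>

definition word_weight :: "('k::finite \<Rightarrow> nat) \<Rightarrow> ('k \<Rightarrow> nat) \<Rightarrow> real" where
  "word_weight n s = (\<Prod>i\<in>UNIV. real (n i) ^ s i)"

text \<open>Numerator and denominator of the ratio for \<open>tensor_proj_le\<close> both add up
  over the exact degrees below \<open>q\<close>; when \<open>r\<close> is the ratio for exact
  degrees, this weighted mean is therefore the ratio for the box.\<close>

definition box_average :: "('k::finite \<Rightarrow> nat) \<Rightarrow> (('k \<Rightarrow> nat) \<Rightarrow> real) \<Rightarrow> ('k \<Rightarrow> nat) \<Rightarrow> real" where
  "box_average n r q = (\<Sum>s\<le>q. word_weight n s * r s) / (\<Sum>s\<le>q. word_weight n s)"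

lemma word_weight_update:
  assumes "s i = 0"
  shows "word_weight n (s(i := u)) = real (n i) ^ u * word_weight n s"
proof -
  have "word_weight n (s(i := u)) = real (n i) ^ u * (\<Prod>l\<in>UNIV - {i}. real (n l) ^ s l)"
    unfolding word_weight_def by (subst prod.remove[of UNIV i]) simp_all
  moreover have "word_weight n s = (\<Prod>l\<in>UNIV - {i}. real (n l) ^ s l)"
    unfolding word_weight_def using assms by (subst prod.remove[of UNIV i]) simp_all
  ultimately show ?thesis by simp
qed

context
  fixes n :: "'k::finite \<Rightarrow> nat"
  assumes n: "\<And>i. 1 \<le> n i"
begin

lemma word_weight_pos: "0 < word_weight n s"
  unfolding word_weight_def using n by (intro prod_pos) (simp add: Suc_le_eq)

lemma sum_word_weight_pos: "0 < (\<Sum>s\<le>q. word_weight n s)"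
  by (rule sum_pos) (auto simp: finite_atMost_fun word_weight_pos)

text \<open>If \<open>b\<close> is the weight of the slab at 0, the slab at \<open>u\<close> weighs
  \<open>n i ^ u * b\<close>. As \<open>n i \<ge> 1\<close>, each of the \<open>q i + 1\<close>
  slabs weighs at least \<open>b\<close>. This crude count also covers \<open>n i = 1\<close>, where
  the weights do not grow with \<open>u\<close>.\<close>

lemma box_slab_ratio:
  "(\<Sum>s\<in>{s \<in> {..q}. s i = t}. word_weight n s) / (\<Sum>s\<le>q. word_weight n s)
    \<le> real (n i) ^ t / real (Suc (q i))"
proof -
  let ?B = "{s. s \<le> q \<and> s i = 0}"
  define b where "b = (\<Sum>s\<in>?B. word_weight n s)"
  have b: "0 \<le> b" unfolding b_def by (intro sum_nonneg less_imp_le word_weight_pos)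
  have pow: "1 \<le> real (n i) ^ u" for u using n[of i] by (intro one_le_power) simp
  have W: "(\<Sum>s\<le>q. word_weight n s) = (\<Sum>u\<le>q i. real (n i) ^ u * b)"
    unfolding sum_atMost_slabs[of _ q i] b_def sum_distrib_left
    by (intro sum.cong refl) (simp add: word_weight_update)
  have "real (Suc (q i)) * b = (\<Sum>u\<le>q i. 1 * b)" by simp
  also have "\<dots> \<le> (\<Sum>s\<le>q. word_weight n s)"
    unfolding W by (intro sum_mono mult_right_mono pow b)
  finally have bW: "real (Suc (q i)) * b \<le> (\<Sum>s\<le>q. word_weight n s)" .
  have "(\<Sum>s\<in>{s \<in> {..q}. s i = t}. word_weight n s) = (\<Sum>s\<le>q. if s i = t then word_weight n s else 0)"
    by (rule sum.inter_filter[OF finite_atMost_fun])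
  also have "\<dots> = (\<Sum>u\<le>q i. if u = t then real (n i) ^ t * b else 0)"
    unfolding sum_atMost_slabs[of _ q i] b_def sum_distrib_left
    by (intro sum.cong refl) (auto simp: word_weight_update intro!: sum.cong)
  also have "\<dots> \<le> real (n i) ^ t * b" using b by (simp add: sum.delta)
  finally have "(\<Sum>s\<in>{s \<in> {..q}. s i = t}. word_weight n s) * real (Suc (q i))
      \<le> (real (n i) ^ t * b) * real (Suc (q i))" by (rule mult_right_mono) simp
  also have "\<dots> = real (n i) ^ t * (real (Suc (q i)) * b)" by (simp only: mult_ac)
  also have "\<dots> \<le> real (n i) ^ t * (\<Sum>s\<le>q. word_weight n s)"
    by (intro mult_left_mono bW) simp
  finally show ?thesis using sum_word_weight_pos[of q] by (simp add: divide_le_eq le_divide_eq mult.commute)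
qed

text \<open>Raising \<open>q i\<close> by one adds a single slab. By antitonicity of
  \<open>r\<close> its mean is at most the mean of each slab already present, and including a
  smaller value cannot raise an average.\<close>

lemma box_average_antimono:
  assumes anti: "\<And>p q. p \<le> q \<Longrightarrow> r q \<le> r p" and "p \<le> q"
  shows "box_average n r q \<le> box_average n r p"
proof (rule antimono_fun_steps[OF _ \<open>p \<le> q\<close>])
  fix q :: "'k \<Rightarrow> nat" and i
  let ?B = "{s. s \<le> q \<and> s i = 0}"
  define b where "b = (\<Sum>s\<in>?B. word_weight n s)"
  define R where "R u = (\<Sum>s\<in>?B. word_weight n s * r (s(i := u)))" for u
  define X where "X m = (\<Sum>u\<le>m. real (n i) ^ u * R u)" for m
  define Y where "Y m = (\<Sum>u\<le>m. real (n i) ^ u)" for m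
  \<comment> \<open>The base slab does not see the bound in direction \<open>i\<close>; hence both
    sums become functions \<open>X\<close> and \<open>Y\<close> of the single variable
    \<open>m\<close>, up to the factor \<open>b\<close>.\<close>
  have "s \<le> q(i := m) \<longleftrightarrow> s \<le> q" if "s i = 0" for s m
  proof -
    have "s l \<le> (q(i := m)) l \<longleftrightarrow> s l \<le> q l" for l using that by (cases "l = i") simp_all
    then show ?thesis by (simp only: le_fun_def)
  qed
  then have B: "{s. s \<le> q(i := m) \<and> s i = 0} = ?B" for m by blast
  have W: "(\<Sum>s\<le>q(i := m). word_weight n s) = Y m * b" for m
    unfolding sum_atMost_slabs[of _ "q(i := m)" i] B b_def Y_def sum_distrib_right fun_upd_same
    by (intro sum.cong refl) (simp add: word_weight_update sum_distrib_left)
  have N: "(\<Sum>s\<le>q(i := m). word_weight n s * r s) = X m" for m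
    unfolding sum_atMost_slabs[of _ "q(i := m)" i] B R_def X_def sum_distrib_left fun_upd_same
    by (intro sum.cong refl) (simp add: word_weight_update mult.assoc)
  have f: "box_average n r (q(i := m)) = X m / (Y m * b)" for m
    unfolding box_average_def W N ..
  have pos: "0 < Y m * b" for m unfolding W[symmetric] by (rule sum_word_weight_pos)
  have R: "R v \<le> R u" if "u \<le> v" for u v
    unfolding R_def using that
    by (intro sum_mono mult_left_mono anti less_imp_le[OF word_weight_pos]) (simp add: le_fun_def)
  define m where "m = q i"
  define z where "z = real (n i) ^ Suc m"
  have XS: "X (Suc m) = X m + z * R (Suc m)" and YS: "Y (Suc m) = Y m + z"
    by (simp_all add: X_def Y_def z_def)
  \<comment> \<open>The new slab is compared with every old one. Multiplied by its weight
    \<open>z\<close>, this is the cross-multiplied form of the claim.\<close>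
  have "R (Suc m) * Y m \<le> X m"
    unfolding X_def Y_def sum_distrib_left
  proof (rule sum_mono)
    fix u assume "u \<in> {..m}"
    then have "R (Suc m) \<le> R u" by (intro R) simp
    then show "R (Suc m) * real (n i) ^ u \<le> real (n i) ^ u * R u"
      by (subst mult.commute) (intro mult_left_mono, simp_all)
  qed
  then have "z * (R (Suc m) * Y m) \<le> z * X m"
    by (intro mult_left_mono) (auto simp: z_def)
  then have le: "X (Suc m) * Y m \<le> X m * Y (Suc m)"
    unfolding XS YS by (simp add: algebra_simps)
  have b0: "0 \<le> b" unfolding b_def by (intro sum_nonneg less_imp_le word_weight_pos)
  then have b: "0 < b" using pos[of m] by (cases "b = 0") auto
  then have Y: "0 < Y u" for u using pos[of u] by (simp add: zero_less_mult_iff)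
  have "X (Suc m) / (Y (Suc m) * b) \<le> X m / (Y m * b)"
    using le b Y[of m] Y[of "Suc m"] by (simp add: field_simps)
  then show "box_average n r (q(i := Suc (q i))) \<le> box_average n r q"
    using f[of "Suc m"] f[of m] by (simp add: m_def)
qed

lemma box_average_ge:
  assumes lower: "\<And>q. c \<le> r q"
  shows "c \<le> box_average n r q"
proof -
  have "c * (\<Sum>s\<le>q. word_weight n s) \<le> (\<Sum>s\<le>q. word_weight n s * r s)"
    unfolding sum_distrib_left
    by (intro sum_mono) (simp add: mult.commute[of c] mult_left_mono lower less_imp_le[OF word_weight_pos])
  then show ?thesis unfolding box_average_def using sum_word_weight_pos by (simp add: le_divide_eq)
qed

text \<open>The diagonal boxes suffice here: monotonicity of the averages carries their limit over
  to the iterated limit.\<close>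

lemma box_average_tendsto:
  assumes anti: "\<And>p q. p \<le> q \<Longrightarrow> r q \<le> r p" and lower: "\<And>q. c \<le> r q"
    and approx: "\<And>e. e > 0 \<Longrightarrow> \<exists>q. r q < c + e"
  shows "(\<lambda>m. box_average n r (\<lambda>_. m)) \<longlonglongrightarrow> c"
  unfolding box_average_def
proof (rule tendsto_averages[where w = "\<lambda>_. word_weight n", OF anti lower approx])
  show "(\<lambda>m. (\<Sum>s\<in>{s \<in> {..\<lambda>_. m}. s i = t}. word_weight n s) / sum (word_weight n) {..\<lambda>_. m}) \<longlonglongrightarrow> 0"
    for i t
  proof (rule tendsto_sandwich[OF _ _ tendsto_const LIMSEQ_Suc[OF lim_const_over_n]])
    show "\<forall>\<^sub>F m in sequentially. (\<Sum>s\<in>{s \<in> {..\<lambda>_. m}. s i = t}. word_weight n s) / sum (word_weight n) {..\<lambda>_. m}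
        \<le> real (n i) ^ t / real (Suc m)"
      using box_slab_ratio by (intro always_eventually allI) blast
  qed (simp add: sum_nonneg less_imp_le[OF word_weight_pos])
qed (simp_all add: less_imp_le[OF word_weight_pos] sum_word_weight_pos)

end

section \<open>Iterated limits of antitone functions\<close>

primrec iterated_Inf :: "'k list \<Rightarrow> (('k \<Rightarrow> nat) \<Rightarrow> real) \<Rightarrow> ('k \<Rightarrow> nat) \<Rightarrow> real" where
  "iterated_Inf [] f q = f q"
| "iterated_Inf (i # js) f q = (INF m. iterated_Inf js f (q(i := m)))"

text \<open>Each inner limit is a decreasing sequence bounded by \<open>c\<close> from below, so
  iterated infima are the witnesses. Such an infimum lies below \<open>f p\<close> for every
  \<open>p\<close> that agrees with \<open>q\<close> outside the listed indices. When all indices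
  are listed, \<open>p\<close> may run through the diagonal, which bounds the infimum by
  \<open>c\<close> from above.\<close>

lemma has_iterated_limit_antimono:
  fixes f :: "('k \<Rightarrow> nat) \<Rightarrow> real"
  assumes anti: "\<And>p q. p \<le> q \<Longrightarrow> f q \<le> f p" and lower: "\<And>q. c \<le> f q"
    and js: "set js = UNIV" and lim: "(\<lambda>m. f (\<lambda>_. m)) \<longlonglongrightarrow> c"
  shows "has_iterated_limit js f q c"
proof -
  have low: "c \<le> iterated_Inf js f q" for js q
    by (induction js arbitrary: q) (auto intro: lower cINF_greatest)
  then have bdd: "bdd_below (range (\<lambda>m. iterated_Inf js f (q(i := m))))" for js i q
    by (intro bdd_belowI2)
  have mono: "p \<le> q \<Longrightarrow> iterated_Inf js f q \<le> iterated_Inf js f p" for js p q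
  proof (induction js arbitrary: p q)
    case (Cons i js)
    have "iterated_Inf js f (q(i := m)) \<le> iterated_Inf js f (p(i := m))" for m
      using Cons.prems by (intro Cons.IH) (simp add: le_fun_def)
    then show ?case unfolding iterated_Inf.simps by (intro cINF_mono bdd) auto
  qed (simp add: anti)
  have upper: "(\<And>j. j \<notin> set js \<Longrightarrow> p j = q j) \<Longrightarrow> iterated_Inf js f q \<le> f p" for js p q
  proof (induction js arbitrary: q)
    case Nil
    then have "p = q" by (simp add: fun_eq_iff)
    then show ?case by simp
  next
    case (Cons i js)
    have "iterated_Inf (i # js) f q \<le> iterated_Inf js f (q(i := p i))"
      unfolding iterated_Inf.simps by (rule cINF_lower[OF bdd UNIV_I])
    also have "\<dots> \<le> f p" by (rule Cons.IH) (use Cons.prems in auto)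
    finally show ?case .
  qed
  have "has_iterated_limit js f q (iterated_Inf js f q)" for js q
  proof (induction js arbitrary: q)
    case (Cons i js)
    have "decseq (\<lambda>m. iterated_Inf js f (q(i := m)))"
      by (intro antimonoI mono) (simp add: le_fun_def)
    then have "(\<lambda>m. iterated_Inf js f (q(i := m))) \<longlonglongrightarrow> iterated_Inf (i # js) f q"
      unfolding iterated_Inf.simps by (rule LIMSEQ_decseq_INF[OF bdd])
    then show ?case
      unfolding has_iterated_limit.simps
      by (intro exI[of _ "\<lambda>m. iterated_Inf js f (q(i := m))"] conjI allI Cons.IH)
  qed simp
  moreover have "iterated_Inf js f q = c"
  proof (rule antisym[OF _ low])
    show "iterated_Inf js f q \<le> c"
      by (rule LIMSEQ_le_const[OF lim], intro exI allI impI upper) (simp add: js)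
  qed
  ultimately show ?thesis by metis
qed

lemma has_iterated_limit_of_real:
  "has_iterated_limit js f q c \<Longrightarrow> has_iterated_limit js (\<lambda>q. complex_of_real (f q)) q (complex_of_real c)"
proof (induction js arbitrary: q c)
  case (Cons i js)
  then obtain g where "\<And>m. has_iterated_limit js f (q(i := m)) (g m)" "g \<longlonglongrightarrow> c" by auto
  then show ?case
    using Cons.IH by (auto intro!: exI[of _ "\<lambda>m. complex_of_real (g m)"] tendsto_of_real)
qed simp

section \<open>Complex inner products and bounded operators\<close>

lemma cinner_add_right: "cinner x (y + z) = cinner x y + cinner x z"
  by (metis cinner_commute cinner_add_left complex_cnj_add)

lemma cinner_scaleC_right: "cinner x (c *\<^sub>C y) = cnj c * cinner x y"
  by (metis cinner_commute cinner_scaleC_left complex_cnj_mult)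

lemma bounded_bilinear_cinner: "bounded_bilinear cinner"
proof
  show "\<exists>K. \<forall>a b :: 'a. norm (cinner a b) \<le> norm a * norm b * K"
    by (rule exI[of _ 1]) (simp add: norm_cinner_le)
qed (simp_all add: cinner_add_left cinner_add_right scaleR_scaleC cinner_scaleC_left
    cinner_scaleC_right scaleC_complex_def)

interpretation cinner: bounded_bilinear "cinner :: 'a::chilbert_space \<Rightarrow> 'a \<Rightarrow> complex"
  by (rule bounded_bilinear_cinner)

lemma cinner_self: "cinner x x = complex_of_real ((norm x)\<^sup>2)"
proof (rule complex_eqI)
  show "Im (cinner x x) = Im (complex_of_real ((norm x)\<^sup>2))"
    using arg_cong[OF cinner_commute[of x x], of Im] by simp
qed (simp add: power2_norm_eq_inner inner_cinner)

lemma Re_cinner_self: "Re (cinner x x) = (norm x)\<^sup>2"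
  by (simp add: cinner_self)

lemma cinner_eq_0_iff: "cinner x x = 0 \<longleftrightarrow> x = 0"
  by (simp add: cinner_self)

lemma cinner_left_eqI: "(\<And>z. cinner x z = cinner y z) \<Longrightarrow> x = y"
  using cinner_eq_0_iff[of "x - y"] by (simp add: cinner.diff_left)

lemma cinner_right_eqI: "(\<And>z. cinner z x = cinner z y) \<Longrightarrow> x = y"
  using cinner_eq_0_iff[of "x - y"] by (simp add: cinner.diff_right)

lemma norm_cinner_commute: "norm (cinner x y) = norm (cinner y x)"
  by (metis cinner_commute complex_mod_cnj)

lemma bounded_clinear_iff:
  "bounded_clinear A \<longleftrightarrow> (\<forall>x y. A (x + y) = A x + A y) \<and> (\<forall>c x. A (c *\<^sub>C x) = c *\<^sub>C A x) \<and>
     (\<exists>K. \<forall>x. norm (A x) \<le> K * norm x)"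
  unfolding bounded_clinear_def Vector_Spaces.linear_def module_hom_def module_hom_axioms_def
  by (auto simp: complex_vector.vector_space_axioms complex_vector.module_axioms)

lemma bounded_clinearI:
  assumes "\<And>x y. A (x + y) = A x + A y" "\<And>c x. A (c *\<^sub>C x) = c *\<^sub>C A x"
    and "\<And>x. norm (A x) \<le> K * norm x"
  shows "bounded_clinear A"
  using assms unfolding bounded_clinear_iff by blast

lemma bounded_clinear_add: "bounded_clinear A \<Longrightarrow> A (x + y) = A x + A y"
  by (simp add: bounded_clinear_iff)

lemma bounded_clinear_scaleC: "bounded_clinear A \<Longrightarrow> A (c *\<^sub>C x) = c *\<^sub>C A x"
  by (simp add: bounded_clinear_iff)

lemma bounded_clinear_bound:
  assumes "bounded_clinear A"
  obtains K where "K > 0" "\<And>x. norm (A x) \<le> K * norm x"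
proof -
  obtain K where K: "\<And>x. norm (A x) \<le> K * norm x"
    using assms unfolding bounded_clinear_iff by blast
  have "norm (A x) \<le> max K 1 * norm x" for x
    by (rule order_trans[OF K]) (simp add: mult_right_mono)
  then show ?thesis by (intro that[of "max K 1"]) auto
qed

lemma bounded_clinear_bounded_linear:
  assumes "bounded_clinear A" shows "bounded_linear A"
proof -
  obtain K where "\<And>x. norm (A x) \<le> K * norm x"
    using bounded_clinear_bound[OF assms] by blast
  then show ?thesis
    by (intro bounded_linear_intro[of _ K])
      (simp_all add: bounded_clinear_add[OF assms] bounded_clinear_scaleC[OF assms]
        scaleR_scaleC mult.commute)
qed

lemmas bounded_clinear_diff = linear_diff[OF bounded_linear.linear[OF bounded_clinear_bounded_linear]]
lemmas bounded_clinear_zero = linear_0[OF bounded_linear.linear[OF bounded_clinear_bounded_linear]]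

lemma bounded_clinear_id: "bounded_clinear id"
  by (rule bounded_clinearI[of _ 1]) auto

lemma bounded_clinear_comp:
  assumes A: "bounded_clinear A" and B: "bounded_clinear B"
  shows "bounded_clinear (A \<circ> B)"
proof -
  obtain K L where K: "K > 0" "\<And>x. norm (A x) \<le> K * norm x" and L: "\<And>x. norm (B x) \<le> L * norm x"
    using bounded_clinear_bound[OF A] bounded_clinear_bound[OF B] by metis
  have "norm ((A \<circ> B) x) \<le> (K * L) * norm x" for x
    using order_trans[OF K(2)[of "B x"] mult_left_mono[OF L[of x], of K]] K(1) by (simp add: mult.assoc)
  then show ?thesis
    by (intro bounded_clinearI[of _ "K * L"])
      (simp_all add: bounded_clinear_add[OF A] bounded_clinear_add[OF B]
        bounded_clinear_scaleC[OF A] bounded_clinear_scaleC[OF B])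
qed

section \<open>Orthogonal projections and adjoints\<close>

lemma parallelogram_mid:
  fixes x y z :: "'a::real_inner"
  shows "(norm (y - z))\<^sup>2 = 2 * (norm (x - y))\<^sup>2 + 2 * (norm (x - z))\<^sup>2
    - 4 * (norm (x - (1/2) *\<^sub>R (y + z)))\<^sup>2"
  by (simp add: power2_norm_eq_inner inner_simps algebra_simps inner_commute)

text \<open>The near-minimisers \<open>S m\<close> form a decreasing sequence of closed sets.
  Midpoints stay in \<open>M\<close>, so the parallelogram law bounds their diameters, and
  completeness provides a common point.\<close>

lemma closest_point_csubspace:
  fixes M :: "'a::chilbert_space set"
  assumes "complex_vector.subspace M" "closed M"
  obtains y where "y \<in> M" "\<And>z. z \<in> M \<Longrightarrow> norm (x - y) \<le> norm (x - z)"
proof -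
  define d where "d = infdist x M"
  have ne: "M \<noteq> {}" using complex_vector.subspace_0[OF assms(1)] by auto
  have d0: "d \<ge> 0" by (simp add: d_def infdist_nonneg)
  have dle: "d \<le> norm (x - z)" if "z \<in> M" for z
    using infdist_le[OF that] by (simp add: d_def dist_norm)
  define S where "S m = {y \<in> M. norm (x - y) \<le> d + 1 / real (Suc m)}" for m
  have mid: "(1/2) *\<^sub>R (y + z) \<in> M" if "y \<in> M" "z \<in> M" for y z
    unfolding scaleR_scaleC using that assms(1)
    by (intro complex_vector.subspace_scale complex_vector.subspace_add)
  obtain a where a: "\<And>m. a \<in> S m"
  proof (rule decreasing_closed_nest[of S])
    show "closed (S m)" for m
      unfolding S_def Collect_conj_eq Collect_mem_eq
      by (intro closed_Int assms closed_Collect_le continuous_intros)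
    show "S m \<noteq> {}" for m
    proof -
      have "infdist x M < d + 1 / real (Suc m)" by (simp add: d_def)
      then obtain y where "y \<in> M" "dist x y < d + 1 / real (Suc m)"
        using ne unfolding infdist_notempty[OF ne] by (subst (asm) cINF_less_iff) auto
      then show ?thesis by (auto simp: S_def dist_norm intro: less_imp_le)
    qed
    show "S n \<subseteq> S m" if "m \<le> n" for m n
    proof -
      have "1 / real (Suc n) \<le> 1 / real (Suc m)"
        using that by (simp add: frac_le)
      then show ?thesis by (auto simp: S_def)
    qed
    fix e :: real assume "e > 0"
    \<comment> \<open>With \<open>t = 1 / (m + 1)\<close> this is
      \<open>4 * (d + t)^2 - 4 * d^2\<close>, the bound that the parallelogram law gives for squared
      distances within \<open>S m\<close>.\<close>
    have "(\<lambda>m. 8 * d * (1 / real (Suc m)) + 4 * (1 / real (Suc m))\<^sup>2) \<longlonglongrightarrow> 8 * d * 0 + 4 * 0\<^sup>2"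
      by (intro tendsto_intros LIMSEQ_inverse_real_of_nat[unfolded inverse_eq_divide])
    then have "eventually (\<lambda>m. 8 * d * (1 / real (Suc m)) + 4 * (1 / real (Suc m))\<^sup>2 < e\<^sup>2) sequentially"
      by (rule order_tendstoD) (use \<open>e > 0\<close> in simp)
    then obtain m where m: "8 * d * (1 / real (Suc m)) + 4 * (1 / real (Suc m))\<^sup>2 < e\<^sup>2"
      by (auto simp: eventually_sequentially)
    have "dist y z < e" if y: "y \<in> S m" and z: "z \<in> S m" for y z
    proof -
      define t where "t = 1 / real (Suc m)"
      have "(norm (x - y))\<^sup>2 \<le> (d + t)\<^sup>2" "(norm (x - z))\<^sup>2 \<le> (d + t)\<^sup>2"
        using y z by (auto simp: S_def t_def intro!: power_mono)
      moreover have "d\<^sup>2 \<le> (norm (x - (1/2) *\<^sub>R (y + z)))\<^sup>2"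
        using y z d0 by (intro power_mono dle mid) (auto simp: S_def)
      ultimately have "(norm (y - z))\<^sup>2 \<le> 4 * (d + t)\<^sup>2 - 4 * d\<^sup>2"
        unfolding parallelogram_mid[of y z x] by linarith
      also have "\<dots> < e\<^sup>2"
        using m unfolding t_def[symmetric] by (simp add: power2_eq_square algebra_simps)
      finally show ?thesis
        using \<open>e > 0\<close> by (simp add: dist_norm power_less_imp_less_base)
    qed
    then show "\<exists>n. \<forall>x\<in>S n. \<forall>y\<in>S n. dist x y < e" by blast
  qed blast
  have "norm (x - a) \<le> d"
  proof (rule LIMSEQ_le_const)
    show "(\<lambda>m. d + 1 / real (Suc m)) \<longlonglongrightarrow> d"
      using tendsto_add[OF tendsto_const[of d] LIMSEQ_inverse_real_of_nat[unfolded inverse_eq_divide]]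
      by simp
  qed (use a in \<open>auto simp: S_def\<close>)
  moreover have "a \<in> M" using a[of 0] by (simp add: S_def)
  ultimately show thesis using dle by (intro that[of a]) (auto intro: order_trans)
qed

lemma orthogonal_decomposition:
  fixes M :: "'a::chilbert_space set"
  assumes "complex_vector.subspace M" "closed M"
  obtains y where "y \<in> M" "\<And>z. z \<in> M \<Longrightarrow> cinner (x - y) z = 0"
proof -
  obtain y where y: "y \<in> M" "\<And>z. z \<in> M \<Longrightarrow> norm (x - y) \<le> norm (x - z)"
    using closest_point_csubspace[OF assms] by blast
  have "cinner (x - y) z = 0" if "z \<in> M" for z
  proof (rule ccontr)
    define u where "u = x - y"
    define c where "c = cinner u z"
    \<comment> \<open>Moving \<open>y\<close> by \<open>(s * c) z\<close> changes the squared
      distance by \<open>|c|^2 s (s |z|^2 - 2)\<close>. This choice keeps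
      \<open>s |z|^2 \<le> 1\<close>, so the distance would drop, and it avoids dividing by the norm
      of \<open>z\<close>.\<close>
    define s where "s = 1 / ((norm z)\<^sup>2 + 1)"
    assume "cinner (x - y) z \<noteq> 0"
    then have c: "c \<noteq> 0" by (simp add: c_def u_def)
    have s: "s > 0" by (simp add: s_def add_nonneg_pos)
    have "norm u \<le> norm (x - (y + (s * c) *\<^sub>C z))"
      unfolding u_def using \<open>z \<in> M\<close> assms(1)
      by (intro y complex_vector.subspace_add complex_vector.subspace_scale)
    then have "(norm u)\<^sup>2 \<le> (norm (u - (s * c) *\<^sub>C z))\<^sup>2"
      by (intro power_mono) (auto simp: u_def algebra_simps)
    also have "\<dots> = Re (cinner (u - (s * c) *\<^sub>C z) (u - (s * c) *\<^sub>C z))"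
      by (simp add: Re_cinner_self)
    also have "cinner (u - (s * c) *\<^sub>C z) (u - (s * c) *\<^sub>C z)
        = (norm u)\<^sup>2 - cnj (s * c) * c - (s * c) * cnj c + (s * c) * cnj (s * c) * (norm z)\<^sup>2"
      unfolding cinner.diff_left cinner.diff_right cinner_scaleC_left cinner_scaleC_right
      using cinner_commute[of z u] by (simp add: cinner_self c_def algebra_simps)
    also have "Re \<dots> = (norm u)\<^sup>2 - 2 * s * (norm c)\<^sup>2 + s\<^sup>2 * (norm c)\<^sup>2 * (norm z)\<^sup>2"
      unfolding cmod_power2 by (simp add: power2_eq_square algebra_simps)
    finally have "s * (norm c)\<^sup>2 * 2 \<le> s * (norm c)\<^sup>2 * (s * (norm z)\<^sup>2)"
      by (simp add: power2_eq_square algebra_simps)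
    then have "2 \<le> s * (norm z)\<^sup>2"
      using s c by (subst (asm) mult_le_cancel_left_pos) auto
    moreover have "s * (norm z)\<^sup>2 \<le> 1"
      by (simp add: s_def divide_le_eq add_nonneg_pos)
    ultimately show False by simp
  qed
  then show thesis using y(1) by (rule that[rotated])
qed

lemma proj_eqI:
  assumes "complex_vector.subspace M" "y \<in> M" "\<And>z. z \<in> M \<Longrightarrow> cinner (x - y) z = 0"
  shows "proj M x = y"
  unfolding proj_def
proof (rule the_equality)
  fix w assume w: "w \<in> M \<and> (\<forall>z\<in>M. cinner (x - w) z = 0)"
  then have "w - y \<in> M" using assms by (intro complex_vector.subspace_diff) auto
  then have "cinner (x - y) (w - y) - cinner (x - w) (w - y) = 0"
    using w assms by simp
  then have "cinner (w - y) (w - y) = 0"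
    by (simp add: cinner.diff_left)
  then show "w = y" by (simp add: cinner_eq_0_iff)
qed (use assms in auto)

lemma
  assumes "complex_vector.subspace M" "closed M"
  shows proj_in: "proj M x \<in> M"
    and proj_orthogonal: "z \<in> M \<Longrightarrow> cinner (x - proj M x) z = 0"
proof -
  obtain y where "y \<in> M" "\<And>z. z \<in> M \<Longrightarrow> cinner (x - y) z = 0"
    using orthogonal_decomposition[OF assms] by blast
  then show "proj M x \<in> M" "z \<in> M \<Longrightarrow> cinner (x - proj M x) z = 0"
    using proj_eqI[OF assms(1)] by metis+
qed

lemma bounded_clinear_proj:
  assumes M: "complex_vector.subspace M" "closed M"
  shows "bounded_clinear (proj M)"
proof (rule bounded_clinearI)
  show "proj M (x + y) = proj M x + proj M y" for x y
    by (rule proj_eqI[OF M(1)])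
      (simp_all add: complex_vector.subspace_add M proj_in add_diff_add cinner_add_left proj_orthogonal)
  show "proj M (c *\<^sub>C x) = c *\<^sub>C proj M x" for c x
    by (rule proj_eqI[OF M(1)])
      (simp_all add: complex_vector.subspace_scale M proj_in proj_orthogonal cinner_scaleC_left
        flip: complex_vector.scale_right_diff_distrib)
  fix x
  have "cinner x (proj M x) = cinner (proj M x) (proj M x)"
    using proj_orthogonal[OF M proj_in[OF M, of x], of x] by (simp add: cinner.diff_left)
  then have "norm (proj M x) * norm (proj M x) \<le> norm x * norm (proj M x)"
    using norm_cinner_le[of x "proj M x"] by (simp add: cinner_self power2_eq_square norm_mult)
  then show "norm (proj M x) \<le> 1 * norm x"
    by (metis mult_1 mult_right_le_imp_le norm_ge_zero order_le_less)
qed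

lemma riesz_representation:
  fixes f :: "'a::chilbert_space \<Rightarrow> complex"
  assumes f: "bounded_clinear f"
  obtains y where "\<And>x. f x = cinner x y"
proof (cases "\<forall>x. f x = 0")
  case True
  then show thesis by (intro that[of 0]) (simp add: cinner.zero_right)
next
  case False
  then obtain x0 where x0: "f x0 \<noteq> 0" by blast
  note lin = bounded_clinear_add[OF f] bounded_clinear_scaleC[OF f] bounded_clinear_diff[OF f]
    bounded_clinear_zero[OF f]
  define M where "M = {x. f x = 0}"
  have M: "complex_vector.subspace M" "closed M"
    unfolding M_def complex_vector.subspace_def
    by (auto simp: lin scaleC_complex_def
        intro!: closed_Collect_eq linear_continuous_on[OF bounded_clinear_bounded_linear[OF f]] continuous_on_const)
  define u where "u = x0 - proj M x0"
  have fu: "f u = f x0"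
    using proj_in[OF M, of x0] by (simp add: u_def lin M_def)
  then have u: "u \<noteq> 0" using x0 lin(4) by auto
  \<comment> \<open>The vector \<open>x - (f x / f u) u\<close> lies in the kernel of
    \<open>f\<close> and is therefore orthogonal to \<open>u\<close>. The conjugate compensates for
    the conjugate linearity of the second argument.\<close>
  have "f x = cinner x ((cnj (f u) / (norm u)\<^sup>2) *\<^sub>C u)" for x
  proof -
    have "x - (f x / f u) *\<^sub>C u \<in> M"
      using x0 fu by (simp add: M_def lin scaleC_complex_def)
    then have "cinner u (x - (f x / f u) *\<^sub>C u) = 0"
      unfolding u_def by (rule proj_orthogonal[OF M])
    then have "cinner (x - (f x / f u) *\<^sub>C u) u = 0"
      by (metis cinner_commute complex_cnj_zero)
    then have "cinner x u = (f x / f u) * complex_of_real ((norm u)\<^sup>2)"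
      by (simp add: cinner.diff_left cinner_scaleC_left cinner_self)
    then show ?thesis
      using x0 fu u by (simp add: cinner_scaleC_right)
  qed
  then show thesis by (rule that)
qed

section \<open>Adjoints\<close>

lemma cadjoint_eqI:
  assumes "\<And>x y. cinner (A x) y = cinner x (B y)"
  shows "cadjoint A = B"
  unfolding cadjoint_def
proof (rule the_equality)
  fix C assume "\<forall>x y. cinner (A x) y = cinner x (C y)"
  then have "cinner x (C y) = cinner x (B y)" for x y using assms by simp
  then show "C = B" by (intro ext) (rule cinner_right_eqI)
qed (use assms in blast)

text \<open>The description in \<open>cadjoint\<close> needs a witness: for each \<open>y\<close>
  the Riesz theorem represents the functional \<open>x \<mapsto> cinner (A x) y\<close>, and choice
  collects the representing vectors.\<close>

lemma cinner_cadjoint: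
  assumes A: "bounded_clinear A"
  shows "cinner (A x) y = cinner x (cadjoint A y)"
proof -
  have "\<exists>z. \<forall>x. cinner (A x) y = cinner x z" for y
  proof -
    obtain K where K: "\<And>x. norm (A x) \<le> K * norm x"
      using bounded_clinear_bound[OF A] by blast
    have "bounded_clinear (\<lambda>x. cinner (A x) y)"
    proof (rule bounded_clinearI)
      show "norm (cinner (A x) y) \<le> (K * norm y) * norm x" for x
        using norm_cinner_le[of "A x" y] mult_right_mono[OF K[of x], of "norm y"]
        by (simp add: mult.assoc mult.commute[of "norm y"])
    qed (simp_all add: bounded_clinear_add[OF A] bounded_clinear_scaleC[OF A] cinner_add_left
        cinner_scaleC_left scaleC_complex_def)
    then show ?thesis using riesz_representation[of "\<lambda>x. cinner (A x) y"] by blast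
  qed
  then have "\<forall>y. \<exists>z. \<forall>x. cinner (A x) y = cinner x z" by (rule allI)
  from choice[OF this] obtain B where B: "\<And>x y. cinner (A x) y = cinner x (B y)" by blast
  then have "cadjoint A = B" by (rule cadjoint_eqI)
  with B[of x y] show ?thesis by simp
qed

lemma cinner_cadjoint':
  "bounded_clinear A \<Longrightarrow> cinner (cadjoint A x) y = cinner x (A y)"
  by (subst (1 2) cinner_commute) (simp add: cinner_cadjoint[of A])

lemma norm_cadjoint_le:
  assumes A: "bounded_clinear A" and K: "K \<ge> 0" "\<And>x. norm (A x) \<le> K * norm x"
  shows "norm (cadjoint A y) \<le> K * norm y"
proof (cases "cadjoint A y = 0")
  case True
  then show ?thesis using K(1) by simp
next
  case False
  have "norm (cadjoint A y) * norm (cadjoint A y) = norm (cinner (A (cadjoint A y)) y)"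
    by (simp add: cinner_cadjoint[OF A] cinner_self power2_eq_square norm_mult)
  also have "\<dots> \<le> norm (A (cadjoint A y)) * norm y" by (rule norm_cinner_le)
  also have "\<dots> \<le> (K * norm y) * norm (cadjoint A y)"
    using mult_right_mono[OF K(2)[of "cadjoint A y"], of "norm y"] by (simp add: mult_ac)
  finally show ?thesis using False by simp
qed

lemma bounded_clinear_cadjoint:
  assumes A: "bounded_clinear A"
  shows "bounded_clinear (cadjoint A)"
proof -
  obtain K where "K > 0" "\<And>x. norm (A x) \<le> K * norm x"
    using bounded_clinear_bound[OF A] by blast
  then have "norm (cadjoint A y) \<le> K * norm y" for y
    by (intro norm_cadjoint_le[OF A]) auto
  moreover have "cadjoint A (x + y) = cadjoint A x + cadjoint A y" for x y
    by (rule cinner_left_eqI) (simp add: cinner_cadjoint'[OF A] cinner_add_left)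
  moreover have "cadjoint A (c *\<^sub>C x) = c *\<^sub>C cadjoint A x" for c x
    by (rule cinner_left_eqI) (simp add: cinner_cadjoint'[OF A] cinner_scaleC_left)
  ultimately show ?thesis by (intro bounded_clinearI)
qed

lemma cadjoint_cadjoint: "bounded_clinear A \<Longrightarrow> cadjoint (cadjoint A) = A"
  by (rule cadjoint_eqI) (rule cinner_cadjoint')

lemma cadjoint_comp:
  assumes "bounded_clinear A" "bounded_clinear B"
  shows "cadjoint (A \<circ> B) = cadjoint B \<circ> cadjoint A"
  by (rule cadjoint_eqI) (simp add: cinner_cadjoint[OF assms(1)] cinner_cadjoint[OF assms(2)])

lemma cadjoint_id: "cadjoint id = id"
  by (rule cadjoint_eqI) simp

instance chilbert_space \<subseteq> banach ..

lemma bounded_clinear_scaleC_const: "bounded_clinear (\<lambda>x. c *\<^sub>C x)"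
  by (rule bounded_clinearI[of _ "norm c"])
    (simp_all add: scaleC_add_right scaleC_scaleC mult.commute norm_scaleC)

lemmas bounded_linear_scaleC = bounded_clinear_bounded_linear[OF bounded_clinear_scaleC_const]

section \<open>Positive operators and square roots\<close>

lemma positive_op_bounded: "positive_op A \<Longrightarrow> bounded_clinear A"
  by (simp add: positive_op_def)

lemma positive_op_real: "positive_op A \<Longrightarrow> cinner (A x) x = complex_of_real (Re (cinner (A x) x))"
  unfolding positive_op_def by (auto simp: complex_nonneg_Reals_iff complex_eq_iff)

lemma positive_op_Re_nonneg: "positive_op A \<Longrightarrow> 0 \<le> Re (cinner (A x) x)"
  unfolding positive_op_def by (auto simp: complex_nonneg_Reals_iff)

text \<open>Polarisation: the quadratic form is real at \<open>x + y\<close>, which compares the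
  imaginary parts of the two mixed terms, and at \<open>x + \<i> y\<close>, which compares their
  real parts.\<close>

lemma positive_op_selfadjoint:
  assumes A: "positive_op A"
  shows "cinner (A x) y = cinner x (A y)"
proof -
  note lin = bounded_clinear_add[OF positive_op_bounded[OF A]]
    bounded_clinear_scaleC[OF positive_op_bounded[OF A]]
  have Im: "Im (cinner (A u) u) = 0" for u
    using arg_cong[OF positive_op_real[OF A, of u], of Im] by simp
  have "Im (cinner (A (x + y)) (x + y)) = 0" "Im (cinner (A (x + \<i> *\<^sub>C y)) (x + \<i> *\<^sub>C y)) = 0"
    by (rule Im)+
  then have "Im (cinner (A x) y + cinner (A y) x) = 0" "Im (\<i> * (cinner (A y) x - cinner (A x) y)) = 0"
    by (simp_all add: lin Im cinner_add_left cinner_add_right cinner_scaleC_left cinner_scaleC_right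
        algebra_simps)
  then have "cinner (A x) y = cnj (cinner (A y) x)"
    by (intro complex_eqI) simp_all
  then show ?thesis by (metis cinner_commute)
qed

lemma positive_op_cadjoint: "positive_op A \<Longrightarrow> cadjoint A = A"
  by (rule cadjoint_eqI) (rule positive_op_selfadjoint)

text \<open>Evaluate the form of \<open>A\<close> at \<open>x - t A x\<close>. The value
  \<open>t = 1 / K\<close> balances \<open>- 2 t |A x|^2\<close> against
  \<open>t^2 K |A x|^2\<close> and leaves \<open>- |A x|^2 / K\<close>. The inequality later shows
  that \<open>I - A / K\<close> is a contraction and that a null vector of the form is a null vector
  of \<open>A\<close>.\<close>

lemma norm_power2_le_positive_op:
  assumes A: "positive_op A" and K: "K > 0" "\<And>x. norm (A x) \<le> K * norm x"
  shows "(norm (A x))\<^sup>2 \<le> K * Re (cinner (A x) x)"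
proof -
  note lin = bounded_clinear_diff[OF positive_op_bounded[OF A]]
    bounded_clinear_scaleC[OF positive_op_bounded[OF A]]
  define t where "t = 1 / K"
  have "Re (cinner (A (A x)) (A x)) \<le> norm (A (A x)) * norm (A x)"
    using norm_cinner_le complex_Re_le_cmod order_trans by blast
  also have "\<dots> \<le> K * (norm (A x))\<^sup>2"
    using mult_right_mono[OF K(2)[of "A x"], of "norm (A x)"] by (simp add: power2_eq_square mult.assoc)
  finally have 1: "Re (cinner (A (A x)) (A x)) \<le> K * (norm (A x))\<^sup>2" .
  have "0 \<le> Re (cinner (A (x - complex_of_real t *\<^sub>C A x)) (x - complex_of_real t *\<^sub>C A x))"
    by (rule positive_op_Re_nonneg[OF A])
  also have "\<dots> = Re (cinner (A x) x) - 2 * t * (norm (A x))\<^sup>2 + t\<^sup>2 * Re (cinner (A (A x)) (A x))"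
    by (simp add: lin cinner.diff_left cinner.diff_right cinner_scaleC_left cinner_scaleC_right
        Re_cinner_self positive_op_selfadjoint[OF A, of "A x" x] power2_eq_square algebra_simps)
  also have "\<dots> \<le> Re (cinner (A x) x) - 2 * t * (norm (A x))\<^sup>2 + t\<^sup>2 * (K * (norm (A x))\<^sup>2)"
    using 1 by (simp add: mult_left_mono)
  also have "\<dots> = Re (cinner (A x) x) - (norm (A x))\<^sup>2 / K"
    using K(1) by (simp add: t_def power2_eq_square field_simps)
  finally show ?thesis using K(1) by (simp add: field_simps)
qed

lemma positive_op_kernel:
  assumes "positive_op A" "cinner (A x) x = 0"
  shows "A x = 0"
proof -
  obtain K where "K > 0" "\<And>x. norm (A x) \<le> K * norm x"
    using bounded_clinear_bound[OF positive_op_bounded[OF assms(1)]] by blast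
  from norm_power2_le_positive_op[OF assms(1) this, of x] show ?thesis using assms(2) by simp
qed

text \<open>The classical iteration for \<open>1 - sqrt (1 - b)\<close>; its norm convergence is controlled by the
scalar iteration \<open>sqrt_bound\<close> at \<open>b = 1\<close>.\<close>

primrec sqrt_iter :: "('a::chilbert_space \<Rightarrow> 'a) \<Rightarrow> nat \<Rightarrow> 'a \<Rightarrow> 'a" where
  "sqrt_iter B 0 = (\<lambda>x. 0)"
| "sqrt_iter B (Suc m) = (\<lambda>x. (1/2) *\<^sub>R (B x + sqrt_iter B m (sqrt_iter B m x)))"

primrec sqrt_bound :: "nat \<Rightarrow> real" where
  "sqrt_bound 0 = 0"
| "sqrt_bound (Suc m) = (1 + (sqrt_bound m)\<^sup>2) / 2"

lemma sqrt_bound_range: "0 \<le> sqrt_bound m \<and> sqrt_bound m \<le> 1"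
  by (induction m) (auto simp: power_le_one_iff power_le_one)

lemma sqrt_bound_mono: "sqrt_bound m \<le> sqrt_bound (Suc m)"
proof (induction m)
  case (Suc m)
  then have "(sqrt_bound m)\<^sup>2 \<le> (sqrt_bound (Suc m))\<^sup>2"
    using sqrt_bound_range by (intro power_mono) auto
  then show ?case by simp
qed simp

context
  fixes B :: "'a::chilbert_space \<Rightarrow> 'a"
  assumes B: "bounded_clinear B" and nB: "\<And>x. norm (B x) \<le> norm x"
    and sB: "\<And>x y. cinner (B x) y = cinner x (B y)"
begin

lemma sqrt_iter_add: "sqrt_iter B m (x + y) = sqrt_iter B m x + sqrt_iter B m y"
  by (induction m arbitrary: x y) (simp_all add: bounded_clinear_add[OF B] algebra_simps)

lemma sqrt_iter_scaleC: "sqrt_iter B m (c *\<^sub>C x) = c *\<^sub>C sqrt_iter B m x"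
  by (induction m arbitrary: x)
    (simp_all add: bounded_clinear_scaleC[OF B] scaleR_scaleC scaleC_scaleC mult.commute
      flip: scaleC_add_right)

lemma sqrt_iter_norm: "norm (sqrt_iter B m x) \<le> sqrt_bound m * norm x"
proof (induction m arbitrary: x)
  case (Suc m)
  have "norm (sqrt_iter B m (sqrt_iter B m x)) \<le> sqrt_bound m * (sqrt_bound m * norm x)"
    using sqrt_bound_range by (intro order_trans[OF Suc] mult_left_mono Suc) auto
  moreover have "norm (sqrt_iter B (Suc m) x) \<le> (norm (B x) + norm (sqrt_iter B m (sqrt_iter B m x))) / 2"
    using norm_triangle_ineq[of "B x"] by simp
  ultimately show ?case using nB[of x] by (simp add: field_simps power2_eq_square)
qed simp

lemma bounded_clinear_sqrt_iter: "bounded_clinear (sqrt_iter B m)"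
  by (rule bounded_clinearI[OF sqrt_iter_add sqrt_iter_scaleC sqrt_iter_norm])

lemma sqrt_iter_commute:
  assumes "bounded_clinear C" "\<And>x. C (B x) = B (C x)"
  shows "C (sqrt_iter B m x) = sqrt_iter B m (C x)"
  by (induction m arbitrary: x)
    (simp_all add: assms bounded_clinear_zero bounded_clinear_add[OF assms(1)] scaleR_scaleC
      bounded_clinear_scaleC[OF assms(1)])

lemma sqrt_iter_selfadjoint: "cinner (sqrt_iter B m x) y = cinner x (sqrt_iter B m y)"
  by (induction m arbitrary: x y)
    (simp_all add: cinner.zero_left cinner.zero_right cinner_add_left cinner_add_right
      cinner_scaleC_left cinner_scaleC_right sB scaleR_scaleC)

text \<open>Consecutive iterates \<open>Y\<close> and \<open>Z\<close> commute, so
  \<open>Z^2 - Y^2\<close> factors as \<open>(Z + Y) (Z - Y)\<close>. The scalar iteration factors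
  in the same way, and its increments dominate the operator increments by induction.\<close>

lemma sqrt_iter_step:
  "norm (sqrt_iter B (Suc m) x - sqrt_iter B m x) \<le> (sqrt_bound (Suc m) - sqrt_bound m) * norm x"
proof (induction m arbitrary: x)
  case 0
  then show ?case using nB[of x] by simp
next
  case (Suc m)
  let ?Y = "sqrt_iter B m" and ?Z = "sqrt_iter B (Suc m)"
  \<comment> \<open>Two uses of \<open>sqrt_iter_commute\<close>: an iterate commutes with
    \<open>B\<close>, hence with every other iterate.\<close>
  have comm: "?Z (?Y u) = ?Y (?Z u)" for u
    by (rule sqrt_iter_commute[OF bounded_clinear_sqrt_iter])
      (rule sqrt_iter_commute[OF B refl, symmetric])
  define w where "w = ?Z x - ?Y x"
  have "sqrt_iter B (Suc (Suc m)) x - ?Z x = (1/2) *\<^sub>R (?Z (?Z x) - ?Y (?Y x))"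
    unfolding sqrt_iter.simps(2)[of B "Suc m"] by (subst (4) sqrt_iter.simps) (simp add: algebra_simps)
  also have "?Z (?Z x) - ?Y (?Y x) = ?Z w + ?Y w"
    unfolding w_def bounded_clinear_diff[OF bounded_clinear_sqrt_iter] comm by simp
  finally have "norm (sqrt_iter B (Suc (Suc m)) x - ?Z x) \<le> (norm (?Z w) + norm (?Y w)) / 2"
    using norm_triangle_ineq[of "?Z w" "?Y w"] by simp
  also have "\<dots> \<le> ((sqrt_bound (Suc m) + sqrt_bound m) / 2) * norm w"
    using sqrt_iter_norm[of "Suc m" w] sqrt_iter_norm[of m w] by (simp add: field_simps)
  also have "\<dots> \<le> ((sqrt_bound (Suc m) + sqrt_bound m) / 2) * ((sqrt_bound (Suc m) - sqrt_bound m) * norm x)"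
    unfolding w_def using sqrt_bound_range[of m] sqrt_bound_range[of "Suc m"]
    by (intro mult_left_mono Suc) simp
  also have "\<dots> = (sqrt_bound (Suc (Suc m)) - sqrt_bound (Suc m)) * norm x"
  proof -
    have "sqrt_bound (Suc (Suc m)) - sqrt_bound (Suc m) = ((sqrt_bound (Suc m))\<^sup>2 - (sqrt_bound m)\<^sup>2) / 2"
      by (simp add: power2_eq_square field_simps)
    then show ?thesis by (simp only: power2_eq_square) (simp add: field_simps del: sqrt_bound.simps)
  qed
  finally show ?case .
qed

text \<open>The scalar bounds increase and stay below 1, so their increments are summable; these
  dominate the increments of the operator iteration.\<close>

lemma convergent_sqrt_iter: "convergent (\<lambda>m. sqrt_iter B m x)"
proof -
  have "convergent sqrt_bound"
    by (rule Bseq_mono_convergent[OF BseqI'[of _ 1]])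
      (use sqrt_bound_range sqrt_bound_mono in \<open>auto intro: lift_Suc_mono_le simp del: sqrt_bound.simps\<close>)
  then have "summable (\<lambda>m. sqrt_bound (Suc m) - sqrt_bound m)"
    using telescope_summable unfolding convergent_def by blast
  then have "summable (\<lambda>m. (sqrt_bound (Suc m) - sqrt_bound m) * norm x)"
    by (rule summable_mult2)
  then have "summable (\<lambda>m. sqrt_iter B (Suc m) x - sqrt_iter B m x)"
    by (rule summable_comparison_test') (rule sqrt_iter_step)
  then have "convergent (\<lambda>m. \<Sum>i<m. sqrt_iter B (Suc i) x - sqrt_iter B i x)"
    by (simp only: summable_iff_convergent)
  moreover have "(\<Sum>i<m. sqrt_iter B (Suc i) x - sqrt_iter B i x) = sqrt_iter B m x" for m
    using sum_lessThan_telescope[of "\<lambda>i. sqrt_iter B i x" m] by (simp del: sqrt_iter.simps(2))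
  ultimately show ?thesis by (simp only:)
qed

text \<open>The limit \<open>L\<close> solves \<open>L = (B + L^2) / 2\<close>, which says
  \<open>(I - L)^2 = I - B\<close>; and \<open>Y = I - L\<close> is positive because
  \<open>L\<close> is a selfadjoint contraction. The commutation clause survives the limit and is
  what the uniqueness of square roots rests on.\<close>

lemma sqrt_one_minus:
  obtains Y where "positive_op Y" "\<And>x. Y (Y x) = x - B x"
    "\<And>C x. bounded_clinear C \<Longrightarrow> (\<And>x. C (B x) = B (C x)) \<Longrightarrow> C (Y x) = Y (C x)"
proof -
  obtain L where L: "\<And>x. (\<lambda>m. sqrt_iter B m x) \<longlonglongrightarrow> L x"
    using convergent_sqrt_iter unfolding convergent_def by metis
  have nL: "norm (L x) \<le> norm x" for x
  proof (rule LIMSEQ_le_const2[OF tendsto_norm[OF L]], intro exI allI impI)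
    fix m show "norm (sqrt_iter B m x) \<le> norm x"
      using sqrt_iter_norm[of m x] sqrt_bound_range[of m] mult_right_mono[of "sqrt_bound m" 1 "norm x"]
      by simp
  qed
  have add: "L (x + y) = L x + L y" for x y
    by (rule LIMSEQ_unique[OF L]) (simp add: sqrt_iter_add tendsto_add L)
  have scC: "L (c *\<^sub>C x) = c *\<^sub>C L x" for c x
    by (rule LIMSEQ_unique[OF L]) (simp add: sqrt_iter_scaleC bounded_linear.tendsto[OF bounded_linear_scaleC] L)
  have bL: "bounded_clinear L"
    by (rule bounded_clinearI[of _ 1]) (simp_all add: add scC nL)
  have LL: "L x = (1/2) *\<^sub>R (B x + L (L x))" for x
  proof (rule LIMSEQ_unique[OF LIMSEQ_Suc[OF L[of x]]])
    \<comment> \<open>Operator and argument vary together. The iterates are uniformly contractive,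
      so the inner iterate may be replaced by its limit \<open>L x\<close>.\<close>
    have "(\<lambda>m. sqrt_iter B m (sqrt_iter B m x) - sqrt_iter B m (L x)) \<longlonglongrightarrow> 0"
    proof (rule Lim_null_comparison[OF always_eventually])
      show "(\<lambda>m. norm (sqrt_iter B m x - L x)) \<longlonglongrightarrow> 0"
        using L tendsto_norm_zero LIM_zero by blast
      show "\<forall>m. norm (sqrt_iter B m (sqrt_iter B m x) - sqrt_iter B m (L x)) \<le> norm (sqrt_iter B m x - L x)"
      proof
        fix m
        have "norm (sqrt_iter B m (sqrt_iter B m x - L x)) \<le> 1 * norm (sqrt_iter B m x - L x)"
          by (rule order_trans[OF sqrt_iter_norm]) (intro mult_right_mono, use sqrt_bound_range in auto)
        then show "norm (sqrt_iter B m (sqrt_iter B m x) - sqrt_iter B m (L x)) \<le> norm (sqrt_iter B m x - L x)"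
          by (simp add: bounded_clinear_diff[OF bounded_clinear_sqrt_iter])
      qed
    qed
    from tendsto_add[OF this L[of "L x"]]
    have "(\<lambda>m. sqrt_iter B m (sqrt_iter B m x)) \<longlonglongrightarrow> L (L x)" by simp
    then show "(\<lambda>m. sqrt_iter B (Suc m) x) \<longlonglongrightarrow> (1/2) *\<^sub>R (B x + L (L x))"
      unfolding sqrt_iter.simps by (intro tendsto_intros)
  qed
  have sL: "cinner (L x) y = cinner x (L y)" for x y
  proof (rule LIMSEQ_unique)
    show "(\<lambda>m. cinner (sqrt_iter B m x) y) \<longlonglongrightarrow> cinner (L x) y"
      by (intro cinner.tendsto L tendsto_const)
    show "(\<lambda>m. cinner (sqrt_iter B m x) y) \<longlonglongrightarrow> cinner x (L y)"
      unfolding sqrt_iter_selfadjoint by (intro cinner.tendsto L tendsto_const)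
  qed
  define Y where "Y x = x - L x" for x
  have "norm (Y x) \<le> 2 * norm x" for x
    unfolding Y_def using norm_triangle_ineq4[of x "L x"] nL[of x] by simp
  then have bY: "bounded_clinear Y"
    by (intro bounded_clinearI[of _ 2])
      (simp_all add: Y_def add scC complex_vector.scale_right_diff_distrib)
  show thesis
  proof (rule that)
    have "cinner (Y x) x \<in> \<real>\<^sub>\<ge>\<^sub>0" for x
    proof -
      have "Im (cinner (L x) x) = 0"
        using arg_cong[OF cinner_commute[of "L x" x], of Im] sL[of x x] by simp
      moreover have "Re (cinner (L x) x) \<le> (norm x)\<^sup>2"
        using complex_Re_le_cmod[of "cinner (L x) x"] norm_cinner_le[of "L x" x]
          mult_right_mono[OF nL[of x], of "norm x"] by (simp add: power2_eq_square)
      ultimately show ?thesis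
        by (simp add: Y_def cinner.diff_left cinner_self complex_nonneg_Reals_iff)
    qed
    then show "positive_op Y" using bY by (simp add: positive_op_def)
    show "Y (Y x) = x - B x" for x
    proof -
      have "2 *\<^sub>R L x = B x + L (L x)" by (subst LL) simp
      moreover have "Y (Y x) = x - 2 *\<^sub>R L x + L (L x)"
        by (simp add: Y_def bounded_clinear_diff[OF bL] scaleR_2)
      ultimately show ?thesis by simp
    qed
    fix C x assume C: "bounded_clinear C" "\<And>x. C (B x) = B (C x)"
    have "C (L x) = L (C x)"
    proof (rule LIMSEQ_unique)
      show "(\<lambda>m. C (sqrt_iter B m x)) \<longlonglongrightarrow> C (L x)"
        by (rule bounded_linear.tendsto[OF bounded_clinear_bounded_linear[OF C(1)] L])
      show "(\<lambda>m. C (sqrt_iter B m x)) \<longlonglongrightarrow> L (C x)"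
        unfolding sqrt_iter_commute[OF C] by (rule L)
    qed
    then show "C (Y x) = Y (C x)"
      by (simp add: Y_def bounded_clinear_diff[OF C(1)])
  qed
qed

end

text \<open>Rescaling: \<open>B = I - A / K\<close> is a selfadjoint contraction, so
  \<open>A / K = I - B\<close> has a root \<open>Y\<close>, and \<open>sqrt K\<close> times
  \<open>Y\<close> is a root of \<open>A\<close>.\<close>

lemma sqrt_exists:
  assumes A: "positive_op A"
  obtains S where "positive_op S" "S \<circ> S = A"
    "\<And>C x. bounded_clinear C \<Longrightarrow> (\<And>x. C (A x) = A (C x)) \<Longrightarrow> C (S x) = S (C x)"
proof -
  note bA = positive_op_bounded[OF A]
  obtain K where K: "K > 0" "\<And>x. norm (A x) \<le> K * norm x"
    using bounded_clinear_bound[OF bA] by blast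
  define B where "B x = x - complex_of_real (1 / K) *\<^sub>C A x" for x
  have nB: "norm (B x) \<le> norm x" for x
  proof (rule power2_le_imp_le)
    have "(norm (B x))\<^sup>2 = Re (cinner (B x) (B x))" by (simp add: Re_cinner_self)
    also have "\<dots> = (norm x)\<^sup>2 - 2 * Re (cinner (A x) x) / K + (norm (A x))\<^sup>2 / K\<^sup>2"
      by (simp add: B_def cinner.diff_left cinner.diff_right cinner_scaleC_left cinner_scaleC_right
          Re_cinner_self positive_op_selfadjoint[OF A, of x x, symmetric] power2_eq_square algebra_simps
          Re_divide_of_real)
    also have "\<dots> \<le> (norm x)\<^sup>2"
    proof -
      have "(norm (A x))\<^sup>2 / K\<^sup>2 \<le> K * Re (cinner (A x) x) / K\<^sup>2"
        using norm_power2_le_positive_op[OF A K, of x] by (intro divide_right_mono) auto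
      also have "\<dots> \<le> 2 * Re (cinner (A x) x) / K"
        using K(1) positive_op_Re_nonneg[OF A, of x] by (simp add: power2_eq_square field_simps)
      finally show ?thesis by simp
    qed
    finally show "(norm (B x))\<^sup>2 \<le> (norm x)\<^sup>2" .
  qed simp
  have bB: "bounded_clinear B"
    by (rule bounded_clinearI[of _ 1])
      (simp_all add: nB, simp_all add: B_def bounded_clinear_add[OF bA] bounded_clinear_scaleC[OF bA]
        scaleC_add_right complex_vector.scale_right_diff_distrib scaleC_scaleC mult.commute)
  have sB: "cinner (B x) y = cinner x (B y)" for x y
    by (simp add: B_def cinner.diff_left cinner.diff_right cinner_scaleC_left cinner_scaleC_right
        positive_op_selfadjoint[OF A])
  obtain Y where Y: "positive_op Y" "\<And>x. Y (Y x) = x - B x"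
    "\<And>C x. bounded_clinear C \<Longrightarrow> (\<And>x. C (B x) = B (C x)) \<Longrightarrow> C (Y x) = Y (C x)"
    using sqrt_one_minus[OF bB nB sB] by blast
  note bY = positive_op_bounded[OF Y(1)]
  define k where "k = complex_of_real (sqrt K)"
  have kk: "k * k = complex_of_real K"
    using K(1) by (simp add: k_def flip: of_real_mult)
  define S where "S x = k *\<^sub>C Y x" for x
  have bS: "bounded_clinear S"
  proof -
    have "S = (\<lambda>x. k *\<^sub>C x) \<circ> Y" by (simp add: S_def fun_eq_iff)
    then show ?thesis by (simp only: bounded_clinear_comp[OF bounded_clinear_scaleC_const bY])
  qed
  show thesis
  proof (rule that)
    have "cinner (S x) x \<in> \<real>\<^sub>\<ge>\<^sub>0" for x
      using Y(1) K(1) unfolding positive_op_def S_def cinner_scaleC_left k_def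
      by (intro nonneg_Reals_mult_I) auto
    then show "positive_op S" using bS by (simp add: positive_op_def)
    show "S \<circ> S = A"
      using K(1) by (auto simp: S_def bounded_clinear_scaleC[OF bY] scaleC_scaleC kk Y(2) B_def
          complex_vector.scale_right_diff_distrib scaleC_one)
    fix C x assume C: "bounded_clinear C" "\<And>x. C (A x) = A (C x)"
    have "C (Y x) = Y (C x)"
      by (rule Y(3)[OF C(1)]) (simp add: B_def bounded_clinear_diff[OF C(1)] bounded_clinear_scaleC[OF C(1)] C(2))
    then show "C (S x) = S (C x)" by (simp add: S_def bounded_clinear_scaleC[OF C(1)])
  qed
qed

text \<open>Any root \<open>Q\<close> commutes with \<open>A = Q^2\<close>, hence with the
  constructed root \<open>S\<close>. For \<open>y = Q x - S x\<close> this gives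
  \<open>Q y + S y = 0\<close>; positivity makes both forms vanish at \<open>y\<close>, so
  \<open>Q y = S y = 0\<close>, and \<open>|y|^2\<close> is the inner product of
  \<open>Q y - S y\<close> with \<open>x\<close>.\<close>

lemma sqrt_op_eqI:
  assumes P: "positive_op P" and PP: "P \<circ> P = A" and A: "positive_op A"
  shows "sqrt_op A = P"
proof -
  obtain S where S: "positive_op S" "S \<circ> S = A"
    and com: "\<And>C x. bounded_clinear C \<Longrightarrow> (\<And>x. C (A x) = A (C x)) \<Longrightarrow> C (S x) = S (C x)"
    using sqrt_exists[OF A] by blast
  have unique: "Q = S" if Q: "positive_op Q" and QQ: "Q \<circ> Q = A" for Q
  proof
    fix x
    note bQ = positive_op_bounded[OF Q] and bS = positive_op_bounded[OF S(1)]
    have QQ': "Q (Q x) = A x" and SS': "S (S x) = A x" for x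
      using fun_cong[OF QQ] fun_cong[OF S(2)] by auto
    have QS: "Q (S x) = S (Q x)" for x
      by (rule com[OF bQ]) (simp flip: QQ')
    define y where "y = Q x - S x"
    have sum0: "Q y + S y = 0"
      by (simp add: y_def bounded_clinear_diff[OF bQ] bounded_clinear_diff[OF bS] QQ' SS' QS)
    have "Re (cinner (Q y) y) + Re (cinner (S y) y) = 0"
      using arg_cong[OF sum0, of "\<lambda>v. Re (cinner v y)"] by (simp add: cinner_add_left cinner.zero_left)
    then have "Re (cinner (Q y) y) = 0" and "Re (cinner (S y) y) = 0"
      using positive_op_Re_nonneg[OF Q, of y] positive_op_Re_nonneg[OF S(1), of y] by auto
    then have "cinner (Q y) y = 0" and "cinner (S y) y = 0"
      using complex_eqI[of "cinner (Q y) y" 0] complex_eqI[of "cinner (S y) y" 0]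
        arg_cong[OF positive_op_real[OF Q, of y], of Im] arg_cong[OF positive_op_real[OF S(1), of y], of Im]
      by simp_all
    then have "Q y = 0" and "S y = 0"
      using positive_op_kernel Q S(1) by blast+
    moreover have "cinner y y = cinner (Q y - S y) x"
      by (simp add: y_def cinner.diff_right cinner.diff_left
          positive_op_selfadjoint[OF Q, of _ x] positive_op_selfadjoint[OF S(1), of _ x])
    ultimately have "cinner y y = 0" by (simp add: cinner.zero_left)
    then show "Q x = S x" by (simp add: cinner_eq_0_iff y_def)
  qed
  show ?thesis
    unfolding sqrt_op_def
  proof (rule the_equality)
    show "positive_op P \<and> P \<circ> P = A" using P PP by (rule conjI)
    fix Q assume "positive_op Q \<and> Q \<circ> Q = A"
    then show "Q = P" using unique[of Q] unique[OF P PP] by blast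
  qed
qed

lemma
  assumes "positive_op A"
  shows positive_op_sqrt_op: "positive_op (sqrt_op A)"
    and sqrt_op_square: "sqrt_op A (sqrt_op A x) = A x"
proof -
  obtain S where S: "positive_op S" "S \<circ> S = A"
    using sqrt_exists[OF assms] by blast
  have "sqrt_op A = S" by (rule sqrt_op_eqI[OF S assms])
  then show "positive_op (sqrt_op A)" "sqrt_op A (sqrt_op A x) = A x"
    using S(1) fun_cong[OF S(2), of x] by auto
qed

lemma abs_op_positive_op:
  assumes A: "positive_op A"
  shows "abs_op A = A"
  unfolding abs_op_def positive_op_cadjoint[OF A]
proof (rule sqrt_op_eqI[OF A refl])
  have "cinner ((A \<circ> A) x) x = complex_of_real ((norm (A x))\<^sup>2)" for x
    by (simp add: positive_op_selfadjoint[OF A, of "A x"] cinner_self)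
  then show "positive_op (A \<circ> A)"
    by (simp add: positive_op_def bounded_clinear_comp positive_op_bounded[OF A])
qed

section \<open>Orthonormal bases and Hilbert-Schmidt operators\<close>

lemma closure_csubspace:
  fixes M :: "'a::chilbert_space set"
  assumes "complex_vector.subspace M"
  shows "complex_vector.subspace (closure M)"
  unfolding complex_vector.subspace_def
proof (intro conjI ballI allI)
  show "0 \<in> closure M"
    using complex_vector.subspace_0[OF assms] closure_subset by blast
next
  fix x y assume "x \<in> closure M" "y \<in> closure M"
  then obtain f g where "\<And>m. f m \<in> M" "f \<longlonglongrightarrow> x" "\<And>m. g m \<in> M" "g \<longlonglongrightarrow> y"
    unfolding closure_sequential by blast
  then have "(\<lambda>m. f m + g m) \<longlonglongrightarrow> x + y" "\<And>m. f m + g m \<in> M"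
    using assms by (auto intro: tendsto_add complex_vector.subspace_add)
  then show "x + y \<in> closure M"
    unfolding closure_sequential by (intro exI[of _ "\<lambda>m. f m + g m"]) auto
next
  fix c x assume "x \<in> closure M"
  then obtain f where "\<And>m. f m \<in> M" "f \<longlonglongrightarrow> x"
    unfolding closure_sequential by blast
  then have "(\<lambda>m. c *\<^sub>C f m) \<longlonglongrightarrow> c *\<^sub>C x" "\<And>m. c *\<^sub>C f m \<in> M"
    using assms by (auto intro: bounded_linear.tendsto[OF bounded_linear_scaleC] complex_vector.subspace_scale)
  then show "c *\<^sub>C x \<in> closure M"
    unfolding closure_sequential by (intro exI[of _ "\<lambda>m. c *\<^sub>C f m"]) auto
qed

definition is_orthonormal :: "'a::chilbert_space set \<Rightarrow> bool" where
  "is_orthonormal E \<longleftrightarrow> (\<forall>x\<in>E. \<forall>y\<in>E. cinner x y = (if x = y then 1 else 0))"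

lemma is_onb_orthonormal: "is_onb E \<Longrightarrow> is_orthonormal E"
  by (simp add: is_onb_def is_orthonormal_def)

text \<open>A maximal orthonormal set, given by Zorn's lemma, has dense span, since otherwise a
  normalised residual would enlarge it. Existence is what gives meaning to the basis chosen by
  \<open>SOME\<close> in \<open>trace_op\<close>.\<close>

lemma onb_exists: "\<exists>E :: 'a::chilbert_space set. is_onb E"
proof -
  have "\<exists>E\<in>{E :: 'a set. is_orthonormal E}. \<forall>X\<in>{E. is_orthonormal E}. E \<subseteq> X \<longrightarrow> X = E"
  proof (rule subset_Zorn')
    fix C :: "'a set set" assume C: "subset.chain {E. is_orthonormal E} C"
    have "cinner x y = (if x = y then 1 else 0)" if "x \<in> X" "X \<in> C" "y \<in> Y" "Y \<in> C" for x y X Y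
    proof -
      have "X \<subseteq> Y \<or> Y \<subseteq> X" "is_orthonormal X" "is_orthonormal Y"
        using C that by (auto simp: subset.chain_def)
      then show ?thesis using that unfolding is_orthonormal_def by (meson subsetD)
    qed
    then show "\<Union>C \<in> {E. is_orthonormal E}" unfolding is_orthonormal_def by blast
  qed
  then obtain E :: "'a set" where E: "is_orthonormal E"
    and max: "\<And>X. is_orthonormal X \<Longrightarrow> E \<subseteq> X \<Longrightarrow> X = E" by auto
  let ?M = "closure (complex_vector.span E)"
  have M: "complex_vector.subspace ?M" "closed ?M"
    by (auto intro: closure_csubspace complex_vector.subspace_span)
  have EM: "E \<subseteq> ?M" using complex_vector.span_superset closure_subset by blast
  have "x \<in> ?M" for x
  proof (rule ccontr)
    assume "x \<notin> ?M"
    define u where "u = x - proj ?M x"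
    have u0: "u \<noteq> 0" using \<open>x \<notin> ?M\<close> proj_in[OF M, of x] by (auto simp: u_def)
    have uM: "cinner u z = 0" if "z \<in> ?M" for z
      unfolding u_def by (rule proj_orthogonal[OF M that])
    then have uM': "cinner z u = 0" if "z \<in> ?M" for z
      using that by (metis cinner_commute complex_cnj_zero)
    define v where "v = complex_of_real (1 / norm u) *\<^sub>C u"
    have "cinner v v = 1"
      using u0 by (simp add: v_def cinner_self norm_scaleC norm_divide)
    then have "is_orthonormal (insert v E)"
      using E EM uM uM' unfolding is_orthonormal_def
      by (auto simp: v_def cinner_scaleC_left cinner_scaleC_right)
    then have "v \<in> E" using max[of "insert v E"] by blast
    then have "cinner u v = 0" using EM uM by blast
    then show False using u0 by (simp add: v_def cinner_scaleC_right cinner_self)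
  qed
  then have "?M = UNIV" by blast
  then have "is_onb E" using E unfolding is_onb_def is_orthonormal_def by blast
  then show ?thesis by blast
qed

lemma is_onb_some: "is_onb (SOME E. is_onb E)"
  by (rule someI_ex[OF onb_exists])

lemma orthonormal_expansion:
  fixes x :: "'a::chilbert_space"
  assumes E: "is_orthonormal F" "finite F"
  defines "p \<equiv> (\<Sum>e\<in>F. cinner x e *\<^sub>C e)"
  shows "z \<in> complex_vector.span F \<Longrightarrow> cinner (x - p) z = 0"
    and "p \<in> complex_vector.span F"
    and "(norm x)\<^sup>2 = (norm (x - p))\<^sup>2 + (\<Sum>e\<in>F. (norm (cinner x e))\<^sup>2)"
proof -
  have pe: "cinner p e = cinner x e" if "e \<in> F" for e
  proof -
    have "cinner p e = (\<Sum>d\<in>F. if d = e then cinner x d else 0)"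
      unfolding p_def cinner.sum_left cinner_scaleC_left
      using E that by (intro sum.cong) (auto simp: is_orthonormal_def)
    then show ?thesis using that E by simp
  qed
  show orth: "cinner (x - p) z = 0" if "z \<in> complex_vector.span F" for z
    using that
  proof (induction rule: complex_vector.span_induct_alt)
    case (step c e y)
    then show ?case
      by (simp add: cinner_add_right cinner_scaleC_right cinner.diff_left pe)
  qed (simp add: cinner.zero_right)
  show pF: "p \<in> complex_vector.span F"
    unfolding p_def by (intro complex_vector.span_sum complex_vector.span_scale complex_vector.span_base)
  have "complex_of_real ((norm p)\<^sup>2) = (\<Sum>e\<in>F. cnj (cinner x e) * cinner p e)"
    unfolding cinner_self[symmetric] by (subst (2) p_def) (simp add: cinner.sum_right cinner_scaleC_right)
  also have "\<dots> = complex_of_real (\<Sum>e\<in>F. (norm (cinner x e))\<^sup>2)"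
    by (simp add: pe complex_norm_square mult.commute del: of_real_power)
  finally have np: "(norm p)\<^sup>2 = (\<Sum>e\<in>F. (norm (cinner x e))\<^sup>2)"
    using of_real_eq_iff by blast
  have "cinner p (x - p) = 0"
    using orth[OF pF] by (metis cinner_commute complex_cnj_zero)
  then have "cinner x x = cinner (x - p) (x - p) + cinner p p"
    using orth[OF pF] by (simp add: cinner.diff_left cinner.diff_right)
  then have "Re (cinner x x) = Re (cinner (x - p) (x - p)) + Re (cinner p p)" by simp
  then show "(norm x)\<^sup>2 = (norm (x - p))\<^sup>2 + (\<Sum>e\<in>F. (norm (cinner x e))\<^sup>2)"
    by (simp only: Re_cinner_self np)
qed

text \<open>Some \<open>y\<close> in the span of a finite \<open>F\<close> is within
  \<open>sqrt \<epsilon>\<close> of \<open>x\<close>, and the orthogonal projection of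
  \<open>x\<close> to that span is no farther away. So the sum over \<open>F\<close> misses
  \<open>|x|^2\<close> by less than \<open>\<epsilon>\<close>; larger finite sets only add terms and
  stay below \<open>|x|^2\<close> by Bessel's inequality.\<close>

lemma parseval:
  assumes E: "is_onb E"
  shows "((\<lambda>e. (norm (cinner x e))\<^sup>2) has_sum (norm x)\<^sup>2) E"
  unfolding has_sum_def tendsto_iff eventually_finite_subsets_at_top
proof (intro allI impI)
  fix \<epsilon> :: real assume "\<epsilon> > 0"
  note on = is_onb_orthonormal[OF E]
  have sub: "is_orthonormal F" if "F \<subseteq> E" for F
    using on that unfolding is_orthonormal_def by blast
  have "x \<in> closure (complex_vector.span E)" using E by (simp add: is_onb_def)
  then obtain y where y: "y \<in> complex_vector.span E" "dist y x < sqrt \<epsilon>"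
    using \<open>\<epsilon> > 0\<close> by (metis closure_approachable real_sqrt_gt_0_iff)
  then obtain F where F: "finite F" "F \<subseteq> E" "y \<in> complex_vector.span F"
    unfolding complex_vector.span_explicit[of E]
    by (auto intro: complex_vector.span_sum complex_vector.span_scale complex_vector.span_base)
  define p where "p = (\<Sum>e\<in>F. cinner x e *\<^sub>C e)"
  note ex = orthonormal_expansion[OF sub[OF F(2)] F(1), where x = x, folded p_def]
  have "p - y \<in> complex_vector.span F" using ex(2) F(3) by (rule complex_vector.span_diff)
  then have 0: "cinner (x - p) (p - y) = 0" "cinner (p - y) (x - p) = 0"
    using ex(1) by (metis, metis cinner_commute complex_cnj_zero)
  have "x - y = (x - p) + (p - y)" by simp
  then have "cinner (x - y) (x - y) = cinner (x - p) (x - p) + cinner (p - y) (p - y)"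
    by (simp only: cinner_add_left cinner_add_right 0) simp
  then have "Re (cinner (x - y) (x - y)) = Re (cinner (x - p) (x - p)) + Re (cinner (p - y) (p - y))"
    by simp
  then have "(norm (x - p))\<^sup>2 \<le> (norm (x - y))\<^sup>2" by (simp add: Re_cinner_self)
  also have "\<dots> < (sqrt \<epsilon>)\<^sup>2"
    using y(2) by (intro power_strict_mono) (auto simp: dist_norm norm_minus_commute)
  finally have lt: "(norm x)\<^sup>2 - (\<Sum>e\<in>F. (norm (cinner x e))\<^sup>2) < \<epsilon>"
    using \<open>\<epsilon> > 0\<close> ex(3) by simp
  show "\<exists>X. finite X \<and> X \<subseteq> E \<and> (\<forall>Y. finite Y \<and> X \<subseteq> Y \<and> Y \<subseteq> E \<longrightarrow>
      dist (\<Sum>e\<in>Y. (norm (cinner x e))\<^sup>2) ((norm x)\<^sup>2) < \<epsilon>)"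
  proof (intro exI[of _ F] conjI F allI impI)
    fix Y assume Y: "finite Y \<and> F \<subseteq> Y \<and> Y \<subseteq> E"
    then have "(\<Sum>e\<in>F. (norm (cinner x e))\<^sup>2) \<le> (\<Sum>e\<in>Y. (norm (cinner x e))\<^sup>2)"
      by (intro sum_mono2) auto
    moreover have "(\<Sum>e\<in>Y. (norm (cinner x e))\<^sup>2) \<le> (norm x)\<^sup>2"
      using orthonormal_expansion(3)[OF sub, of Y x] Y by simp
    ultimately show "dist (\<Sum>e\<in>Y. (norm (cinner x e))\<^sup>2) ((norm x)\<^sup>2) < \<epsilon>"
      using lt by (simp add: dist_real_def)
  qed
qed

text \<open>Both sums equal the double sum of the squared matrix entries
  \<open>|cinner (A e) f|^2\<close>, where nonnegativity permits exchanging the order. Keeping the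
  two bases independent makes basis independence a consequence.\<close>

lemma hilbert_schmidt_cadjoint_has_sum:
  assumes A: "bounded_clinear A" and E: "is_onb E" and F: "is_onb F"
    and s: "((\<lambda>e. (norm (A e))\<^sup>2) has_sum s) E"
  shows "((\<lambda>f. (norm (cadjoint A f))\<^sup>2) has_sum s) F"
proof -
  define g where "g = (\<lambda>(e, f). (norm (cinner (A e) f))\<^sup>2)"
  have inner: "((\<lambda>f. g (e, f)) has_sum (norm (A e))\<^sup>2) F" for e
    unfolding g_def prod.case by (rule parseval[OF F])
  have "g summable_on E \<times> F"
    by (rule summable_on_SigmaI[OF inner has_sum_imp_summable[OF s]]) (auto simp: g_def)
  then have "(g has_sum s) (E \<times> F)"
    by (rule has_sum_SigmaI[OF inner s])
  then have "((\<lambda>(f, e). g (e, f)) has_sum s) (F \<times> E)"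
    by (rule iffD1[OF has_sum_swap])
  then show ?thesis
  proof (rule has_sum_SigmaD)
    fix f
    have "norm (cinner (A e) f) = norm (cinner (cadjoint A f) e)" for e
      by (simp add: cinner_cadjoint[OF A] norm_cinner_commute)
    then show "((\<lambda>e. case (f, e) of (f, e) \<Rightarrow> g (e, f)) has_sum (norm (cadjoint A f))\<^sup>2) E"
      using parseval[OF E, of "cadjoint A f"] by (simp add: g_def)
  qed
qed

section \<open>Hilbert-Schmidt operators and traces\<close>

definition hilbert_schmidt :: "('a::chilbert_space \<Rightarrow> 'b::chilbert_space) \<Rightarrow> bool" where
  "hilbert_schmidt A \<longleftrightarrow> bounded_clinear A \<and> (\<lambda>e. (norm (A e))\<^sup>2) summable_on (SOME E. is_onb E)"

definition hs_norm2 :: "('a::chilbert_space \<Rightarrow> 'b::chilbert_space) \<Rightarrow> real" where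
  "hs_norm2 A = (\<Sum>\<^sub>\<infinity>e\<in>(SOME E. is_onb E). (norm (A e))\<^sup>2)"

lemma hs_norm2_nonneg: "0 \<le> hs_norm2 A"
  unfolding hs_norm2_def by (rule infsum_nonneg) simp

lemma hilbert_schmidt_bounded: "hilbert_schmidt A \<Longrightarrow> bounded_clinear A"
  by (simp add: hilbert_schmidt_def)

text \<open>Passing to the adjoint and back transfers the sum from \<open>E\<close> to the basis
  fixed in the definition.\<close>

lemma
  assumes A: "bounded_clinear A" and E: "is_onb E"
    and s: "((\<lambda>e. (norm (A e))\<^sup>2) has_sum s) E"
  shows hilbert_schmidtI: "hilbert_schmidt A" and hs_norm2_eqI: "hs_norm2 A = s"
proof -
  have "((\<lambda>f. (norm (cadjoint A f))\<^sup>2) has_sum s) (SOME E. is_onb E)"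
    by (rule hilbert_schmidt_cadjoint_has_sum[OF A E is_onb_some s])
  from hilbert_schmidt_cadjoint_has_sum[OF bounded_clinear_cadjoint[OF A] is_onb_some is_onb_some this]
  have "((\<lambda>f. (norm (A f))\<^sup>2) has_sum s) (SOME E. is_onb E)"
    by (simp add: cadjoint_cadjoint[OF A])
  then show "hilbert_schmidt A" "hs_norm2 A = s"
    using A by (auto simp: hilbert_schmidt_def hs_norm2_def intro: infsumI has_sum_imp_summable)
qed

lemma hilbert_schmidt_has_sum:
  "hilbert_schmidt A \<Longrightarrow> ((\<lambda>e. (norm (A e))\<^sup>2) has_sum hs_norm2 A) (SOME E. is_onb E)"
  by (simp add: hilbert_schmidt_def hs_norm2_def)

lemma
  assumes A: "hilbert_schmidt A"
  shows hilbert_schmidt_cadjoint: "hilbert_schmidt (cadjoint A)"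
    and hs_norm2_cadjoint: "hs_norm2 (cadjoint A) = hs_norm2 A"
proof -
  note b = hilbert_schmidt_bounded[OF A]
  have s: "((\<lambda>f. (norm (cadjoint A f))\<^sup>2) has_sum hs_norm2 A) (SOME E. is_onb E)"
    using b is_onb_some is_onb_some hilbert_schmidt_has_sum[OF A]
    by (rule hilbert_schmidt_cadjoint_has_sum)
  show "hilbert_schmidt (cadjoint A)" "hs_norm2 (cadjoint A) = hs_norm2 A"
    by (rule hilbert_schmidtI[OF bounded_clinear_cadjoint[OF b] is_onb_some s]
        hs_norm2_eqI[OF bounded_clinear_cadjoint[OF b] is_onb_some s])+
qed

lemma
  assumes A: "hilbert_schmidt A" and X: "bounded_clinear X" "\<And>x. norm (X x) \<le> norm x"
  shows hilbert_schmidt_comp_left: "hilbert_schmidt (X \<circ> A)"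
    and hs_norm2_comp_left_le: "hs_norm2 (X \<circ> A) \<le> hs_norm2 A"
proof -
  have le: "(norm ((X \<circ> A) e))\<^sup>2 \<le> (norm (A e))\<^sup>2" for e
    using X(2)[of "A e"] by (simp add: power_mono)
  have s: "(\<lambda>e. (norm ((X \<circ> A) e))\<^sup>2) summable_on (SOME E. is_onb E)"
    by (rule summable_on_comparison_test[OF has_sum_imp_summable[OF hilbert_schmidt_has_sum[OF A]] le]) auto
  then show "hilbert_schmidt (X \<circ> A)"
    by (simp add: hilbert_schmidt_def bounded_clinear_comp X hilbert_schmidt_bounded[OF A])
  show "hs_norm2 (X \<circ> A) \<le> hs_norm2 A"
    unfolding hs_norm2_def
    by (rule infsum_mono[OF s has_sum_imp_summable[OF hilbert_schmidt_has_sum[OF A]] le])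
qed

text \<open>A right factor does not act on the individual vectors \<open>A e\<close>. Taking
  adjoints turns it into a left factor, for which the estimate holds term by term.\<close>

lemma
  assumes A: "hilbert_schmidt A" and X: "bounded_clinear X" "\<And>x. norm (X x) \<le> norm x"
  shows hilbert_schmidt_comp_right: "hilbert_schmidt (A \<circ> X)"
    and hs_norm2_comp_right_le: "hs_norm2 (A \<circ> X) \<le> hs_norm2 A"
proof -
  note bA = hilbert_schmidt_bounded[OF A]
  have nX: "norm (cadjoint X x) \<le> norm x" for x
    using norm_cadjoint_le[OF X(1), of 1 x] X(2) by simp
  have eq: "A \<circ> X = cadjoint (cadjoint X \<circ> cadjoint A)"
    by (simp add: cadjoint_comp[OF bounded_clinear_cadjoint[OF X(1)] bounded_clinear_cadjoint[OF bA]]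
        cadjoint_cadjoint[OF bA] cadjoint_cadjoint[OF X(1)])
  note hs = hilbert_schmidt_comp_left[OF hilbert_schmidt_cadjoint[OF A] bounded_clinear_cadjoint[OF X(1)] nX]
    and le = hs_norm2_comp_left_le[OF hilbert_schmidt_cadjoint[OF A] bounded_clinear_cadjoint[OF X(1)] nX]
  show "hilbert_schmidt (A \<circ> X)" "hs_norm2 (A \<circ> X) \<le> hs_norm2 A"
    using hilbert_schmidt_cadjoint[OF hs] hs_norm2_cadjoint[OF hs] hs_norm2_cadjoint[OF A] le
    by (simp_all add: eq)
qed

text \<open>\<open>trace_op\<close> sees only the diagonal values of the form of \<open>B\<close>,
  so writing that form as a sum of squares turns the trace into a sum of Hilbert-Schmidt norms.
  Numerators and denominators of the trace ratios are both evaluated this way.\<close>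

lemma trace_op_sum_squares:
  assumes hs: "\<And>b. b \<in> W \<Longrightarrow> hilbert_schmidt (C b)"
    and B: "\<And>x. cinner (B x) x = complex_of_real (\<Sum>b\<in>W. (norm (C b x))\<^sup>2)"
  shows "trace_op B = complex_of_real (\<Sum>b\<in>W. hs_norm2 (C b))"
proof -
  have "((\<lambda>e. \<Sum>b\<in>W. (norm (C b e))\<^sup>2) has_sum (\<Sum>b\<in>W. hs_norm2 (C b))) (SOME E. is_onb E)"
    using hs
    by (induction W rule: infinite_finite_induct) (auto intro!: has_sum_add hilbert_schmidt_has_sum)
  then show ?thesis
    unfolding trace_op_def B by (intro infsumI has_sum_of_real)
qed

text \<open>For positive \<open>A\<close> the operator \<open>abs_op A\<close> is \<open>A\<close>
  itself, and \<open>cinner (A e) e\<close> is the squared norm of \<open>sqrt_op A e\<close>; thus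
  summability in one basis is the Hilbert-Schmidt condition.\<close>

lemma hilbert_schmidt_sqrt_op:
  assumes A: "positive_op A" and tr: "trace_class A"
  shows "hilbert_schmidt (sqrt_op A)"
proof -
  obtain E where E: "is_onb E" "(\<lambda>e. cinner (A e) e) summable_on E"
    using tr abs_op_positive_op[OF A] by (auto simp: trace_class_def)
  note S = positive_op_sqrt_op[OF A]
  have "cinner (A e) e = complex_of_real ((norm (sqrt_op A e))\<^sup>2)" for e
    using positive_op_selfadjoint[OF S, of "sqrt_op A e" e] sqrt_op_square[OF A, of e]
    by (simp add: cinner_self)
  then have "(\<lambda>e. (norm (sqrt_op A e))\<^sup>2) summable_on E"
    using summable_on_Re[OF E(2)] by simp
  then show ?thesis
    by (rule hilbert_schmidtI[OF positive_op_bounded[OF S] E(1) has_sum_infsum])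
qed

section \<open>Coordinates in Hilbert sums\<close>

lemma hnth_add: "hnth (x + y) i = hnth x i + hnth y i"
  by (simp add: plus_hsum.rep_eq)

lemma hnth_scaleC: "hnth (c *\<^sub>C x) i = c *\<^sub>C hnth x i"
  by (simp add: scaleC_hsum.rep_eq)

lemma hnth_zero: "hnth 0 i = 0"
  by (simp add: zero_hsum.rep_eq)

lemma hnth_sum: "hnth (sum f F) i = (\<Sum>j\<in>F. hnth (f j) i)"
  by (induction F rule: infinite_finite_induct) (simp_all add: hnth_add hnth_zero)

lemma hnth_Abs_hsum:
  "(\<lambda>i. (norm (f i))\<^sup>2) summable_on UNIV \<Longrightarrow> hnth (Abs_hsum f) = f"
  by (rule Abs_hsum_inverse) simp

lemma norm_hnth_le: "norm (hnth x i) \<le> norm x"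
  using power2_le_imp_le[of "norm (hnth x i)" "norm x"] hsum_partial_sum_le[of "{i}" x] by simp

lemma hsum_norm_leI:
  assumes "\<And>F. finite F \<Longrightarrow> (\<Sum>i\<in>F. (norm (hnth x i))\<^sup>2) \<le> B\<^sup>2" "0 \<le> B"
  shows "norm x \<le> B"
proof (rule power2_le_imp_le)
  show "(norm x)\<^sup>2 \<le> B\<^sup>2"
    unfolding hsum_norm_sq by (rule infsum_le_finite_sums[OF hsum_summable]) (use assms in auto)
qed (use assms in auto)

text \<open>The explicit form of the tensor product of a coordinate projection with
  \<open>B\<close>. All projections in the statement, which are given by descriptions, are
  identified with such operators.\<close>

definition block_op :: "'i set \<Rightarrow> ('h \<Rightarrow> 'h) \<Rightarrow> ('i, 'h::chilbert_space) hsum \<Rightarrow> ('i, 'h) hsum" where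
  "block_op W B x = Abs_hsum (\<lambda>i. if i \<in> W then B (hnth x i) else 0)"

lemma hnth_block_op:
  assumes "bounded_clinear B"
  shows "hnth (block_op W B x) i = (if i \<in> W then B (hnth x i) else 0)"
proof -
  obtain K where K: "\<And>x. norm (B x) \<le> K * norm x"
    using bounded_clinear_bound[OF assms] by blast
  have "(\<lambda>i. (norm (if i \<in> W then B (hnth x i) else 0))\<^sup>2) summable_on UNIV"
  proof (rule summable_on_comparison_test)
    show "(\<lambda>i. K\<^sup>2 * (norm (hnth x i))\<^sup>2) summable_on UNIV"
      by (intro summable_on_cmult_right hsum_summable)
    show "(norm (if i \<in> W then B (hnth x i) else 0))\<^sup>2 \<le> K\<^sup>2 * (norm (hnth x i))\<^sup>2" for i
      using K[of "hnth x i"] by (simp add: power_mono flip: power_mult_distrib)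
  qed simp
  then show ?thesis unfolding block_op_def by (simp add: hnth_Abs_hsum)
qed

lemma bounded_clinear_block_op:
  fixes B :: "'h::chilbert_space \<Rightarrow> 'h" and W :: "'i set"
  assumes B: "bounded_clinear B"
  shows "bounded_clinear (block_op W B)"
proof -
  obtain K where K: "K > 0" "\<And>x. norm (B x) \<le> K * norm x"
    using bounded_clinear_bound[OF assms] by blast
  show ?thesis
  proof (rule bounded_clinearI)
    fix x :: "('i, 'h) hsum"
    show "norm (block_op W B x) \<le> K * norm x"
    proof (rule hsum_norm_leI)
      fix F :: "'i set" assume F: "finite F"
      have "(\<Sum>i\<in>F. (norm (hnth (block_op W B x) i))\<^sup>2) \<le> (\<Sum>i\<in>F. K\<^sup>2 * (norm (hnth x i))\<^sup>2)"
        using K by (intro sum_mono) (simp add: hnth_block_op[OF B] power_mono flip: power_mult_distrib)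
      also have "\<dots> \<le> (K * norm x)\<^sup>2"
        using hsum_partial_sum_le[OF F, of x]
        by (simp add: power_mult_distrib mult_left_mono flip: sum_distrib_left)
      finally show "(\<Sum>i\<in>F. (norm (hnth (block_op W B x) i))\<^sup>2) \<le> (K * norm x)\<^sup>2" .
    qed (use K in simp)
  qed (auto intro!: hsum_eqI simp: hnth_block_op[OF B] hnth_add hnth_scaleC
      bounded_clinear_add[OF B] bounded_clinear_scaleC[OF B])
qed

lift_definition single :: "'i \<Rightarrow> 'h::chilbert_space \<Rightarrow> ('i, 'h) hsum"
  is "\<lambda>i h j. if j = i then h else 0"
  by (rule finite_nonzero_values_imp_summable_on) (simp add: if_distrib[of norm] cong: if_cong)

lemma hnth_single: "hnth (single i h) j = (if j = i then h else 0)"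
  by (simp add: single.rep_eq)

lemma cinner_hsum_supp:
  assumes "finite F" "\<And>i. i \<notin> F \<Longrightarrow> hnth x i = 0"
  shows "cinner x y = (\<Sum>i\<in>F. cinner (hnth x i) (hnth y i))"
proof -
  have "cinner x y = (\<Sum>\<^sub>\<infinity>i\<in>F. cinner (hnth x i) (hnth y i))"
    unfolding cinner_hsum_def by (rule infsum_cong_neutral) (auto simp: assms(2) cinner.zero_left)
  then show ?thesis using assms(1) by simp
qed

lemma cinner_single: "cinner (single i h) x = cinner h (hnth x i)"
  by (subst cinner_hsum_supp[of "{i}"]) (auto simp: hnth_single)

lemma norm_single: "norm (single i h) = norm h"
proof -
  have "complex_of_real ((norm (single i h))\<^sup>2) = complex_of_real ((norm h)\<^sup>2)"
    unfolding cinner_self[symmetric] by (simp add: cinner_single hnth_single)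
  then show ?thesis unfolding of_real_eq_iff by (simp add: power2_eq_iff_nonneg)
qed

lemma single_scaleC: "single i (c *\<^sub>C h) = c *\<^sub>C single i h"
  by (rule hsum_eqI) (simp add: hnth_single hnth_scaleC)

text \<open>The squared distance of a finite partial sum from \<open>x\<close> is
  \<open>|x|^2\<close> minus the corresponding partial sum of the squared coordinate norms.\<close>

lemma hsum_has_sum_single:
  assumes "\<And>i. i \<notin> W \<Longrightarrow> hnth x i = 0"
  shows "((\<lambda>i. single i (hnth x i)) has_sum x) W"
  unfolding has_sum_def tendsto_iff eventually_finite_subsets_at_top
proof (intro allI impI)
  fix \<epsilon> :: real assume \<epsilon>: "\<epsilon> > 0"
  have "((\<lambda>i. (norm (hnth x i))\<^sup>2) has_sum (norm x)\<^sup>2) UNIV"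
    unfolding hsum_norm_sq by (rule has_sum_infsum[OF hsum_summable])
  then have hs: "((\<lambda>i. (norm (hnth x i))\<^sup>2) has_sum (norm x)\<^sup>2) W"
    by (subst has_sum_cong_neutral[of UNIV W]) (auto simp: assms)
  have "\<forall>\<^sub>F F in finite_subsets_at_top W. dist (\<Sum>i\<in>F. (norm (hnth x i))\<^sup>2) ((norm x)\<^sup>2) < \<epsilon>\<^sup>2"
    using hs \<epsilon> unfolding has_sum_def tendsto_iff by simp
  then obtain X where X: "finite X" "X \<subseteq> W"
    and lt: "\<forall>Y. finite Y \<and> X \<subseteq> Y \<and> Y \<subseteq> W \<longrightarrow>
      dist (\<Sum>i\<in>Y. (norm (hnth x i))\<^sup>2) ((norm x)\<^sup>2) < \<epsilon>\<^sup>2"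
    unfolding eventually_finite_subsets_at_top by (elim exE conjE) (rule that)
  show "\<exists>X. finite X \<and> X \<subseteq> W \<and> (\<forall>Y. finite Y \<and> X \<subseteq> Y \<and> Y \<subseteq> W \<longrightarrow>
      dist (\<Sum>i\<in>Y. single i (hnth x i)) x < \<epsilon>)"
  proof (intro exI[of _ X] conjI X allI impI)
    fix Y assume Y: "finite Y \<and> X \<subseteq> Y \<and> Y \<subseteq> W"
    define p where "p = (\<Sum>i\<in>Y. single i (hnth x i))"
    have hp: "hnth p i = (if i \<in> Y then hnth x i else 0)" for i
      using Y by (simp add: p_def hnth_sum hnth_single)
    have pz: "cinner p z = (\<Sum>i\<in>Y. cinner (hnth x i) (hnth z i))" for z
      using Y by (subst cinner_hsum_supp[of Y]) (auto simp: hp)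
    have pp: "cinner p p = complex_of_real (\<Sum>i\<in>Y. (norm (hnth x i))\<^sup>2)"
      unfolding pz of_real_sum by (intro sum.cong refl) (simp add: hp cinner_self)
    have px: "cinner p x = complex_of_real (\<Sum>i\<in>Y. (norm (hnth x i))\<^sup>2)"
      by (simp add: pz cinner_self)
    have "Re (cinner (p - x) (p - x)) = (norm x)\<^sup>2 - (\<Sum>i\<in>Y. (norm (hnth x i))\<^sup>2)"
      using px cinner_commute[of x p] by (simp add: cinner.diff_left cinner.diff_right pp Re_cinner_self)
    also have "\<dots> < \<epsilon>\<^sup>2"
      using lt[rule_format, OF Y] by (simp add: dist_real_def)
    finally show "dist p x < \<epsilon>"
      using \<epsilon> by (simp add: dist_norm Re_cinner_self power_less_imp_less_base)
  qed
qed

text \<open>Finite sums of the vectors \<open>single i h\<close> approximate every vector. This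
  supplies the uniqueness half of the descriptions in \<open>tensor_op\<close> and
  \<open>Tensor_op\<close>.\<close>

lemma bounded_clinear_hsum_eqI:
  fixes S :: "('i, 'h::chilbert_space) hsum \<Rightarrow> 'b::chilbert_space"
  assumes "bounded_clinear S" "bounded_clinear S'" "\<And>i h. S (single i h) = S' (single i h)"
  shows "S = S'"
proof
  fix x :: "('i, 'h) hsum"
  have x: "((\<lambda>i. single i (hnth x i)) has_sum x) UNIV"
    by (rule hsum_has_sum_single) simp
  have "((\<lambda>i. S (single i (hnth x i))) has_sum S x) UNIV"
    by (rule has_sum_bounded_linear[OF bounded_clinear_bounded_linear[OF assms(1)] x])
  moreover have "((\<lambda>i. S (single i (hnth x i))) has_sum S' x) UNIV"
    unfolding assms(3) by (rule has_sum_bounded_linear[OF bounded_clinear_bounded_linear[OF assms(2)] x])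
  ultimately show "S x = S' x" by (rule has_sum_unique)
qed

lemma tensor_single: "tensor (single i 1) h = single i h"
  by (rule hsum_eqI) (simp add: tensor.rep_eq hnth_single scaleC_one)

lemma tensor_op_block_op:
  assumes B: "bounded_clinear B"
  shows "tensor_op (block_op W id) B = block_op W B"
proof -
  have eq: "block_op W B (tensor u h) = tensor (block_op W id u) (B h)" for u h
    by (rule hsum_eqI) (simp add: hnth_block_op[OF B] hnth_block_op[OF bounded_clinear_id]
        tensor.rep_eq bounded_clinear_scaleC[OF B])
  show ?thesis
    unfolding tensor_op_def
  proof (rule the_equality)
    fix S assume S: "bounded_clinear S \<and> (\<forall>u h. S (tensor u h) = tensor (block_op W id u) (B h))"
    show "S = block_op W B"
    proof (rule bounded_clinear_hsum_eqI)
      show "S (single i h) = block_op W B (single i h)" for i h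
        using S eq[of "single i 1" h] by (metis tensor_single)
    qed (use S B bounded_clinear_block_op in auto)
  qed (use eq B bounded_clinear_block_op in auto)
qed

lemma Tensor_single: "Tensor (\<lambda>i. single (\<beta> i) 1) = single \<beta> 1"
proof (rule hsum_eqI)
  fix \<gamma> show "hnth (Tensor (\<lambda>i. single (\<beta> i) 1)) \<gamma> = hnth (single \<beta> 1) \<gamma>"
    by (auto simp: Tensor.rep_eq hnth_single fun_eq_iff intro: prod_zero)
qed

lemma Tensor_op_block_op:
  "Tensor_op (\<lambda>i. block_op (W i) id) = block_op {\<beta>. \<forall>i. \<beta> i \<in> W i} id"
proof -
  note b = bounded_clinear_block_op[OF bounded_clinear_id]
  have eq: "block_op {\<beta>. \<forall>i. \<beta> i \<in> W i} id (Tensor x) = Tensor (\<lambda>i. block_op (W i) id (x i))" for x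
  proof (rule hsum_eqI)
    fix \<gamma>
    show "hnth (block_op {\<beta>. \<forall>i. \<beta> i \<in> W i} id (Tensor x)) \<gamma>
        = hnth (Tensor (\<lambda>i. block_op (W i) id (x i))) \<gamma>"
    proof (cases "\<forall>i. \<gamma> i \<in> W i")
      case True
      then show ?thesis by (simp add: hnth_block_op[OF bounded_clinear_id] Tensor.rep_eq)
    next
      case False
      then obtain i where "\<gamma> i \<notin> W i" by blast
      then have "\<exists>i\<in>UNIV. hnth (block_op (W i) id (x i)) (\<gamma> i) = 0"
        by (intro bexI[of _ i]) (simp_all add: hnth_block_op[OF bounded_clinear_id])
      then have "hnth (Tensor (\<lambda>i. block_op (W i) id (x i))) \<gamma> = 0"
        unfolding Tensor.rep_eq by (intro prod_zero) simp_all
      then show ?thesis using False by (auto simp: hnth_block_op[OF bounded_clinear_id])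
    qed
  qed
  show ?thesis
    unfolding Tensor_op_def
  proof (rule the_equality)
    fix S assume S: "bounded_clinear S \<and> (\<forall>x. S (Tensor x) = Tensor (\<lambda>i. block_op (W i) id (x i)))"
    have 1: "S (single \<beta> 1) = block_op {\<beta>. \<forall>i. \<beta> i \<in> W i} id (single \<beta> 1)" for \<beta>
      using S eq[of "\<lambda>i. single (\<beta> i) 1"] unfolding Tensor_single[symmetric] by simp
    have c: "single \<beta> c = c *\<^sub>C single \<beta> 1" for \<beta> :: "'a \<Rightarrow> 'b" and c
      using single_scaleC[of \<beta> c "1::complex"] by (simp add: scaleC_complex_def)
    have "S (single \<beta> c) = block_op {\<beta>. \<forall>i. \<beta> i \<in> W i} id (single \<beta> c)" for \<beta> c
      by (subst (1 2) c) (simp only: bounded_clinear_scaleC[OF conjunct1[OF S]] bounded_clinear_scaleC[OF b] 1)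
    then show "S = block_op {\<beta>. \<forall>i. \<beta> i \<in> W i} id"
      using S b by (intro bounded_clinear_hsum_eqI) auto
  qed (use eq b in auto)
qed

lemma proj_span_single:
  assumes W: "finite W"
  shows "proj (complex_vector.span ((\<lambda>w. single w (1::complex)) ` W)) = block_op W id"
proof
  fix x :: "('a, complex) hsum"
  note h = hnth_block_op[OF bounded_clinear_id]
  show "proj (complex_vector.span ((\<lambda>w. single w 1) ` W)) x = block_op W id x"
  proof (rule proj_eqI[OF complex_vector.subspace_span])
    have "block_op W id x = (\<Sum>w\<in>W. hnth x w *\<^sub>C single w 1)"
      using W by (intro hsum_eqI)
        (simp add: h hnth_sum hnth_scaleC hnth_single scaleC_complex_def if_distrib cong: if_cong)
    also have "\<dots> \<in> complex_vector.span ((\<lambda>w. single w 1) ` W)"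
      by (intro complex_vector.span_sum complex_vector.span_scale complex_vector.span_base imageI)
    finally show "block_op W id x \<in> complex_vector.span ((\<lambda>w. single w 1) ` W)" .
    fix z assume "z \<in> complex_vector.span ((\<lambda>w. single w (1::complex)) ` W)"
    then show "cinner (x - block_op W id x) z = 0"
    proof (induction rule: complex_vector.span_induct_alt)
      case (step c u z)
      then obtain w where w: "w \<in> W" "u = single w 1" by blast
      have "cinner u (x - block_op W id x) = 0"
        using w by (simp add: cinner_single hnth_diff h cinner.zero_right)
      then have u: "cinner (x - block_op W id x) u = 0"
        by (metis cinner_commute complex_cnj_zero)
      show ?case
        unfolding cinner_add_right cinner_scaleC_right u step.IH by simp
    qed (simp add: cinner.zero_right)
  qed
qed

text \<open>The basis in \<open>trace_op\<close> need not be the coordinate basis; Parseval for the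
  unit vector \<open>single w 1\<close> shows that each coordinate in \<open>W\<close> contributes
  exactly 1 in any basis.\<close>

lemma trace_op_block_op_id:
  fixes W :: "'i set"
  assumes W: "finite W"
  shows "trace_op (block_op W id :: ('i, complex) hsum \<Rightarrow> _) = of_nat (card W)"
proof -
  have b: "bounded_clinear (\<lambda>x :: ('i, complex) hsum. hnth x w)" for w
    by (rule bounded_clinearI[of _ 1]) (simp_all add: hnth_add hnth_scaleC norm_hnth_le)
  have s: "((\<lambda>e :: ('i, complex) hsum. (norm (hnth e w))\<^sup>2) has_sum 1) (SOME E. is_onb E)" for w
    using parseval[OF is_onb_some, of "single w (1::complex)"]
    by (simp add: cinner_single norm_single cinner_complex_def)
  have "trace_op (block_op W id :: ('i, complex) hsum \<Rightarrow> _)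
      = complex_of_real (\<Sum>w\<in>W. hs_norm2 (\<lambda>x :: ('i, complex) hsum. hnth x w))"
  proof (rule trace_op_sum_squares)
    show "hilbert_schmidt (\<lambda>x :: ('i, complex) hsum. hnth x w)" for w
      by (rule hilbert_schmidtI[OF b is_onb_some s])
    show "cinner (block_op W id x) x = complex_of_real (\<Sum>w\<in>W. (norm (hnth x w))\<^sup>2)"
      for x :: "('i, complex) hsum"
      using W by (subst cinner_hsum_supp[of W])
        (auto simp: hnth_block_op[OF bounded_clinear_id] cinner_self)
  qed
  also have "(\<Sum>w\<in>W. hs_norm2 (\<lambda>x :: ('i, complex) hsum. hnth x w)) = (\<Sum>w\<in>W. 1)"
    by (intro sum.cong refl hs_norm2_eqI[OF b is_onb_some s])
  also have "complex_of_real (\<Sum>w\<in>W. 1) = of_nat (card W)" by simp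
  finally show ?thesis .
qed

section \<open>Words and projections of the Fock spaces\<close>

lemma fock_basis_eq_single: "fock_basis w = single w 1"
  by (rule hsum_eqI) (simp add: fock_basis.rep_eq hnth_single)

definition words :: "('k::finite \<Rightarrow> nat) \<Rightarrow> ('k \<Rightarrow> nat) \<Rightarrow> ('k \<Rightarrow> nat list) set" where
  "words n q = {\<beta>. \<forall>i. \<beta> i \<in> {w \<in> lists {1..n i}. length w = q i}}"

lemma finite_lists_length: "finite {w \<in> lists {1..m::nat}. length w = q}"
  using finite_lists_length_eq[of "{1..m}" q] by (simp add: lists_eq_set)

lemma finite_lists_length_atMost: "finite {w \<in> lists {1..m::nat}. length w \<le> q}"
  using finite_lists_length_le[of "{1..m}" q] by (simp add: lists_eq_set)

lemma card_lists_length: "card {w \<in> lists {1..m::nat}. length w = q} = m ^ q"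
  using card_lists_length_eq[of "{1..m}" q] by (simp add: lists_eq_set)

lemma finite_words: "finite (words n q)"
  unfolding words_def PiE_UNIV_eq[symmetric] by (intro finite_PiE finite_lists_length) auto

lemma card_words: "card (words n q) = (\<Prod>i\<in>UNIV. n i ^ q i)"
  unfolding words_def PiE_UNIV_eq[symmetric] by (simp only: card_PiE[OF finite] card_lists_length)

lemma words_disjoint: "s \<noteq> t \<Longrightarrow> words n s \<inter> words n t = {}"
  unfolding words_def by (auto simp: fun_eq_iff)

lemma words_subset: "words n q \<subseteq> {\<beta>. \<forall>i. \<beta> i \<in> lists {1..n i}}"
  by (auto simp: words_def)

lemma finite_words_atMost: "finite (\<Union>s\<in>{..q}. words n s)"
  by (intro finite_UN_I finite_atMost_fun finite_words)

lemma card_words_atMost: "card (\<Union>s\<in>{..q}. words n s) = (\<Sum>s\<le>q. \<Prod>i\<in>UNIV. n i ^ s i)"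
  using card_UN_disjoint[of "{..q}" "words n"]
  by (simp add: finite_atMost_fun finite_words words_disjoint card_words)

lemma tensor_proj_eq: "tensor_proj n q = block_op (words n q) id"
proof -
  have "fock_proj (n i) (q i) = block_op {w \<in> lists {1..n i}. length w = q i} id" for i
    unfolding fock_proj_def fock_basis_eq_single by (rule proj_span_single[OF finite_lists_length])
  then show ?thesis
    unfolding tensor_proj_def words_def by (simp only: Tensor_op_block_op)
qed

lemma tensor_proj_le_eq: "tensor_proj_le n q = block_op (\<Union>s\<in>{..q}. words n s) id"
proof -
  have "{\<alpha>. \<forall>i. \<alpha> i \<in> lists {1..n i} \<and> length (\<alpha> i) \<le> q i} = (\<Union>s\<in>{..q}. words n s)"
  proof (intro equalityI subsetI)
    fix \<alpha> assume "\<alpha> \<in> {\<alpha>. \<forall>i. \<alpha> i \<in> lists {1..n i} \<and> length (\<alpha> i) \<le> q i}"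
    then have "\<alpha> \<in> words n (\<lambda>i. length (\<alpha> i))" "(\<lambda>i. length (\<alpha> i)) \<le> q"
      by (auto simp: words_def le_fun_def)
    then show "\<alpha> \<in> (\<Union>s\<in>{..q}. words n s)" by blast
  qed (auto simp: words_def le_fun_def)
  then show ?thesis
    unfolding tensor_proj_le_def fock_basis_eq_single Tensor_single
    by (simp only: proj_span_single[OF finite_words_atMost])
qed

section \<open>Word operators and defect operators\<close>

lemma word_op_Nil: "word_op X [] = id"
  by (simp add: word_op_def fun_eq_iff)

lemma word_op_Cons: "word_op X (j # w) = X j \<circ> word_op X w"
  by (simp add: word_op_def fun_eq_iff)

lemma bounded_clinear_word_op:
  assumes "\<And>j. j \<in> A \<Longrightarrow> bounded_clinear (X j)" "w \<in> lists A"
  shows "bounded_clinear (word_op X w)"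
  using assms(2)
proof (induction w)
  case Nil
  show ?case unfolding word_op_Nil by (rule bounded_clinear_id)
next
  case (Cons j w)
  then show ?case unfolding word_op_Cons by (intro bounded_clinear_comp assms(1))
qed

lemma cadjoint_word_op_Nil: "cadjoint (word_op X []) h = h"
  unfolding word_op_Nil cadjoint_id by (rule id_apply)

lemma cadjoint_word_op_Cons:
  assumes "\<And>j. j \<in> A \<Longrightarrow> bounded_clinear (X j)" "w \<in> lists A" "j \<in> A"
  shows "cadjoint (word_op X (j # w)) = cadjoint (word_op X w) \<circ> cadjoint (X j)"
  unfolding word_op_Cons using assms by (intro cadjoint_comp bounded_clinear_word_op)

lemma cadjoint_word_op_contraction:
  assumes X: "\<And>j. j \<in> A \<Longrightarrow> bounded_clinear (X j)"
    and c: "\<And>j x. j \<in> A \<Longrightarrow> norm (cadjoint (X j) x) \<le> norm x" and "w \<in> lists A"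
  shows "norm (cadjoint (word_op X w) x) \<le> norm x"
  using assms(3)
proof (induction w arbitrary: x)
  case (Cons j w)
  then show ?case
    using order_trans[OF Cons.IH c] by (simp add: cadjoint_word_op_Cons[OF X])
qed (simp add: cadjoint_word_op_Nil)

lemma cinner_id_minus_Phi:
  assumes "\<And>j. j \<in> {1..m} \<Longrightarrow> bounded_clinear (X j)"
  shows "cinner (id_minus_Phi m X D h) h
    = cinner (D h) h - (\<Sum>j=1..m. cinner (D (cadjoint (X j) h)) (cadjoint (X j) h))"
  unfolding id_minus_Phi_def Phi_def cinner.diff_left cinner.sum_left
  by (intro arg_cong2[of _ _ _ _ minus] sum.cong refl cinner_cadjoint assms)

text \<open>Telescoping: \<open>\<Sum> \<Phi>\<^sup>p ((id - \<Phi>) D)\<close>, summed over \<open>p \<le> q\<close>, is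
\<open>D - \<Phi>\<^sup>q\<^sup>+\<^sup>1 D\<close>. Applied index by index, this bounds the Berezin kernel.\<close>

lemma sum_words_id_minus_Phi_le:
  assumes X: "\<And>j. j \<in> {1..m} \<Longrightarrow> bounded_clinear (X j)"
    and D: "\<And>h. 0 \<le> Re (cinner (D h) h)"
  shows "(\<Sum>w\<in>{w \<in> lists {1..m}. length w \<le> q}.
      Re (cinner (id_minus_Phi m X D (cadjoint (word_op X w) h)) (cadjoint (word_op X w) h)))
    \<le> Re (cinner (D h) h)"
proof -
  have eq: "Re (cinner (id_minus_Phi m X D h) h)
      = Re (cinner (D h) h) - (\<Sum>j=1..m. Re (cinner (D (cadjoint (X j) h)) (cadjoint (X j) h)))" for h
    by (subst cinner_id_minus_Phi) (use X in \<open>simp_all only: minus_complex.sel Re_sum\<close>)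
  show ?thesis
  proof (induction q arbitrary: h)
    case 0
    have "{w \<in> lists {1..m}. length w \<le> 0} = {[]}" by auto
    moreover have "0 \<le> (\<Sum>j=1..m. Re (cinner (D (cadjoint (X j) h)) (cadjoint (X j) h)))"
      by (intro sum_nonneg D)
    ultimately show ?case
      by (simp add: cadjoint_word_op_Nil eq)
  next
    case (Suc q)
    let ?W = "\<lambda>q. {w \<in> lists {1..m}. length w \<le> q}"
    define f where "f h w = Re (cinner (id_minus_Phi m X D (cadjoint (word_op X w) h))
      (cadjoint (word_op X w) h))" for h w
    \<comment> \<open>A nonempty word is split at its first letter, whose adjoint acts first; the
      induction hypothesis therefore applies to the vector \<open>cadjoint (X j) h\<close>. The
      empty word supplies the term that cancels the resulting sum.\<close>
    have W: "?W (Suc q) = insert [] ((\<lambda>(j, w). j # w) ` ({1..m} \<times> ?W q))"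
    proof (intro equalityI subsetI)
      fix w assume w: "w \<in> ?W (Suc q)"
      show "w \<in> insert [] ((\<lambda>(j, w). j # w) ` ({1..m} \<times> ?W q))"
      proof (cases w)
        case (Cons j v)
        then have "(j, v) \<in> {1..m} \<times> ?W q" using w by auto
        then show ?thesis unfolding Cons by (intro insertI2 image_eqI[of _ _ "(j, v)"]) simp_all
      qed simp
    qed auto
    have "sum (f h) (?W (Suc q)) = f h [] + sum (f h) ((\<lambda>(j, w). j # w) ` ({1..m} \<times> ?W q))"
      unfolding W
    proof (rule sum.insert)
      show "finite ((\<lambda>(j, w). j # w) ` ({1..m} \<times> ?W q))"
        by (intro finite_imageI finite_cartesian_product finite_lists_length_atMost finite_atLeastAtMost)
    qed auto
    also have "sum (f h) ((\<lambda>(j, w). j # w) ` ({1..m} \<times> ?W q)) = (\<Sum>(j, w)\<in>{1..m} \<times> ?W q. f h (j # w))"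
      by (subst sum.reindex) (auto simp: inj_on_def case_prod_unfold)
    also have "\<dots> = (\<Sum>j=1..m. \<Sum>w\<in>?W q. f h (j # w))"
      by (simp only: sum.cartesian_product)
    also have "\<dots> = (\<Sum>j=1..m. \<Sum>w\<in>?W q. f (cadjoint (X j) h) w)"
    proof (intro sum.cong refl)
      fix j w assume "j \<in> {1..m}" "w \<in> ?W q"
      then have "cadjoint (word_op X (j # w)) = cadjoint (word_op X w) \<circ> cadjoint (X j)"
        using X by (intro cadjoint_word_op_Cons[of "{1..m}"]) auto
      then show "f h (j # w) = f (cadjoint (X j) h) w" by (simp only: f_def o_apply)
    qed
    also have "\<dots> \<le> (\<Sum>j=1..m. Re (cinner (D (cadjoint (X j) h)) (cadjoint (X j) h)))"
      unfolding f_def by (intro sum_mono Suc.IH)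
    also have "f h [] = Re (cinner (D h) h) - \<dots>"
      by (simp add: f_def cadjoint_word_op_Nil eq)
    finally show ?case by (simp add: f_def)
  qed
qed

lemma proj_eq_self: "complex_vector.subspace M \<Longrightarrow> y \<in> M \<Longrightarrow> proj M y = y"
  by (rule proj_eqI) (simp_all add: cinner.zero_left)

lemma subspace_range:
  assumes A: "bounded_clinear A"
  shows "complex_vector.subspace (range A)"
  unfolding complex_vector.subspace_def
  by (auto simp: bounded_clinear_zero[OF A] simp flip: bounded_clinear_add[OF A] bounded_clinear_scaleC[OF A]
      intro: range_eqI[of _ _ 0])

text \<open>Let \<open>z\<close> be the part of \<open>sqrt_op A x\<close> orthogonal to the closed
  range of \<open>A\<close>. Then \<open>cinner (A z) z = 0\<close>, so
  \<open>sqrt_op A z = 0\<close>, so \<open>z\<close> is orthogonal to \<open>sqrt_op A x\<close>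
  and vanishes. Consequently the projection onto the defect space fixes all coefficients of the
  Berezin kernel.\<close>

lemma sqrt_op_in_closure_range:
  assumes A: "positive_op A"
  shows "sqrt_op A x \<in> closure (range A)"
proof -
  note bA = positive_op_bounded[OF A] and S = positive_op_sqrt_op[OF A]
  have "complex_vector.subspace (range A)" by (rule subspace_range[OF bA])
  then have M: "complex_vector.subspace (closure (range A))" "closed (closure (range A))"
    by (simp_all add: closure_csubspace)
  define y where "y = sqrt_op A x"
  define z where "z = y - proj (closure (range A)) y"
  have zM: "cinner z v = 0" if "v \<in> closure (range A)" for v
    unfolding z_def by (rule proj_orthogonal[OF M that])
  have "cinner z (A z) = 0" by (rule zM[OF subsetD[OF closure_subset rangeI]])
  then have "cinner (A z) z = 0" by (metis cinner_commute complex_cnj_zero)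
  then have "cinner (sqrt_op A z) (sqrt_op A z) = 0"
    by (simp add: positive_op_selfadjoint[OF S, symmetric] sqrt_op_square[OF A])
  then have "sqrt_op A z = 0" by (simp add: cinner_eq_0_iff)
  then have "cinner z y = 0"
    unfolding y_def by (simp add: positive_op_selfadjoint[OF S, symmetric] cinner.zero_left)
  then have "cinner z z = 0"
    unfolding z_def[symmetric] using zM[OF proj_in[OF M, of y]]
    by (subst (2) z_def) (simp add: cinner.diff_right)
  then have "y = proj (closure (range A)) y" by (simp add: cinner_eq_0_iff z_def)
  then show ?thesis using proj_in[OF M, of y] by (simp add: y_def)
qed

section \<open>The Berezin kernel\<close>

definition adjoint_word :: "('k \<Rightarrow> nat \<Rightarrow> 'h \<Rightarrow> 'h) \<Rightarrow> ('k \<Rightarrow> nat list) \<Rightarrow> 'k list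
    \<Rightarrow> 'h::chilbert_space \<Rightarrow> 'h" where
  "adjoint_word T \<beta> bs h = foldr (\<lambda>i. cadjoint (word_op (T i) (\<beta> i))) bs h"

definition berezin_coeff :: "('k::{finite,linorder} \<Rightarrow> nat) \<Rightarrow> ('k \<Rightarrow> nat \<Rightarrow> 'h \<Rightarrow> 'h)
    \<Rightarrow> ('k \<Rightarrow> nat list) \<Rightarrow> 'h::chilbert_space \<Rightarrow> 'h" where
  "berezin_coeff n T \<beta> = sqrt_op (Delta n T id) \<circ> adjoint_word T \<beta> indices"

definition word_trace :: "('k::{finite,linorder} \<Rightarrow> nat) \<Rightarrow> ('k \<Rightarrow> nat \<Rightarrow> 'h \<Rightarrow> 'h::chilbert_space)
    \<Rightarrow> ('k \<Rightarrow> nat) \<Rightarrow> real" where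
  "word_trace n T q = (\<Sum>\<beta>\<in>words n q. hs_norm2 (berezin_coeff n T \<beta>))"

lemma set_indices: "set indices = UNIV"
  by (simp add: indices_def)

lemma distinct_indices: "distinct indices"
  by (simp add: indices_def)

lemma filter_singleton:
  assumes "distinct xs" "i \<in> set xs"
  shows "filter (\<lambda>t. t \<in> {i}) xs = [i]"
proof -
  obtain as bs where xs: "xs = as @ i # bs" using assms(2) by (blast dest: split_list)
  then have "filter (\<lambda>t. t \<in> {i}) as = []" "filter (\<lambda>t. t \<in> {i}) bs = []"
    using assms(1) by (auto simp: filter_empty_conv)
  then show ?thesis by (simp add: xs)
qed

lemma foldr_pow_of_bool:
  "foldr (\<lambda>i. F i ^^ of_bool (i \<in> A)) xs Y = foldr F (filter (\<lambda>i. i \<in> A) xs) Y"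
  by (induction xs) auto

lemma foldr_commute:
  assumes "\<And>t h. t \<in> set bs \<Longrightarrow> G (f t h) = f t (G h)"
  shows "G (foldr f bs h) = foldr f bs (G h)"
  using assms by (induction bs) simp_all

lemma adjoint_word_Cons:
  "adjoint_word T \<beta> (i # bs) h = cadjoint (word_op (T i) (\<beta> i)) (adjoint_word T \<beta> bs h)"
  by (simp add: adjoint_word_def)

lemma adjoint_word_append: "adjoint_word T \<beta> (as @ bs) h = adjoint_word T \<beta> as (adjoint_word T \<beta> bs h)"
  by (simp add: adjoint_word_def)

lemma adjoint_word_cong:
  "(\<And>i. i \<in> set bs \<Longrightarrow> \<beta> i = \<gamma> i) \<Longrightarrow> adjoint_word T \<beta> bs h = adjoint_word T \<gamma> bs h"
  unfolding adjoint_word_def by (induction bs) simp_all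

context
  fixes n :: "'k::{finite,linorder} \<Rightarrow> nat"
    and T :: "'k \<Rightarrow> nat \<Rightarrow> 'h::chilbert_space \<Rightarrow> 'h"
  assumes T: "T \<in> regular_polyball n"
begin

lemma polyball_bounded: "j \<in> {1..n i} \<Longrightarrow> bounded_clinear (T i j)"
  using T by (simp add: regular_polyball_def)

lemma polyball_commute:
  assumes "s \<noteq> t" "j \<in> {1..n s}" "l \<in> {1..n t}"
  shows "T s j \<circ> T t l = T t l \<circ> T s j"
  using T assms by (simp add: regular_polyball_def)

lemma partial_defect_positive:
  "positive_op (foldr (\<lambda>i. id_minus_Phi (n i) (T i)) (filter (\<lambda>i. i \<in> A) indices) id)"
proof -
  have "positive_op (Delta_pow n (\<lambda>i. of_bool (i \<in> A)) T id)"
    using T unfolding regular_polyball_def by auto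
  then show ?thesis unfolding Delta_pow_def foldr_pow_of_bool .
qed

text \<open>The defect is a fold from the right, so an argument that removes indices from the front
  meets exactly the defects of suffixes. Each is a polyball condition with exponents 0 and
  1.\<close>

lemma suffix_defect_positive:
  assumes "indices = as @ bs"
  shows "positive_op (foldr (\<lambda>i. id_minus_Phi (n i) (T i)) bs id)"
proof -
  have "set as \<inter> set bs = {}" using distinct_indices[where 'a='k] unfolding assms by simp
  then have "filter (\<lambda>i. i \<in> set bs) as = []" by (auto simp: filter_empty_conv)
  then have "filter (\<lambda>i. i \<in> set bs) indices = bs" unfolding assms by simp
  then show ?thesis using partial_defect_positive[of "set bs"] by simp
qed

lemma Delta_positive: "positive_op (Delta n T id)"
  unfolding Delta_def by (rule suffix_defect_positive[of "[]"]) simp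

text \<open>The polyball condition for the single index \<open>i\<close> bounds the sum of all
  \<open>|T_ij^* x|^2\<close> by \<open>|x|^2\<close>.\<close>

lemma polyball_adjoint_contraction:
  assumes j: "j \<in> {1..n i}"
  shows "norm (cadjoint (T i j) x) \<le> norm x"
proof -
  have "positive_op (id_minus_Phi (n i) (T i) id)"
    using partial_defect_positive[of "{i}"] unfolding filter_singleton[OF distinct_indices, unfolded set_indices, OF UNIV_I]
    by simp
  then have "0 \<le> Re (cinner (id_minus_Phi (n i) (T i) id x) x)"
    by (rule positive_op_Re_nonneg)
  also have "\<dots> = (norm x)\<^sup>2 - (\<Sum>l=1..n i. (norm (cadjoint (T i l) x))\<^sup>2)"
    using cinner_id_minus_Phi[of "n i" "T i" id x, OF polyball_bounded] by (simp add: cinner_self)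
  finally have "(\<Sum>l=1..n i. (norm (cadjoint (T i l) x))\<^sup>2) \<le> (norm x)\<^sup>2" by simp
  moreover have "(norm (cadjoint (T i j) x))\<^sup>2 \<le> (\<Sum>l=1..n i. (norm (cadjoint (T i l) x))\<^sup>2)"
    using j by (intro member_le_sum) auto
  ultimately show ?thesis by (intro power2_le_imp_le[OF _ norm_ge_zero]) linarith
qed

text \<open>With the words of the later indices fixed, the sum over the words of \<open>i\<close>
  telescopes by \<open>sum_words_id_minus_Phi_le\<close>, where the positive defect of the remaining
  suffix takes the role of \<open>D\<close>. The extensional product keeps the choices for different
  suffixes apart.\<close>

lemma sum_suffix_defect_le:
  assumes "indices = as @ bs"
  shows "(\<Sum>\<beta>\<in>Pi\<^sub>E (set bs) (\<lambda>i. {w \<in> lists {1..n i}. length w \<le> Q i}).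
      Re (cinner (foldr (\<lambda>i. id_minus_Phi (n i) (T i)) bs id (adjoint_word T \<beta> bs h)) (adjoint_word T \<beta> bs h)))
    \<le> (norm h)\<^sup>2"
  using assms
proof (induction bs arbitrary: as)
  case Nil
  then show ?case by (simp add: adjoint_word_def Re_cinner_self)
next
  case (Cons i bs)
  let ?W = "\<lambda>i. {w \<in> lists {1..n i}. length w \<le> Q i}"
  let ?D = "foldr (\<lambda>i. id_minus_Phi (n i) (T i))"
  define f where "f bs \<beta> = Re (cinner (?D bs id (adjoint_word T \<beta> bs h)) (adjoint_word T \<beta> bs h))" for bs \<beta>
  have i: "i \<notin> set bs"
    using distinct_indices[where 'a='k] unfolding Cons.prems by simp
  have suffix: "indices = (as @ [i]) @ bs" using Cons.prems by simp
  have "sum (f (i # bs)) (Pi\<^sub>E (set (i # bs)) ?W)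
      = sum (f (i # bs)) ((\<lambda>(w, \<beta>). \<beta>(i := w)) ` (?W i \<times> Pi\<^sub>E (set bs) ?W))"
    by (simp only: list.set(2) PiE_insert_eq)
  also have "\<dots> = (\<Sum>(w, \<beta>)\<in>?W i \<times> Pi\<^sub>E (set bs) ?W. f (i # bs) (\<beta>(i := w)))"
    by (subst sum.reindex[OF inj_combinator[OF i]]) (simp only: o_def case_prod_unfold)
  also have "\<dots> = (\<Sum>w\<in>?W i. \<Sum>\<beta>\<in>Pi\<^sub>E (set bs) ?W. f (i # bs) (\<beta>(i := w)))"
    by (simp only: sum.cartesian_product)
  also have "\<dots> = (\<Sum>\<beta>\<in>Pi\<^sub>E (set bs) ?W. \<Sum>w\<in>?W i. f (i # bs) (\<beta>(i := w)))"
    by (rule sum.swap)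
  also have "\<dots> \<le> (\<Sum>\<beta>\<in>Pi\<^sub>E (set bs) ?W. f bs \<beta>)"
  proof (rule sum_mono)
    fix \<beta>
    let ?h = "adjoint_word T \<beta> bs h"
    have "adjoint_word T (\<beta>(i := w)) bs h = ?h" for w
      by (rule adjoint_word_cong) (use i in auto)
    then have fw: "f (i # bs) (\<beta>(i := w)) = Re (cinner (id_minus_Phi (n i) (T i) (?D bs id)
        (cadjoint (word_op (T i) w) ?h)) (cadjoint (word_op (T i) w) ?h))" for w
      by (simp add: f_def adjoint_word_Cons)
    show "(\<Sum>w\<in>?W i. f (i # bs) (\<beta>(i := w))) \<le> f bs \<beta>"
      unfolding fw f_def[of bs \<beta>]
      by (rule sum_words_id_minus_Phi_le[OF polyball_bounded
            positive_op_Re_nonneg[OF suffix_defect_positive[OF suffix]]])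
  qed
  also have "\<dots> \<le> (norm h)\<^sup>2"
    unfolding f_def by (rule Cons.IH[OF suffix])
  finally show ?case unfolding f_def .
qed

lemma norm_berezin_coeff:
  "(norm (berezin_coeff n T \<beta> h))\<^sup>2
    = Re (cinner (Delta n T id (adjoint_word T \<beta> indices h)) (adjoint_word T \<beta> indices h))"
  using positive_op_selfadjoint[OF positive_op_sqrt_op[OF Delta_positive],
      of "berezin_coeff n T \<beta> h" "adjoint_word T \<beta> indices h"]
  by (simp only: berezin_coeff_def o_apply sqrt_op_square[OF Delta_positive] Re_cinner_self)

lemma sum_norm_berezin_coeff_le:
  assumes F: "finite F" "F \<subseteq> {\<beta>. \<forall>i. \<beta> i \<in> lists {1..n i}}"
  shows "(\<Sum>\<beta>\<in>F. (norm (berezin_coeff n T \<beta> h))\<^sup>2) \<le> (norm h)\<^sup>2"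
proof -
  \<comment> \<open>A crude bound for all lengths occurring in \<open>F\<close>; unlike a maximum,
    the sum also makes sense for empty \<open>F\<close>.\<close>
  define Q where "Q i = (\<Sum>\<beta>\<in>F. length (\<beta> i))" for i
  let ?P = "Pi\<^sub>E (set (indices :: 'k list)) (\<lambda>i. {w \<in> lists {1..n i}. length w \<le> Q i})"
  have "length (\<beta> i) \<le> Q i" if "\<beta> \<in> F" for \<beta> i
    unfolding Q_def using F(1) that by (intro member_le_sum) auto
  then have "F \<subseteq> ?P"
    using F(2) unfolding set_indices PiE_UNIV_eq by blast
  moreover have "finite ?P"
    by (intro finite_PiE finite_lists_length_atMost) simp
  ultimately have "(\<Sum>\<beta>\<in>F. (norm (berezin_coeff n T \<beta> h))\<^sup>2) \<le> (\<Sum>\<beta>\<in>?P. (norm (berezin_coeff n T \<beta> h))\<^sup>2)"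
    by (intro sum_mono2) auto
  also have "\<dots> \<le> (norm h)\<^sup>2"
    unfolding norm_berezin_coeff Delta_def by (rule sum_suffix_defect_le[of "[]"]) simp
  finally show ?thesis .
qed

lemma
  assumes "\<And>i. \<beta> i \<in> lists {1..n i}"
  shows bounded_clinear_adjoint_word: "bounded_clinear (adjoint_word T \<beta> bs)"
    and adjoint_word_contraction: "norm (adjoint_word T \<beta> bs h) \<le> norm h"
proof -
  have b: "bounded_clinear (cadjoint (word_op (T i) (\<beta> i)))" for i
    by (intro bounded_clinear_cadjoint bounded_clinear_word_op[OF polyball_bounded assms])
  show "bounded_clinear (adjoint_word T \<beta> bs)"
  proof (induction bs)
    case Nil
    have "adjoint_word T \<beta> [] = id" by (simp add: adjoint_word_def fun_eq_iff)
    then show ?case by (simp only: bounded_clinear_id)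
  next
    case (Cons i bs)
    have "adjoint_word T \<beta> (i # bs) = cadjoint (word_op (T i) (\<beta> i)) \<circ> adjoint_word T \<beta> bs"
      by (simp add: adjoint_word_Cons fun_eq_iff)
    then show ?case by (simp only: bounded_clinear_comp[OF b Cons])
  qed
  have c: "norm (cadjoint (word_op (T i) (\<beta> i)) x) \<le> norm x" for i x
    by (rule cadjoint_word_op_contraction[OF polyball_bounded polyball_adjoint_contraction assms])
  show "norm (adjoint_word T \<beta> bs h) \<le> norm h"
  proof (induction bs)
    case (Cons i bs)
    then show ?case using order_trans[OF c] by (simp add: adjoint_word_Cons)
  qed (simp add: adjoint_word_def)
qed

lemma bounded_clinear_berezin_coeff:
  assumes "\<And>i. \<beta> i \<in> lists {1..n i}"
  shows "bounded_clinear (berezin_coeff n T \<beta>)"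
  unfolding berezin_coeff_def
  by (rule bounded_clinear_comp[OF positive_op_bounded[OF positive_op_sqrt_op[OF Delta_positive]]
        bounded_clinear_adjoint_word[OF assms]])

text \<open>The coefficients, extended by zero, are square summable by the telescoping bound and so
  define an element of \<open>hsum\<close>; the infinite sum in the definition is its expansion in
  coordinates.\<close>

lemma hnth_berezin_kernel:
  "hnth (berezin_kernel n T h) \<beta> = (if \<forall>i. \<beta> i \<in> lists {1..n i} then berezin_coeff n T \<beta> h else 0)"
proof -
  let ?W = "{\<beta>. \<forall>i. \<beta> i \<in> lists {1..n i}}"
  define f where "f \<beta> = (if \<beta> \<in> ?W then berezin_coeff n T \<beta> h else 0)" for \<beta>
  have "(\<lambda>\<beta>. (norm (f \<beta>))\<^sup>2) summable_on UNIV"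
  proof (rule nonneg_bdd_above_summable_on)
    show "bdd_above (sum (\<lambda>\<beta>. (norm (f \<beta>))\<^sup>2) ` {F. F \<subseteq> UNIV \<and> finite F})"
    proof (rule bdd_aboveI2)
      fix F :: "('k \<Rightarrow> nat list) set" assume "F \<in> {F. F \<subseteq> UNIV \<and> finite F}"
      then have F: "finite F" by simp
      have "(\<Sum>\<beta>\<in>F. (norm (f \<beta>))\<^sup>2) = (\<Sum>\<beta>\<in>F \<inter> ?W. (norm (f \<beta>))\<^sup>2)"
        using F by (intro sum.mono_neutral_right) (auto simp: f_def)
      also have "\<dots> = (\<Sum>\<beta>\<in>F \<inter> ?W. (norm (berezin_coeff n T \<beta> h))\<^sup>2)"
        by (intro sum.cong) (auto simp: f_def)
      also have "\<dots> \<le> (norm h)\<^sup>2"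
        using F by (intro sum_norm_berezin_coeff_le) auto
      finally show "(\<Sum>\<beta>\<in>F. (norm (f \<beta>))\<^sup>2) \<le> (norm h)\<^sup>2" .
    qed
  qed simp
  then have hn: "hnth (Abs_hsum f) = f" by (rule hnth_Abs_hsum)
  have "((\<lambda>\<beta>. single \<beta> (hnth (Abs_hsum f) \<beta>)) has_sum Abs_hsum f) ?W"
    by (rule hsum_has_sum_single) (simp only: hn f_def if_False)
  then have "((\<lambda>\<beta>. single \<beta> (berezin_coeff n T \<beta> h)) has_sum Abs_hsum f) ?W"
    by (rule iffD1[OF has_sum_cong, rotated]) (simp only: hn f_def if_True)
  then have "berezin_kernel n T h = Abs_hsum f"
    unfolding berezin_kernel_def fock_basis_eq_single Tensor_single tensor_single
      berezin_coeff_def o_apply adjoint_word_def by (rule infsumI)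
  then show ?thesis by (simp only: hn f_def mem_Collect_eq)
qed

lemma bounded_clinear_berezin_kernel: "bounded_clinear (berezin_kernel n T)"
proof (rule bounded_clinearI)
  show "norm (berezin_kernel n T h) \<le> 1 * norm h" for h
    unfolding mult_1
  proof (rule hsum_norm_leI)
    fix F :: "('k \<Rightarrow> nat list) set" assume F: "finite F"
    let ?W = "{\<beta>. \<forall>i. \<beta> i \<in> lists {1..n i}}"
    have "(\<Sum>\<beta>\<in>F. (norm (hnth (berezin_kernel n T h) \<beta>))\<^sup>2)
        = (\<Sum>\<beta>\<in>F \<inter> ?W. (norm (hnth (berezin_kernel n T h) \<beta>))\<^sup>2)"
      using F by (intro sum.mono_neutral_right) (auto simp: hnth_berezin_kernel)
    also have "\<dots> = (\<Sum>\<beta>\<in>F \<inter> ?W. (norm (berezin_coeff n T \<beta> h))\<^sup>2)"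
      by (intro sum.cong refl) (simp add: hnth_berezin_kernel)
    also have "\<dots> \<le> (norm h)\<^sup>2"
      using F by (intro sum_norm_berezin_coeff_le) auto
    finally show "(\<Sum>\<beta>\<in>F. (norm (hnth (berezin_kernel n T h) \<beta>))\<^sup>2) \<le> (norm h)\<^sup>2" .
  qed simp
next
  show "berezin_kernel n T (x + y) = berezin_kernel n T x + berezin_kernel n T y" for x y
  proof (rule hsum_eqI)
    fix \<beta> show "hnth (berezin_kernel n T (x + y)) \<beta> = hnth (berezin_kernel n T x + berezin_kernel n T y) \<beta>"
      unfolding hnth_add hnth_berezin_kernel
      by (auto intro: bounded_clinear_add bounded_clinear_berezin_coeff simp del: One_nat_def)
  qed
  show "berezin_kernel n T (c *\<^sub>C x) = c *\<^sub>C berezin_kernel n T x" for c x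
  proof (rule hsum_eqI)
    fix \<beta> show "hnth (berezin_kernel n T (c *\<^sub>C x)) \<beta> = hnth (c *\<^sub>C berezin_kernel n T x) \<beta>"
      unfolding hnth_scaleC hnth_berezin_kernel
      by (auto intro: bounded_clinear_scaleC bounded_clinear_berezin_coeff simp del: One_nat_def)
  qed
qed

context
  assumes tr: "trace_class_defect n T"
begin

lemma hilbert_schmidt_berezin_coeff:
  assumes "\<And>i. \<beta> i \<in> lists {1..n i}"
  shows "hilbert_schmidt (berezin_coeff n T \<beta>)"
  unfolding berezin_coeff_def
  by (rule hilbert_schmidt_comp_right[OF
        hilbert_schmidt_sqrt_op[OF Delta_positive tr[unfolded trace_class_defect_def]]
        bounded_clinear_adjoint_word[OF assms] adjoint_word_contraction[OF assms]])

text \<open>The form of the compression at \<open>h\<close> is the sum of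
  \<open>|C_\<beta> h|^2\<close> over \<open>W\<close>, since the projection onto the defect space
  fixes every \<open>C_\<beta> h\<close>.\<close>

lemma trace_berezin_compression:
  assumes W: "finite W" "W \<subseteq> {\<beta>. \<forall>i. \<beta> i \<in> lists {1..n i}}"
  shows "trace_op (berezin_compression n T (block_op W id))
    = complex_of_real (\<Sum>\<beta>\<in>W. hs_norm2 (berezin_coeff n T \<beta>))"
proof (rule trace_op_sum_squares)
  show "hilbert_schmidt (berezin_coeff n T \<beta>)" if "\<beta> \<in> W" for \<beta>
    using W(2) that by (intro hilbert_schmidt_berezin_coeff) auto
  fix h
  let ?M = "defect_space n T" and ?K = "berezin_kernel n T"
  note bD = positive_op_bounded[OF Delta_positive]
  have "complex_vector.subspace (range (Delta n T id))" by (rule subspace_range[OF bD])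
  then have M: "complex_vector.subspace ?M" "closed ?M"
    unfolding defect_space_def by (simp_all add: closure_csubspace)
  note bP = bounded_clinear_proj[OF M]
  have cM: "proj ?M (berezin_coeff n T \<beta> h) = berezin_coeff n T \<beta> h" for \<beta>
    by (rule proj_eq_self[OF M(1)])
      (simp add: berezin_coeff_def defect_space_def sqrt_op_in_closure_range[OF Delta_positive])
  have "cinner (berezin_compression n T (block_op W id) h) h = cinner (block_op W (proj ?M) (?K h)) (?K h)"
    unfolding berezin_compression_def tensor_op_block_op[OF bP] o_apply
    by (rule cinner_cadjoint'[OF bounded_clinear_berezin_kernel])
  also have "\<dots> = (\<Sum>\<beta>\<in>W. cinner (hnth (block_op W (proj ?M) (?K h)) \<beta>) (hnth (?K h) \<beta>))"
    by (rule cinner_hsum_supp[OF W(1)]) (simp add: hnth_block_op[OF bP])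
  also have "\<dots> = (\<Sum>\<beta>\<in>W. complex_of_real ((norm (berezin_coeff n T \<beta> h))\<^sup>2))"
  proof (rule sum.cong[OF refl])
    fix \<beta> assume "\<beta> \<in> W"
    then have "\<forall>i. \<beta> i \<in> lists {1..n i}" using W(2) by blast
    then have "hnth (?K h) \<beta> = berezin_coeff n T \<beta> h" by (simp only: hnth_berezin_kernel if_True simp_thms)
    then show "cinner (hnth (block_op W (proj ?M) (?K h)) \<beta>) (hnth (?K h) \<beta>)
        = complex_of_real ((norm (berezin_coeff n T \<beta> h))\<^sup>2)"
      using \<open>\<beta> \<in> W\<close> by (simp only: hnth_block_op[OF bP] if_True cM cinner_self)
  qed
  finally show "cinner (berezin_compression n T (block_op W id) h) h
      = complex_of_real (\<Sum>\<beta>\<in>W. (norm (berezin_coeff n T \<beta> h))\<^sup>2)"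
    by (simp only: of_real_sum)
qed

end

section \<open>Growth of the traces from one degree to the next\<close>

lemma cadjoint_word_op_commute:
  assumes "i \<noteq> t" "j \<in> {1..n i}" "w \<in> lists {1..n t}"
  shows "cadjoint (T i j) (cadjoint (word_op (T t) w) h) = cadjoint (word_op (T t) w) (cadjoint (T i j) h)"
proof -
  have "T i j \<circ> word_op (T t) w = word_op (T t) w \<circ> T i j"
    using assms(3)
  proof (induction w)
    case (Cons l w)
    then show ?case
      using polyball_commute[OF assms(1,2), of l] unfolding word_op_Cons by (metis comp_assoc)
  qed (simp add: word_op_Nil)
  then have "cadjoint (T i j \<circ> word_op (T t) w) = cadjoint (word_op (T t) w \<circ> T i j)" by (simp only:)
  moreover have "bounded_clinear (word_op (T t) w)"
    by (rule bounded_clinear_word_op[OF polyball_bounded assms(3)])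
  ultimately show ?thesis
    using polyball_bounded[OF assms(2)] by (simp add: cadjoint_comp fun_eq_iff)
qed

text \<open>Within tuple \<open>i\<close> the adjoint of the prepended letter acts first. It moves
  right past the adjoints of the tuples in \<open>bs\<close>; those in \<open>as\<close> act later
  and are untouched.\<close>

lemma berezin_coeff_Cons:
  assumes \<beta>: "\<And>i. \<beta> i \<in> lists {1..n i}" and j: "j \<in> {1..n i}"
  shows "berezin_coeff n T (\<beta>(i := j # \<beta> i)) = berezin_coeff n T \<beta> \<circ> cadjoint (T i j)"
proof -
  obtain as bs where ind: "indices = as @ i # bs"
    using split_list[of i "indices :: 'k list"] by (auto simp: set_indices)
  then have i: "i \<notin> set as" "i \<notin> set bs"
    using distinct_indices[where 'a='k] unfolding ind by simp_all
  let ?\<gamma> = "\<beta>(i := j # \<beta> i)"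
  have "adjoint_word T ?\<gamma> indices h = adjoint_word T \<beta> indices (cadjoint (T i j) h)" for h
  proof -
    have "cadjoint (T i j) (adjoint_word T \<beta> bs h) = adjoint_word T \<beta> bs (cadjoint (T i j) h)"
      unfolding adjoint_word_def
      by (rule foldr_commute, rule cadjoint_word_op_commute) (use i j \<beta> in auto)
    moreover have "cadjoint (word_op (T i) (j # \<beta> i)) = cadjoint (word_op (T i) (\<beta> i)) \<circ> cadjoint (T i j)"
      by (rule cadjoint_word_op_Cons[OF polyball_bounded \<beta> j])
    moreover have "adjoint_word T ?\<gamma> bs h = adjoint_word T \<beta> bs h" for h
      by (rule adjoint_word_cong) (use i in auto)
    moreover have "adjoint_word T ?\<gamma> as h = adjoint_word T \<beta> as h" for h
      by (rule adjoint_word_cong) (use i in auto)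
    ultimately show ?thesis
      by (simp add: ind adjoint_word_append adjoint_word_Cons)
  qed
  then show ?thesis by (simp add: berezin_coeff_def fun_eq_iff)
qed

text \<open>A tuple of the larger degree arises from exactly one of the \<open>n i\<close> letters
  and one tuple of degree \<open>q\<close>. Its coefficient is the old one followed on the right by
  a contraction, so the Hilbert-Schmidt norm does not grow.\<close>

lemma word_trace_Suc_le:
  assumes tr: "trace_class_defect n T"
  shows "word_trace n T (q(i := Suc (q i))) \<le> real (n i) * word_trace n T q"
proof -
  let ?f = "\<lambda>(j, \<beta>). \<beta>(i := j # \<beta> i)"
  have W: "words n (q(i := Suc (q i))) = ?f ` ({1..n i} \<times> words n q)"
  proof (intro equalityI subsetI)
    fix \<gamma> assume \<gamma>: "\<gamma> \<in> words n (q(i := Suc (q i)))"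
    then have "\<gamma> i \<in> lists {1..n i}" "length (\<gamma> i) = Suc (q i)"
      unfolding words_def by (auto dest: spec[of _ i])
    then obtain j w where jw: "\<gamma> i = j # w" "j \<in> {1..n i}" "w \<in> lists {1..n i}" "length w = q i"
      by (cases "\<gamma> i") auto
    have "\<gamma>(i := w) \<in> words n q"
      using \<gamma> jw unfolding words_def by auto
    moreover have "\<gamma> = ?f (j, \<gamma>(i := w))" using jw(1) by (simp add: fun_eq_iff)
    ultimately show "\<gamma> \<in> ?f ` ({1..n i} \<times> words n q)" using jw(2) by blast
  next
    fix \<gamma> assume "\<gamma> \<in> ?f ` ({1..n i} \<times> words n q)"
    then obtain j \<beta> where j: "j \<in> {1..n i}" and \<beta>: "\<beta> \<in> words n q" and \<gamma>: "\<gamma> = \<beta>(i := j # \<beta> i)"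
      by auto
    have "\<beta> t \<in> lists {1..n t}" "length (\<beta> t) = q t" for t
      using \<beta> unfolding words_def by blast+
    then show "\<gamma> \<in> words n (q(i := Suc (q i)))"
      using j unfolding words_def \<gamma> by simp
  qed
  have inj: "inj_on ?f ({1..n i} \<times> words n q)"
  proof (rule inj_onI, clarify)
    fix j \<beta> l \<gamma> assume eq: "\<beta>(i := j # \<beta> i) = \<gamma>(i := l # \<gamma> i)"
    have "\<beta> t = \<gamma> t" for t
      using fun_cong[OF eq, of t] by (cases "t = i") auto
    then have "\<beta> = \<gamma>" by (rule ext)
    then show "j = l \<and> \<beta> = \<gamma>" using fun_cong[OF eq, of i] by simp
  qed
  have "word_trace n T (q(i := Suc (q i)))
      = (\<Sum>(j, \<beta>)\<in>{1..n i} \<times> words n q. hs_norm2 (berezin_coeff n T (\<beta>(i := j # \<beta> i))))"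
    unfolding word_trace_def W by (subst sum.reindex[OF inj]) (simp add: case_prod_unfold)
  also have "\<dots> \<le> (\<Sum>(j, \<beta>)\<in>{1..n i} \<times> words n q. hs_norm2 (berezin_coeff n T \<beta>))"
  proof (rule sum_mono, clarify)
    fix j \<beta> assume j: "j \<in> {1..n i}" and "\<beta> \<in> words n q"
    then have \<beta>: "\<beta> t \<in> lists {1..n t}" for t by (auto simp: words_def)
    show "hs_norm2 (berezin_coeff n T (\<beta>(i := j # \<beta> i))) \<le> hs_norm2 (berezin_coeff n T \<beta>)"
      unfolding berezin_coeff_Cons[OF \<beta> j]
      by (rule hs_norm2_comp_right_le[OF hilbert_schmidt_berezin_coeff[OF tr \<beta>]
            bounded_clinear_cadjoint[OF polyball_bounded[OF j]] polyball_adjoint_contraction[OF j]])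
  qed
  also have "\<dots> = real (n i) * word_trace n T q"
    by (simp add: word_trace_def flip: sum.cartesian_product)
  finally show ?thesis .
qed

lemma trace_ratio_tensor_proj:
  assumes tr: "trace_class_defect n T"
  shows "trace_ratio n T (tensor_proj n q)
    = complex_of_real (word_trace n T q / (\<Prod>i\<in>UNIV. real (n i) ^ q i))"
  unfolding trace_ratio_def tensor_proj_eq trace_berezin_compression[OF tr finite_words words_subset]
    trace_op_block_op_id[OF finite_words] card_words word_trace_def
  by simp

lemma trace_ratio_tensor_proj_le:
  assumes tr: "trace_class_defect n T"
  shows "trace_ratio n T (tensor_proj_le n q)
    = complex_of_real ((\<Sum>s\<le>q. word_trace n T s) / (\<Sum>s\<le>q. \<Prod>i\<in>UNIV. real (n i) ^ s i))"
proof -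
  have W: "(\<Union>s\<in>{..q}. words n s) \<subseteq> {\<beta>. \<forall>i. \<beta> i \<in> lists {1..n i}}"
    using words_subset by blast
  have "(\<Sum>\<beta>\<in>(\<Union>s\<in>{..q}. words n s). hs_norm2 (berezin_coeff n T \<beta>)) = (\<Sum>s\<le>q. word_trace n T s)"
    unfolding word_trace_def
    by (intro sum.UNION_disjoint finite_atMost_fun ballI impI finite_words words_disjoint)
  then show ?thesis
    unfolding trace_ratio_def tensor_proj_le_eq trace_berezin_compression[OF tr finite_words_atMost W]
      trace_op_block_op_id[OF finite_words_atMost] card_words_atMost
    by simp
qed

end

section \<open>The curvature\<close>

text \<open>\<open>curv\<close> is defined with \<open>lim\<close>, whose value says nothing for a
  divergent sequence; existence of the curvature is therefore a separate conjunct.\<close>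

theorem theorem1p3:
  fixes n :: "'k::{finite,linorder} \<Rightarrow> nat"
    and T :: "'k \<Rightarrow> nat \<Rightarrow> 'h::chilbert_space \<Rightarrow> 'h"
  assumes "\<forall>i. n i \<ge> 1"
    and "T \<in> regular_polyball n"
    and "trace_class_defect n T"
  shows "convergent (curv_mean n T) \<and>
    ((\<lambda>q :: 'k \<Rightarrow> nat. trace_ratio n T (tensor_proj n q)) \<longlongrightarrow> curv n T) at_top \<and>
    (\<lambda>m. 1 / of_nat ((m + CARD('k) - 1) choose (CARD('k) - 1)) *
        (\<Sum>q | (\<Sum>i\<in>UNIV. q i) = m. trace_ratio n T (tensor_proj n q))) \<longlonglongrightarrow> curv n T \<and>
    has_iterated_limit indices (\<lambda>q. trace_ratio n T (tensor_proj_le n q)) (\<lambda>_. 0) (curv n T)"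
proof -
  note n = assms(1)[rule_format] and tr = assms(3)
  define r where "r q = word_trace n T q / word_weight n q" for q
  define c where "c = (INF q. r q)"
  have pos: "0 < word_weight n q" for q by (rule word_weight_pos[OF n])
  have ratio: "trace_ratio n T (tensor_proj n q) = complex_of_real (r q)" for q
    unfolding r_def word_weight_def by (rule trace_ratio_tensor_proj[OF assms(2) tr])
  have ratio_le: "trace_ratio n T (tensor_proj_le n q) = complex_of_real (box_average n r q)" for q
  proof -
    have "word_weight n s * r s = word_trace n T s" for s using pos[of s] by (simp add: r_def)
    then show ?thesis
      unfolding box_average_def
      by (simp only: trace_ratio_tensor_proj_le[OF assms(2) tr] word_weight_def[symmetric])
  qed
  have r0: "0 \<le> r q" for q
    unfolding r_def word_trace_def
    by (intro divide_nonneg_pos pos sum_nonneg hs_norm2_nonneg)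
  have "r (q(i := Suc (q i))) \<le> r q" for q i
  proof -
    have ni: "0 < real (n i)" using n[of i] by simp
    \<comment> \<open>Both weights are computed from the common base point \<open>q(i := 0)\<close>,
      because \<open>word_weight_update\<close> starts from a zero coordinate.\<close>
    have w: "word_weight n (q(i := Suc (q i))) = real (n i) * word_weight n q"
      using word_weight_update[of "q(i := 0)" i n "Suc (q i)"] word_weight_update[of "q(i := 0)" i n "q i"]
      by simp
    have "r (q(i := Suc (q i))) \<le> (real (n i) * word_trace n T q) / (real (n i) * word_weight n q)"
      unfolding r_def w
      by (intro divide_right_mono word_trace_Suc_le[OF assms(2) tr] mult_nonneg_nonneg less_imp_le[OF pos] less_imp_le[OF ni])
    then show ?thesis using ni by (simp add: r_def)
  qed
  then have anti: "p \<le> q \<Longrightarrow> r q \<le> r p" for p q by (rule antimono_fun_steps)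
  have bdd: "bdd_below (range r)" by (rule bdd_belowI2[of _ 0]) (rule r0)
  have lower: "c \<le> r q" for q unfolding c_def by (rule cINF_lower[OF bdd UNIV_I])
  have approx: "\<exists>q. r q < c + e" if "e > 0" for e
  proof -
    have "c < c + e" using that by simp
    then show ?thesis unfolding c_def by (subst (asm) cINF_less_iff[OF _ bdd]) auto
  qed
  have mean: "curv_mean n T = (\<lambda>m. complex_of_real
      ((\<Sum>q | (\<Sum>i\<in>UNIV. q i) \<le> m. r q) / real ((m + CARD('k)) choose CARD('k))))"
    unfolding curv_mean_def ratio by (simp add: fun_eq_iff)
  have lim: "curv_mean n T \<longlonglongrightarrow> complex_of_real c"
    unfolding mean by (intro tendsto_of_real simplex_averages_tendsto anti lower approx)
  then have curv: "curv n T = complex_of_real c"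
    unfolding curv_def by (rule limI)
  have net: "((\<lambda>q. trace_ratio n T (tensor_proj n q)) \<longlongrightarrow> curv n T) at_top"
    unfolding ratio curv by (intro tendsto_of_real antitone_net_tendsto anti lower approx)
  have "(\<lambda>m. complex_of_real ((\<Sum>q | (\<Sum>i\<in>UNIV. q i) = m. r q)
      / real ((m + CARD('k) - 1) choose (CARD('k) - 1)))) \<longlonglongrightarrow> curv n T"
    unfolding curv by (intro tendsto_of_real simplex_boundary_averages_tendsto anti lower approx)
  then have boundary: "(\<lambda>m. 1 / of_nat ((m + CARD('k) - 1) choose (CARD('k) - 1)) *
      (\<Sum>q | (\<Sum>i\<in>UNIV. q i) = m. trace_ratio n T (tensor_proj n q))) \<longlonglongrightarrow> curv n T"
    unfolding ratio by simp
  have "has_iterated_limit indices (box_average n r) (\<lambda>_. 0) c"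
  proof (rule has_iterated_limit_antimono[OF _ _ set_indices])
    show "p \<le> q \<Longrightarrow> box_average n r q \<le> box_average n r p" for p q
      by (rule box_average_antimono[OF n anti])
    show "c \<le> box_average n r q" for q by (rule box_average_ge[OF n lower])
    show "(\<lambda>m. box_average n r (\<lambda>_. m)) \<longlonglongrightarrow> c"
      by (rule box_average_tendsto[OF n anti lower approx])
  qed
  then have "has_iterated_limit indices (\<lambda>q. trace_ratio n T (tensor_proj_le n q)) (\<lambda>_. 0) (curv n T)"
    unfolding ratio_le curv by (rule has_iterated_limit_of_real)
  then show ?thesis
    using convergentI[OF lim] net boundary by blast
qed

end
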